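(* Let $\mathscr{A}$ be a nonunital C*-algebra, $\mathcal{H}$ a Hilbert space, and let $\phi=(\phi_k)_{k} \in c_0(B(\mathscr{A}))$ be a vanishing sequence of bounded *-maps on $\mathscr{A}$ (possibly of finite length). Denote $\xi(a) = \operatorname{diag}\{\phi_k (a)\}_{k}$ for $a\in\mathscr{A}$ and $\mathscr{X} = \xi(\mathscr{A})$. If $\mathscr{X}$ is a C*-algebra, then a map $\varphi \in B(\mathscr{A},B(\mathcal{H}))$ is $\phi$-decomposable if and only if for every $n\in\mathbb{N}$ and every $[a_{ij}]_{i,j}\in \mathbb{M}_n(\mathscr{A})$, $$[a_{ij}]_{i,j} \in \Gamma_{n}^{+}(\phi) \ \Longrightarrow\ [\varphi(a_{ij})]_{i,j} \in \mathbb{M}_n(B(\mathcal{H}))^+ .$$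
   Context: For a C*-algebra $\mathscr{M}$, $\mathscr{M}^+$ denotes its convex cone of positive elements and $\mathbb{M}_n(\mathscr{M})\simeq \mathbb{M}_n(\mathbb{C})\otimes\mathscr{M}$ the C*-algebra of $n\times n$ matrices over $\mathscr{M}$. A *-map is a linear map $f$ with $f(a^* )=f(a)^*$ for all $a$. A map $\psi:\mathscr{A}\to B(\mathcal{H})$ is completely positive (c.p.) if it is a bounded *-map and $\mathrm{id}_n\otimes\psi:\mathbb{M}_n(\mathscr{A})\to\mathbb{M}_n(B(\mathcal{H}))$, $[a_{ij}]\mapsto[\psi(a_{ij})]$, maps positive elements to positive elements for all $n\in\mathbb{N}$. $B(\mathscr{A},B(\mathcal{H}))$ denotes the bounded linear maps from $\mathscr{A}$ to $B(\mathcal{H})$, and $B(\mathscr{A})$ the bounded linear maps on $\mathscr{A}$. $\phi=(\phi_k)_k\in c_0(B(\mathscr{A}))$ means that the $\phi_k$ are bounded linear maps on $\mathscr{A}$ with $(\|\phi_k\|)_k$ uniformly bounded and $\|\phi_k\|\to0$ as $k\to\infty$ (a vanishing sequence); a finite tuple is regarded as a sequence with only finitely many nonzero terms. A map $\varphi\in B(\mathscr{A},B(\mathcal{H}))$ is $\phi$-decomposable (countably decomposable with respect to $\phi$) if there is a sequence $(\psi_k)_k$ of c.p. maps $\mathscr{A}\to B(\mathcal{H})$ such that $\varphi(a)=\sum_{k}\psi_k(\phi_k(a))$ for every $a\in\mathscr{A}$, the series converging in the norm of $B(\mathcal{H})$. For $n\in\mathbb{N}$, $\Gamma_n^+(\phi)=\{[a_{ij}]_{i,j}\in\mathbb{M}_n(\mathscr{A})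 : [\phi_k(a_{ij})]_{i,j}\in\mathbb{M}_n(\mathscr{A})^+ \text{ for all } k\}$. For a sequence $(a_k)_k$ in $\mathscr{A}$ with $\|a_k\|\to0$, $\operatorname{diag}\{a_k\}_k=\sum_{k}E_{kk}\otimes a_k$ is an element of the spatial tensor product $B(l^2)\hat{\otimes}_{\min}\mathscr{A}$, where $E_{kk}$ is the rank-one projection onto the $k$-th standard basis vector of $l^2$; its norm is $\sup_k\|a_k\|$. The set of all such elements is thereby identified with $c_0(\mathscr{A})$, the norm-vanishing sequences in $\mathscr{A}$ with entrywise operations and supremum norm. "$\mathscr{X}$ is a C*-algebra" refers to the operations and norm inherited from this C*-algebra. *)

theory Defs
  imports "HOL-Analysis.Analysis" "Jordan_Normal_Form.Matrix"
begin

section \<open>Complex normed spaces, C*-algebras and Hilbert spaces\<close>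

class scaleC =
  fixes scaleC :: "complex \<Rightarrow> 'a \<Rightarrow> 'a"  (infixr \<open>*\<^sub>C\<close> 75)

class complex_normed_vector = real_normed_vector + scaleC +
  assumes scaleC_add_right: "c *\<^sub>C (x + y) = c *\<^sub>C x + c *\<^sub>C y"
    and scaleC_add_left: "(c + d) *\<^sub>C x = c *\<^sub>C x + d *\<^sub>C x"
    and scaleC_scaleC: "c *\<^sub>C d *\<^sub>C x = (c * d) *\<^sub>C x"
    and scaleC_of_real: "complex_of_real r *\<^sub>C x = r *\<^sub>R x"
    and norm_scaleC: "norm (c *\<^sub>C x) = cmod c * norm x"

class star =
  fixes star :: "'a \<Rightarrow> 'a"

text \<open>C*-algebras are not assumed to have a unit.\<close>

class cstar_algebra = complex_normed_vector + real_normed_algebra + banach + star +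
  assumes scaleC_mult_left: "(c *\<^sub>C x) * y = c *\<^sub>C (x * y)"
    and scaleC_mult_right: "x * (c *\<^sub>C y) = c *\<^sub>C (x * y)"
    and star_add: "star (x + y) = star x + star y"
    and star_scaleC: "star (c *\<^sub>C x) = cnj c *\<^sub>C star x"
    and star_mult: "star (x * y) = star y * star x"
    and star_star: "star (star x) = x"
    and cstar_identity: "norm (star x * x) = (norm x)\<^sup>2"

class complex_hilbert_space = complex_normed_vector + banach +
  fixes cinner :: "'a \<Rightarrow> 'a \<Rightarrow> complex"
  assumes cinner_add_right: "cinner x (y + z) = cinner x y + cinner x z"
    and cinner_scaleC_right: "cinner x (c *\<^sub>C y) = c * cinner x y"
    and cinner_commute: "cinner y x = cnj (cinner x y)"
    and cinner_self: "cinner x x = complex_of_real ((norm x)\<^sup>2)"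

lemma scaleC_simps:
  fixes x y :: "'a::complex_normed_vector"
  shows scaleC_zero_left [simp]: "0 *\<^sub>C x = 0"
    and scaleC_zero_right [simp]: "c *\<^sub>C (0::'a) = 0"
    and scaleC_one [simp]: "1 *\<^sub>C x = x"
    and scaleC_minus_right [simp]: "c *\<^sub>C (- x) = - (c *\<^sub>C x)"
    and scaleC_diff_right: "c *\<^sub>C (x - y) = c *\<^sub>C x - c *\<^sub>C y"
proof -
  show z: "c *\<^sub>C (0::'a) = 0"
    using norm_scaleC[of c "0::'a"] by simp
  show "0 *\<^sub>C x = 0" "1 *\<^sub>C x = x"
    using scaleC_of_real[of 0 x] scaleC_of_real[of 1 x] by simp_all
  show m: "c *\<^sub>C (- x) = - (c *\<^sub>C x)" for x :: 'a
    using scaleC_add_right[of c "-x" x] z by (simp add: eq_neg_iff_add_eq_0)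
  show "c *\<^sub>C (x - y) = c *\<^sub>C x - c *\<^sub>C y"
    using scaleC_add_right[of c x "- y"] m by simp
qed

lemma scaleC_scaleR_commute:
  fixes x :: "'a::complex_normed_vector"
  shows "c *\<^sub>C r *\<^sub>R x = r *\<^sub>R c *\<^sub>C x"
  by (metis mult.commute scaleC_of_real scaleC_scaleC)

lemma bounded_linear_scaleC: "bounded_linear (\<lambda>x::'a::complex_normed_vector. c *\<^sub>C x)"
  by (rule bounded_linear_intro[where K = "cmod c"])
    (simp_all add: scaleC_add_right scaleC_scaleR_commute norm_scaleC)

definition bounded_clinear :: "('a::complex_normed_vector \<Rightarrow> 'b::complex_normed_vector) \<Rightarrow> bool" where
  "bounded_clinear f \<longleftrightarrow> bounded_linear f \<and> (\<forall>c x. f (c *\<^sub>C x) = c *\<^sub>C f x)"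

lemma norm_star [simp]:
  fixes x :: "'a::cstar_algebra"
  shows "norm (star x) = norm x"
proof -
  have le: "norm x \<le> norm (star x)" for x :: 'a
  proof (cases "norm x = 0")
    case False
    have "norm x * norm x \<le> norm (star x) * norm x"
      using norm_mult_ineq[of "star x" x] by (simp add: cstar_identity power2_eq_square)
    then show ?thesis using False by simp
  qed simp
  show ?thesis using le[of x] le[of "star x"] by (simp add: star_star)
qed

section \<open>Adjoints\<close>

lemma cinner_simps:
  fixes x y z :: "'a::complex_hilbert_space"
  shows cinner_add_left: "cinner (x + y) z = cinner x z + cinner y z"
    and cinner_scaleC_left: "cinner (c *\<^sub>C x) z = cnj c * cinner x z"
    and cinner_scaleR_right: "cinner x (r *\<^sub>R y) = complex_of_real r * cinner x y"
    and cinner_scaleR_left: "cinner (r *\<^sub>R x) y = complex_of_real r * cinner x y"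
    and cinner_minus_right [simp]: "cinner x (- y) = - cinner x y"
    and cinner_minus_left [simp]: "cinner (- x) y = - cinner x y"
    and cinner_diff_right: "cinner x (y - z) = cinner x y - cinner x z"
    and cinner_diff_left: "cinner (x - y) z = cinner x z - cinner y z"
    and cinner_zero_right [simp]: "cinner x 0 = 0"
    and cinner_zero_left [simp]: "cinner 0 x = 0"
proof -
  show al: "cinner (x + y) z = cinner x z + cinner y z" for x y z :: 'a
    by (metis cinner_add_right cinner_commute complex_cnj_add)
  show "cinner (c *\<^sub>C x) z = cnj c * cinner x z" for c and x z :: 'a
    by (metis cinner_scaleC_right cinner_commute complex_cnj_mult)
  then show "cinner (r *\<^sub>R x) y = complex_of_real r * cinner x y" for r and x y :: 'a
    by (metis scaleC_of_real complex_cnj_complex_of_real)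
  show "cinner x (r *\<^sub>R y) = complex_of_real r * cinner x y" for r and x y :: 'a
    by (metis scaleC_of_real cinner_scaleC_right)
  show z: "cinner x 0 = 0" for x :: 'a
    using cinner_add_right[of x 0 0] by simp
  show zl: "cinner 0 x = 0" for x :: 'a
    using al[of 0 0 x] by simp
  show m: "cinner x (- y) = - cinner x y" for x y :: 'a
    using cinner_add_right[of x y "- y"] z by (simp add: eq_neg_iff_add_eq_0 add.commute)
  show ml: "cinner (- x) y = - cinner x y" for x y :: 'a
    using al[of x "- x" y] zl by (simp add: eq_neg_iff_add_eq_0 add.commute)
  show "cinner x (y - z) = cinner x y - cinner x z"
    using cinner_add_right[of x y "- z"] m by simp
  show "cinner (x - y) z = cinner x z - cinner y z"
    using al[of x "- y" z] ml by simp
qed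

lemma norm_add_sq:
  fixes x y :: "'a::complex_hilbert_space"
  shows "(norm (x + y))\<^sup>2 = (norm x)\<^sup>2 + 2 * Re (cinner x y) + (norm y)\<^sup>2"
proof -
  have "complex_of_real ((norm (x + y))\<^sup>2) = cinner (x + y) (x + y)"
    by (simp only: cinner_self)
  also have "\<dots> = cinner x x + cinner x y + cnj (cinner x y) + cinner y y"
    by (simp add: cinner_add_left cinner_add_right cinner_commute[of x y])
  finally have "Re (complex_of_real ((norm (x + y))\<^sup>2)) = Re (cinner x x + cinner x y + cnj (cinner x y) + cinner y y)"
    by (rule arg_cong)
  then show ?thesis by (simp add: cinner_self flip: of_real_power)
qed

lemma quadratic_nonneg_linear_zero:
  fixes a b :: real
  assumes "\<And>t. t\<^sup>2 * a + 2 * t * b \<ge> 0"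
  shows "b = 0"
proof (rule ccontr)
  assume b: "b \<noteq> 0"
  define K where "K = \<bar>a\<bar> + 1"
  have K: "K > 0" "a < K" unfolding K_def by auto
  have "0 \<le> (- b / K)\<^sup>2 * a + 2 * (- b / K) * b" by (rule assms)
  also have "\<dots> = (b\<^sup>2 / K) * (a / K - 2)"
    using K by (simp add: power2_eq_square field_simps)
  also have "\<dots> < 0"
    using b K by (intro mult_pos_neg) (auto simp: field_simps)
  finally show False by simp
qed

lemma norm_le_of_cinner:
  fixes z :: "'a::complex_hilbert_space"
  assumes "cmod (cinner z z) \<le> K * norm z" and "0 \<le> K"
  shows "norm z \<le> K"
proof (cases "z = 0")
  case False
  have "norm z * norm z \<le> K * norm z"
    using assms(1) by (simp add: cinner_self power2_eq_square norm_mult)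
  then show ?thesis using False by simp
qed (use assms in simp)

lemma riesz_representation:
  fixes f :: "'a::complex_hilbert_space \<Rightarrow> complex"
  assumes f: "bounded_linear f" and fc: "\<And>c x. f (c *\<^sub>C x) = c * f x"
  obtains z where "\<And>x. f x = cinner z x"
proof -
  interpret f: bounded_linear f by (rule f)
  obtain K where K: "\<And>x. norm (f x) \<le> norm x * K" and K0: "0 < K"
    using f.pos_bounded by blast
  define J where "J x = (norm x)\<^sup>2 - 2 * Re (f x)" for x
  have lower: "- (K\<^sup>2) \<le> J x" for x
  proof -
    have "Re (f x) \<le> norm x * K"
      using K[of x] complex_Re_le_cmod[of "f x"] by linarith
    moreover have "0 \<le> (norm x - K)\<^sup>2" by simp
    ultimately show ?thesis unfolding J_def by (simp add: power2_diff)
  qed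
  define m where "m = (INF x. J x)"
  have bdd: "bdd_below (range J)" using lower by (auto simp: bdd_below_def)
  have m: "m \<le> J x" for x unfolding m_def by (rule cINF_lower[OF bdd]) simp
  have near: "\<exists>x. J x < m + e" if "e > 0" for e
    using cINF_less_iff[OF _ bdd, of "m + e"] that unfolding m_def by auto
  then have "\<forall>n. \<exists>x. J x < m + inverse (real (Suc n))" by simp
  then obtain X where X: "\<And>n. J (X n) < m + inverse (real (Suc n))" by metis
  have par: "(norm (x - y))\<^sup>2 = 2 * J x + 2 * J y - 4 * J ((1/2) *\<^sub>R (x + y))" for x y
  proof -
    have 1: "(norm (x + y))\<^sup>2 + (norm (x - y))\<^sup>2 = 2 * (norm x)\<^sup>2 + 2 * (norm y)\<^sup>2"
      using norm_add_sq[of x y] norm_add_sq[of x "- y"] by simp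
    have 2: "J ((1/2) *\<^sub>R (x + y)) = (norm (x + y))\<^sup>2 / 4 - (Re (f x) + Re (f y))"
      unfolding J_def by (simp add: f.scaleR f.add power_mult_distrib power_divide add_divide_distrib)
    show ?thesis using 1 unfolding 2 by (simp add: J_def)
  qed
  have "Cauchy X"
  proof (rule metric_CauchyI)
    fix e :: real assume e: "0 < e"
    obtain N where N: "inverse (real (Suc N)) < e\<^sup>2 / 4"
      using reals_Archimedean[of "e\<^sup>2 / 4"] e by auto
    show "\<exists>M. \<forall>k\<ge>M. \<forall>n\<ge>M. dist (X k) (X n) < e"
    proof (intro exI allI impI)
      fix k n assume kn: "k \<ge> N" "n \<ge> N"
      have inv: "inverse (real (Suc l)) \<le> inverse (real (Suc N))" if "l \<ge> N" for l
        using that by (intro le_imp_inverse_le) auto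
      have "(norm (X k - X n))\<^sup>2 \<le> 2 * J (X k) + 2 * J (X n) - 4 * m"
        using par[of "X k" "X n"] m[of "(1/2) *\<^sub>R (X k + X n)"] by linarith
      also have "\<dots> < e\<^sup>2"
        using X[of k] X[of n] inv[OF kn(1)] inv[OF kn(2)] N by linarith
      finally show "dist (X k) (X n) < e"
        using e by (simp add: dist_norm power_less_imp_less_base)
    qed
  qed
  then obtain z where z: "X \<longlonglongrightarrow> z" using Cauchy_convergent convergent_def by blast
  have Jz: "J z \<le> m"
  proof (rule LIMSEQ_le)
    show "(\<lambda>n. J (X n)) \<longlonglongrightarrow> J z"
      unfolding J_def by (intro tendsto_intros z f.tendsto)
    show "(\<lambda>n. m + inverse (real (Suc n))) \<longlonglongrightarrow> m"
      using tendsto_add[OF tendsto_const LIMSEQ_inverse_real_of_nat, of m] by simp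
    show "\<exists>N. \<forall>n\<ge>N. J (X n) \<le> m + inverse (real (Suc n))" using X less_imp_le by blast
  qed
  have re: "Re (f v) = Re (cinner z v)" for v
  proof -
    have "t\<^sup>2 * (norm v)\<^sup>2 + 2 * t * (Re (cinner z v) - Re (f v)) \<ge> 0" for t
    proof -
      have "J (z + t *\<^sub>R v) = J z + (t\<^sup>2 * (norm v)\<^sup>2 + 2 * t * (Re (cinner z v) - Re (f v)))"
        unfolding J_def norm_add_sq
        by (simp add: f.add f.scaleR cinner_scaleR_right power_mult_distrib algebra_simps)
      then show ?thesis using Jz m[of "z + t *\<^sub>R v"] by linarith
    qed
    then have "Re (cinner z v) - Re (f v) = 0" by (rule quadratic_nonneg_linear_zero)
    then show ?thesis by simp
  qed
  have "f v = cinner z v" for v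
    using re[of v] re[of "\<i> *\<^sub>C v"] by (simp add: complex_eq_iff fc cinner_scaleC_right)
  then show ?thesis by (rule that)
qed

lemma cinner_eqI:
  fixes x y :: "'a::complex_hilbert_space"
  assumes "\<And>z. cinner x z = cinner y z"
  shows "x = y"
  using cinner_self[of "x - y"] assms[of "x - y"] by (simp add: cinner_diff_left)

lemma Cauchy_Schwarz:
  fixes x y :: "'a::complex_hilbert_space"
  shows "cmod (cinner x y) \<le> norm x * norm y"
proof (cases "cinner x y = 0")
  case False
  define u where "u = cnj (cinner x y) / complex_of_real (cmod (cinner x y))"
  have u: "cmod u = 1" using False by (simp add: u_def norm_divide)
  have "Re (cinner x (u *\<^sub>C y)) = cmod (cinner x y)"
    using False by (simp add: u_def cinner_scaleC_right mult.commute[of _ "cinner x y"]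
        complex_norm_square[symmetric] power2_eq_square flip: of_real_mult)
  moreover have "Re (cinner x v) \<le> norm x * norm v" for v
  proof -
    have "(norm (x + v))\<^sup>2 \<le> (norm x + norm v)\<^sup>2"
      by (simp add: norm_triangle_ineq power_mono)
    then show ?thesis unfolding norm_add_sq by (simp add: power2_sum)
  qed
  ultimately show ?thesis by (metis norm_scaleC u mult_1)
qed simp

section \<open>The C*-algebra of bounded operators on a Hilbert space\<close>

typedef (overloaded) 'h cbop =
    "{T :: 'h::complex_hilbert_space \<Rightarrow>\<^sub>L 'h. bounded_clinear (blinfun_apply T)}"
  morphisms blinfun_of_cbop Abs_cbop
  by (rule exI[of _ 0]) (simp add: bounded_clinear_def blinfun.bounded_linear_right)

setup_lifting type_definition_cbop

lift_definition cbop_apply :: "'h::complex_hilbert_space cbop \<Rightarrow> 'h \<Rightarrow> 'h" is blinfun_apply .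

lemma bounded_clinear_blinfun:
  "bounded_clinear (blinfun_apply T) \<longleftrightarrow> (\<forall>c x. blinfun_apply T (c *\<^sub>C x) = c *\<^sub>C blinfun_apply T x)"
  by (simp add: bounded_clinear_def blinfun.bounded_linear_right)

lemma bounded_clinear_cbop_apply: "bounded_clinear (cbop_apply T)"
  by transfer

lemma adjoint_exists:
  fixes T :: "'h::complex_hilbert_space cbop"
  shows "\<exists>!S. \<forall>x y. cinner (cbop_apply S x) y = cinner x (cbop_apply T y)"
proof -
  have T: "bounded_linear (cbop_apply T)" "\<And>c x. cbop_apply T (c *\<^sub>C x) = c *\<^sub>C cbop_apply T x"
    using bounded_clinear_cbop_apply[of T] by (auto simp: bounded_clinear_def)
  interpret T: bounded_linear "cbop_apply T" by (rule T)
  obtain K where K: "\<And>x. norm (cbop_apply T x) \<le> norm x * K" and K0: "0 < K"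
    using T.pos_bounded by blast
  have "\<exists>z. \<forall>y. cinner x (cbop_apply T y) = cinner z y" for x
  proof -
    have "bounded_linear (\<lambda>y. cinner x (cbop_apply T y))"
    proof (rule bounded_linear_intro)
      show "norm (cinner x (cbop_apply T y)) \<le> norm y * (norm x * K)" for y
        using Cauchy_Schwarz[of x "cbop_apply T y"] mult_left_mono[OF K[of y], of "norm x"]
        by (simp add: mult_ac)
    qed (simp_all add: T.add T.scaleR cinner_add_right cinner_scaleR_right scaleR_conv_of_real)
    then obtain z where "\<And>y. cinner x (cbop_apply T y) = cinner z y"
      using riesz_representation by (metis (mono_tags, lifting) T(2) cinner_scaleC_right)
    then show ?thesis by blast
  qed
  then obtain S where S: "\<And>x y. cinner x (cbop_apply T y) = cinner (S x) y" by metis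
  have add: "S (x + y) = S x + S y" for x y
    by (rule cinner_eqI) (simp add: cinner_add_left flip: S)
  have sc: "S (c *\<^sub>C x) = c *\<^sub>C S x" for c x
    by (rule cinner_eqI) (simp add: cinner_scaleC_left flip: S)
  have bd: "norm (S x) \<le> norm x * K" for x
  proof (rule norm_le_of_cinner)
    have "cmod (cinner (S x) (S x)) = cmod (cinner x (cbop_apply T (S x)))" by (simp add: S)
    also have "\<dots> \<le> norm x * norm (cbop_apply T (S x))" by (rule Cauchy_Schwarz)
    also have "\<dots> \<le> norm x * (norm (S x) * K)" by (intro mult_left_mono K) simp
    finally show "cmod (cinner (S x) (S x)) \<le> norm x * K * norm (S x)" by (simp add: mult_ac)
  qed (use K0 in simp)
  have Sb: "bounded_linear S"
  proof (rule bounded_linear_intro)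
    show "S (r *\<^sub>R x) = r *\<^sub>R S x" for r x
      using sc[of "complex_of_real r" x] by (simp add: scaleC_of_real)
  qed (rule add, rule bd)
  define S' where "S' = Abs_cbop (Blinfun S)"
  have "cbop_apply S' = S"
    unfolding S'_def cbop_apply.rep_eq
    by (subst Abs_cbop_inverse)
      (simp_all add: bounded_linear_Blinfun_apply[OF Sb] bounded_clinear_def Sb sc)
  then have "\<forall>x y. cinner (cbop_apply S' x) y = cinner x (cbop_apply T y)" by (simp add: S)
  moreover have "R = S'"
    if "\<forall>x y. cinner (cbop_apply R x) y = cinner x (cbop_apply T y)" for R
  proof -
    have "cbop_apply R x = cbop_apply S' x" for x
      by (rule cinner_eqI) (simp add: that calculation)
    then show ?thesis by transfer (rule blinfun_eqI)
  qed
  ultimately show ?thesis by blast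
qed

instantiation cbop :: (complex_hilbert_space) "{complex_normed_vector, times, star}"
begin

lift_definition zero_cbop :: "'a cbop" is 0
  by (simp add: bounded_clinear_blinfun)

lift_definition plus_cbop :: "'a cbop \<Rightarrow> 'a cbop \<Rightarrow> 'a cbop" is "(+)"
  by (simp add: bounded_clinear_blinfun blinfun.add_left scaleC_add_right)

lift_definition uminus_cbop :: "'a cbop \<Rightarrow> 'a cbop" is uminus
  by (simp add: bounded_clinear_blinfun blinfun.minus_left)

lift_definition minus_cbop :: "'a cbop \<Rightarrow> 'a cbop \<Rightarrow> 'a cbop" is "(-)"
  by (simp add: bounded_clinear_blinfun blinfun.diff_left scaleC_diff_right)

lift_definition scaleR_cbop :: "real \<Rightarrow> 'a cbop \<Rightarrow> 'a cbop" is scaleR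
  by (simp add: bounded_clinear_blinfun blinfun.scaleR_left scaleC_scaleR_commute)

lift_definition scaleC_cbop :: "complex \<Rightarrow> 'a cbop \<Rightarrow> 'a cbop" is
  "\<lambda>c T. Blinfun (\<lambda>x. c *\<^sub>C blinfun_apply T x)"
proof -
  fix c and T :: "'a \<Rightarrow>\<^sub>L 'a"
  assume T: "bounded_clinear (blinfun_apply T)"
  have "bounded_linear (\<lambda>x. c *\<^sub>C blinfun_apply T x)"
    using bounded_linear_compose[OF bounded_linear_scaleC[of c] blinfun.bounded_linear_right[of T]]
    by simp
  then show "bounded_clinear (blinfun_apply (Blinfun (\<lambda>x. c *\<^sub>C blinfun_apply T x)))"
    using T by (simp add: bounded_clinear_def bounded_linear_Blinfun_apply scaleC_scaleC mult.commute)
qed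

lift_definition times_cbop :: "'a cbop \<Rightarrow> 'a cbop \<Rightarrow> 'a cbop" is "(o\<^sub>L)"
  by (simp add: bounded_clinear_blinfun)

definition star_cbop :: "'a cbop \<Rightarrow> 'a cbop" where
  "star_cbop T = (THE S. \<forall>x y. cinner (cbop_apply S x) y = cinner x (cbop_apply T y))"

lift_definition norm_cbop :: "'a cbop \<Rightarrow> real" is norm .

definition dist_cbop :: "'a cbop \<Rightarrow> 'a cbop \<Rightarrow> real" where
  "dist_cbop S T = norm (S - T)"

definition sgn_cbop :: "'a cbop \<Rightarrow> 'a cbop" where
  "sgn_cbop T = scaleR (inverse (norm T)) T"

definition uniformity_cbop :: "('a cbop \<times> 'a cbop) filter" where
  "uniformity_cbop = (INF e\<in>{0 <..}. principal {(S, T). dist S T < e})"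

definition open_cbop :: "'a cbop set \<Rightarrow> bool" where
  "open_cbop U = (\<forall>S\<in>U. eventually (\<lambda>(S', T). S' = S \<longrightarrow> T \<in> U) uniformity)"

lemma scaleC_cbop_apply: "cbop_apply (c *\<^sub>C T) x = c *\<^sub>C cbop_apply T x" for T :: "'a cbop"
proof -
  have "bounded_linear (\<lambda>x. c *\<^sub>C cbop_apply T x)"
    using bounded_linear_compose[OF bounded_linear_scaleC[of c]] bounded_clinear_cbop_apply[of T]
    by (auto simp: bounded_clinear_def)
  then show ?thesis
    by (simp add: scaleC_cbop.rep_eq cbop_apply.rep_eq bounded_linear_Blinfun_apply)
qed

lemma cbop_eqI: "(\<And>x. cbop_apply S x = cbop_apply T x) \<Longrightarrow> S = T" for S T :: "'a cbop"
  by transfer (rule blinfun_eqI)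

lemma plus_cbop_apply: "cbop_apply (S + T) x = cbop_apply S x + cbop_apply T x" for S T :: "'a cbop"
  by transfer (rule blinfun.add_left)

lemma times_cbop_apply: "cbop_apply (S * T) x = cbop_apply S (cbop_apply T x)" for S T :: "'a cbop"
  by transfer simp

lemma scaleR_cbop_apply: "cbop_apply (r *\<^sub>R T) x = r *\<^sub>R cbop_apply T x" for T :: "'a cbop"
  by (simp add: cbop_apply.rep_eq scaleR_cbop.rep_eq blinfun.scaleR_left)

lemma norm_cbop_apply: "norm (cbop_apply T x) \<le> norm T * norm x" for T :: "'a cbop"
  unfolding norm_cbop.rep_eq cbop_apply.rep_eq by (rule norm_blinfun)

lemma norm_cbop_le: "0 \<le> K \<Longrightarrow> (\<And>x. norm (cbop_apply T x) \<le> K * norm x) \<Longrightarrow> norm T \<le> K"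
  for T :: "'a cbop"
  unfolding norm_cbop.rep_eq cbop_apply.rep_eq by (rule norm_blinfun_bound)

instance
proof
  fix S T R :: "'a cbop" and r s :: real and c d :: complex
  show "dist S T = norm (S - T)" by (rule dist_cbop_def)
  show "sgn S = scaleR (inverse (norm S)) S" by (rule sgn_cbop_def)
  show "(uniformity :: ('a cbop \<times> 'a cbop) filter) = (INF e\<in>{0 <..}. principal {(S, T). dist S T < e})"
    by (rule uniformity_cbop_def)
  show "open U = (\<forall>S\<in>U. eventually (\<lambda>(S', T). S' = S \<longrightarrow> T \<in> U) uniformity)" for U :: "'a cbop set"
    by (rule open_cbop_def)
  show "S + T + R = S + (T + R)" by transfer simp
  show "S + T = T + S" by transfer simp
  show "0 + S = S" by transfer simp
  show "- S + S = 0" by transfer simp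
  show "S - T = S + - T" by transfer simp
  show "r *\<^sub>R (S + T) = r *\<^sub>R S + r *\<^sub>R T" by transfer (rule scaleR_add_right)
  show "(r + s) *\<^sub>R S = r *\<^sub>R S + s *\<^sub>R S" by transfer (rule scaleR_add_left)
  show "r *\<^sub>R s *\<^sub>R S = (r * s) *\<^sub>R S" by transfer simp
  show "1 *\<^sub>R S = S" by transfer simp
  show "(norm S = 0) = (S = 0)" by transfer simp
  show "norm (S + T) \<le> norm S + norm T" by transfer (rule norm_triangle_ineq)
  show "norm (r *\<^sub>R S) = \<bar>r\<bar> * norm S" by transfer simp
  show "c *\<^sub>C (S + T) = c *\<^sub>C S + c *\<^sub>C T"
    by (rule cbop_eqI) (simp add: scaleC_cbop_apply plus_cbop_apply scaleC_add_right)
  show "(c + d) *\<^sub>C S = c *\<^sub>C S + d *\<^sub>C S"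
    by (rule cbop_eqI) (simp add: scaleC_cbop_apply plus_cbop_apply scaleC_add_left)
  show "c *\<^sub>C d *\<^sub>C S = (c * d) *\<^sub>C S"
    by (rule cbop_eqI) (simp add: scaleC_cbop_apply scaleC_scaleC)
  show "complex_of_real r *\<^sub>C S = r *\<^sub>R S"
    by (rule cbop_eqI) (simp add: scaleC_cbop_apply scaleR_cbop_apply scaleC_of_real)
  have le: "norm (c *\<^sub>C S) \<le> cmod c * norm S" for c and S :: "'a cbop"
  proof (rule norm_cbop_le)
    show "norm (cbop_apply (c *\<^sub>C S) x) \<le> cmod c * norm S * norm x" for x
      using mult_left_mono[OF norm_cbop_apply[of S x], of "cmod c"]
      by (simp add: scaleC_cbop_apply norm_scaleC mult.assoc)
  qed (transfer, simp)
  show "norm (c *\<^sub>C S) = cmod c * norm S"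
  proof (cases "c = 0")
    case True
    have "norm (0 *\<^sub>C S) \<le> 0" using le[of 0 S] by simp
    moreover have "0 \<le> norm (0 *\<^sub>C S)" by transfer simp
    ultimately show ?thesis using True by simp
  next
    case False
    have "S = inverse c *\<^sub>C c *\<^sub>C S"
      by (rule cbop_eqI) (simp add: scaleC_cbop_apply scaleC_scaleC False)
    then have "norm S \<le> cmod (inverse c) * norm (c *\<^sub>C S)" using le[of "inverse c" "c *\<^sub>C S"] by simp
    then have "cmod c * norm S \<le> norm (c *\<^sub>C S)"
      using False by (simp add: norm_inverse norm_divide field_simps)
    then show ?thesis using le[of c S] by simp
  qed
qed

end

lemma cinner_star_cbop: "cinner (cbop_apply (star T) x) y = cinner x (cbop_apply T y)"
  using theI'[OF adjoint_exists[of T]] unfolding star_cbop_def by blast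

lemma star_cbop_eqI:
  assumes "\<And>x y. cinner (cbop_apply S x) y = cinner x (cbop_apply T y)"
  shows "star T = S"
  using adjoint_exists[of T] assms cinner_star_cbop[of T] by blast

lemma cinner_star_cbop_right: "cinner x (cbop_apply (star T) y) = cinner (cbop_apply T x) y"
  by (metis cinner_star_cbop cinner_commute)

lemma norm_blinfun_of_cbop: "norm (blinfun_of_cbop S) = norm S"
  by transfer simp

instance cbop :: (complex_hilbert_space) cstar_algebra
proof
  fix S T R :: "'a cbop" and r :: real and c :: complex
  have ap: "bounded_linear (cbop_apply S)" "cbop_apply S (c *\<^sub>C x) = c *\<^sub>C cbop_apply S x"
    for S :: "'a cbop" and c x
    using bounded_clinear_cbop_apply[of S] by (auto simp: bounded_clinear_def)
  note add = linear_add[OF bounded_linear.linear[OF ap(1)]]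
  note scR = linear_scale[OF bounded_linear.linear[OF ap(1)]]
  note simps = plus_cbop_apply times_cbop_apply scaleR_cbop_apply scaleC_cbop_apply add scR ap(2)
  show "S * T * R = S * (T * R)" by (rule cbop_eqI) (simp add: simps)
  show "(S + T) * R = S * R + T * R" by (rule cbop_eqI) (simp add: simps)
  show "S * (T + R) = S * T + S * R" by (rule cbop_eqI) (simp add: simps)
  show "r *\<^sub>R S * T = r *\<^sub>R (S * T)" by (rule cbop_eqI) (simp add: simps)
  show "S * r *\<^sub>R T = r *\<^sub>R (S * T)" by (rule cbop_eqI) (simp add: simps)
  show "c *\<^sub>C S * T = c *\<^sub>C (S * T)" by (rule cbop_eqI) (simp add: simps)
  show "S * c *\<^sub>C T = c *\<^sub>C (S * T)" by (rule cbop_eqI) (simp add: simps)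
  show sub: "norm (S * T) \<le> norm S * norm T" for S T :: "'a cbop"
    by transfer (rule norm_blinfun_compose)
  show "star (S + T) = star S + star T"
    by (rule star_cbop_eqI) (simp add: simps cinner_star_cbop cinner_add_left cinner_add_right)
  show "star (c *\<^sub>C S) = cnj c *\<^sub>C star S"
    by (rule star_cbop_eqI)
      (simp add: simps cinner_star_cbop cinner_scaleC_left cinner_scaleC_right)
  show "star (S * T) = star T * star S"
    by (rule star_cbop_eqI) (simp add: simps cinner_star_cbop)
  show star2: "star (star S) = S" for S :: "'a cbop"
    by (rule star_cbop_eqI) (simp add: cinner_star_cbop_right)
  have le: "(norm S)\<^sup>2 \<le> norm (star S * S)" for S :: "'a cbop"
  proof -
    have "norm S \<le> sqrt (norm (star S * S))"
    proof (rule norm_cbop_le)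
      fix x
      have "(norm (cbop_apply S x))\<^sup>2 = cmod (cinner (cbop_apply S x) (cbop_apply S x))"
        by (simp add: cinner_self norm_power flip: of_real_power)
      also have "\<dots> = cmod (cinner (cbop_apply (star S * S) x) x)"
        by (simp add: times_cbop_apply cinner_star_cbop)
      also have "\<dots> \<le> norm (cbop_apply (star S * S) x) * norm x" by (rule Cauchy_Schwarz)
      also have "\<dots> \<le> norm (star S * S) * norm x * norm x"
        by (intro mult_right_mono norm_cbop_apply) simp
      also have "\<dots> = (sqrt (norm (star S * S)) * norm x)\<^sup>2"
        by (simp add: power_mult_distrib power2_eq_square[of "norm x"])
      finally show "norm (cbop_apply S x) \<le> sqrt (norm (star S * S)) * norm x"
        by (rule power2_le_imp_le) simp
    qed simp
    then show ?thesis using power_mono[of "norm S" "sqrt (norm (star S * S))" 2] by simp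
  qed
  have "norm S \<le> norm (star S)" for S :: "'a cbop"
  proof (cases "norm S = 0")
    case False
    have "norm S * norm S \<le> norm (star S) * norm S"
      using le[of S] sub[of "star S" S] by (simp add: power2_eq_square)
    then show ?thesis using False by simp
  qed simp
  from this[of S] this[of "star S"] have "norm (star S) = norm S" by (simp add: star2)
  then show "norm (star S * S) = (norm S)\<^sup>2"
    using le[of S] sub[of "star S" S] by (simp add: power2_eq_square)
  show "convergent X" if X: "Cauchy X" for X :: "nat \<Rightarrow> 'a cbop"
  proof -
    have di: "dist (blinfun_of_cbop A) (blinfun_of_cbop B) = dist A B" for A B :: "'a cbop"
      by (simp add: dist_norm minus_cbop.rep_eq flip: norm_blinfun_of_cbop)
    have "Cauchy (\<lambda>n. blinfun_of_cbop (X n))"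
      using X unfolding Cauchy_def di .
    then obtain L where L: "(\<lambda>n. blinfun_of_cbop (X n)) \<longlonglongrightarrow> L"
      using Cauchy_convergent convergent_def by blast
    have "bounded_clinear (blinfun_apply L)"
      unfolding bounded_clinear_blinfun
    proof (intro allI)
      fix c x
      have "(\<lambda>n. blinfun_apply (blinfun_of_cbop (X n)) (c *\<^sub>C x)) \<longlonglongrightarrow> blinfun_apply L (c *\<^sub>C x)"
        by (intro blinfun.tendsto L tendsto_const)
      moreover have "(\<lambda>n. c *\<^sub>C blinfun_apply (blinfun_of_cbop (X n)) x) \<longlonglongrightarrow> c *\<^sub>C blinfun_apply L x"
        by (intro bounded_linear.tendsto[OF bounded_linear_scaleC] blinfun.tendsto L tendsto_const)
      ultimately show "blinfun_apply L (c *\<^sub>C x) = c *\<^sub>C blinfun_apply L x"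
        using LIMSEQ_unique ap(2) by (fastforce simp: cbop_apply.rep_eq)
    qed
    then have L': "blinfun_of_cbop (Abs_cbop L) = L" by (simp add: Abs_cbop_inverse)
    have "X \<longlonglongrightarrow> Abs_cbop L"
      using L unfolding tendsto_iff by (simp add: L' flip: di)
    then show ?thesis by (rule convergentI)
  qed
qed

section \<open>The C*-algebra of vanishing sequences\<close>

text \<open>The diagonal operator \<open>diag {a\<^sub>k}\<^sub>k\<close> in the spatial tensor product \<open>B(l\<^sup>2) \<otimes> A\<close> is
  represented by the sequence of its diagonal entries.\<close>

typedef (overloaded) 'a c0 = "{a :: nat \<Rightarrow> 'a::cstar_algebra. a \<longlonglongrightarrow> 0}"
  morphisms c0_nth diag
  by (rule exI[of _ "\<lambda>_. 0"]) simp

setup_lifting type_definition_c0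

lemma c0_nth_bdd: "bdd_above (range (\<lambda>k. norm (c0_nth a k)))"
proof -
  have "(\<lambda>k. c0_nth a k) \<longlonglongrightarrow> 0" using c0_nth[of a] by simp
  then have "Bseq (\<lambda>k. c0_nth a k)" using convergent_imp_Bseq convergentI by blast
  then show ?thesis unfolding Bseq_def bdd_above_def by auto
qed

instantiation c0 :: (cstar_algebra) "{complex_normed_vector, times, star}"
begin

lift_definition zero_c0 :: "'a c0" is "\<lambda>_. 0" by simp

lift_definition plus_c0 :: "'a c0 \<Rightarrow> 'a c0 \<Rightarrow> 'a c0" is "\<lambda>a b k. a k + b k"
  by (auto intro: tendsto_add_zero)

lift_definition uminus_c0 :: "'a c0 \<Rightarrow> 'a c0" is "\<lambda>a k. - a k"
  using tendsto_minus by fastforce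

lift_definition minus_c0 :: "'a c0 \<Rightarrow> 'a c0 \<Rightarrow> 'a c0" is "\<lambda>a b k. a k - b k"
  using tendsto_diff by fastforce

lift_definition scaleR_c0 :: "real \<Rightarrow> 'a c0 \<Rightarrow> 'a c0" is "\<lambda>r a k. r *\<^sub>R a k"
  using tendsto_scaleR[OF tendsto_const] by fastforce

lift_definition scaleC_c0 :: "complex \<Rightarrow> 'a c0 \<Rightarrow> 'a c0" is "\<lambda>c a k. c *\<^sub>C a k"
  using bounded_linear.tendsto[OF bounded_linear_scaleC] by fastforce

lift_definition times_c0 :: "'a c0 \<Rightarrow> 'a c0 \<Rightarrow> 'a c0" is "\<lambda>a b k. a k * b k"
  using tendsto_mult by fastforce

lift_definition star_c0 :: "'a c0 \<Rightarrow> 'a c0" is "\<lambda>a k. star (a k)"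
proof -
  fix a :: "nat \<Rightarrow> 'a"
  assume "a \<longlonglongrightarrow> 0"
  then have "(\<lambda>k. norm (a k)) \<longlonglongrightarrow> 0" by (rule tendsto_norm_zero)
  then have "(\<lambda>k. norm (star (a k))) \<longlonglongrightarrow> 0" by simp
  then show "(\<lambda>k. star (a k)) \<longlonglongrightarrow> 0" by (rule tendsto_norm_zero_cancel)
qed

lift_definition norm_c0 :: "'a c0 \<Rightarrow> real" is "\<lambda>a. SUP k. norm (a k)" .

definition dist_c0 :: "'a c0 \<Rightarrow> 'a c0 \<Rightarrow> real" where
  "dist_c0 a b = norm (a - b)"

definition sgn_c0 :: "'a c0 \<Rightarrow> 'a c0" where
  "sgn_c0 a = scaleR (inverse (norm a)) a"

definition uniformity_c0 :: "('a c0 \<times> 'a c0) filter" where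
  "uniformity_c0 = (INF e\<in>{0 <..}. principal {(a, b). dist a b < e})"

definition open_c0 :: "'a c0 set \<Rightarrow> bool" where
  "open_c0 U = (\<forall>a\<in>U. eventually (\<lambda>(a', b). a' = a \<longrightarrow> b \<in> U) uniformity)"

lemma c0_eqI: "(\<And>k. c0_nth a k = c0_nth b k) \<Longrightarrow> a = b" for a b :: "'a c0"
  by transfer auto

lemma norm_c0_nth: "norm (c0_nth a k) \<le> norm a" for a :: "'a c0"
  unfolding norm_c0.rep_eq by (rule cSUP_upper[OF _ c0_nth_bdd]) simp

lemma norm_c0_le: "(\<And>k. norm (c0_nth a k) \<le> K) \<Longrightarrow> norm a \<le> K" for a :: "'a c0"
  unfolding norm_c0.rep_eq by (rule cSUP_least) auto

lemmas c0_rep = zero_c0.rep_eq plus_c0.rep_eq uminus_c0.rep_eq minus_c0.rep_eq scaleR_c0.rep_eq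
  scaleC_c0.rep_eq times_c0.rep_eq star_c0.rep_eq

instance
proof
  fix a b c :: "'a c0" and r s :: real and u v :: complex
  show "dist a b = norm (a - b)" by (rule dist_c0_def)
  show "sgn a = scaleR (inverse (norm a)) a" by (rule sgn_c0_def)
  show "(uniformity :: ('a c0 \<times> 'a c0) filter) = (INF e\<in>{0 <..}. principal {(a, b). dist a b < e})"
    by (rule uniformity_c0_def)
  show "open U = (\<forall>a\<in>U. eventually (\<lambda>(a', b). a' = a \<longrightarrow> b \<in> U) uniformity)" for U :: "'a c0 set"
    by (rule open_c0_def)
  show "a + b + c = a + (b + c)" by (rule c0_eqI) (simp add: c0_rep)
  show "a + b = b + a" by (rule c0_eqI) (simp add: c0_rep)
  show "0 + a = a" by (rule c0_eqI) (simp add: c0_rep)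
  show "- a + a = 0" by (rule c0_eqI) (simp add: c0_rep)
  show "a - b = a + - b" by (rule c0_eqI) (simp add: c0_rep)
  show "r *\<^sub>R (a + b) = r *\<^sub>R a + r *\<^sub>R b" by (rule c0_eqI) (simp add: c0_rep scaleR_add_right)
  show "(r + s) *\<^sub>R a = r *\<^sub>R a + s *\<^sub>R a" by (rule c0_eqI) (simp add: c0_rep scaleR_add_left)
  show "r *\<^sub>R s *\<^sub>R a = (r * s) *\<^sub>R a" by (rule c0_eqI) (simp add: c0_rep)
  show "1 *\<^sub>R a = a" by (rule c0_eqI) (simp add: c0_rep)
  show "u *\<^sub>C (a + b) = u *\<^sub>C a + u *\<^sub>C b" by (rule c0_eqI) (simp add: c0_rep scaleC_add_right)
  show "(u + v) *\<^sub>C a = u *\<^sub>C a + v *\<^sub>C a" by (rule c0_eqI) (simp add: c0_rep scaleC_add_left)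
  show "u *\<^sub>C v *\<^sub>C a = (u * v) *\<^sub>C a" by (rule c0_eqI) (simp add: c0_rep scaleC_scaleC)
  show "complex_of_real r *\<^sub>C a = r *\<^sub>R a" by (rule c0_eqI) (simp add: c0_rep scaleC_of_real)
  have sup: "(SUP k. K * norm (c0_nth a k)) = K * norm a" if "0 \<le> K" for K
  proof (rule antisym)
    show "(SUP k. K * norm (c0_nth a k)) \<le> K * norm a"
      by (rule cSUP_least) (simp_all add: mult_left_mono norm_c0_nth that)
    have bdd: "bdd_above (range (\<lambda>k. K * norm (c0_nth a k)))"
      using mult_left_mono[OF norm_c0_nth that] unfolding bdd_above_def by blast
    have up: "K * norm (c0_nth a k) \<le> (SUP k. K * norm (c0_nth a k))" for k
      by (rule cSUP_upper[OF _ bdd]) simp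
    show "K * norm a \<le> (SUP k. K * norm (c0_nth a k))"
    proof (cases "K = 0")
      case False
      then have "norm a \<le> (SUP k. K * norm (c0_nth a k)) / K"
        using up that by (intro norm_c0_le) (simp add: field_simps)
      then show ?thesis using False that by (simp add: field_simps)
    qed simp
  qed
  show "norm (r *\<^sub>R a) = \<bar>r\<bar> * norm a"
    using sup[of "\<bar>r\<bar>"] by (simp add: norm_c0.rep_eq c0_rep)
  show "norm (u *\<^sub>C a) = cmod u * norm a"
    using sup[of "cmod u"] by (simp add: norm_c0.rep_eq c0_rep norm_scaleC)
  show "norm (a + b) \<le> norm a + norm b"
  proof (rule norm_c0_le)
    show "norm (c0_nth (a + b) k) \<le> norm a + norm b" for k
      using norm_triangle_ineq[of "c0_nth a k" "c0_nth b k"] norm_c0_nth[of a k] norm_c0_nth[of b k]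
      by (simp add: c0_rep)
  qed
  show "(norm a = 0) = (a = 0)"
  proof
    assume "norm a = 0"
    then have "c0_nth a k = 0" for k using norm_c0_nth[of a k] by simp
    then show "a = 0" by (intro c0_eqI) (simp add: c0_rep)
  qed (simp add: norm_c0.rep_eq c0_rep)
qed

end

instance c0 :: (cstar_algebra) cstar_algebra
proof
  fix a b c :: "'a c0" and r :: real and u :: complex
  show "a * b * c = a * (b * c)" by (rule c0_eqI) (simp add: c0_rep mult.assoc)
  show "(a + b) * c = a * c + b * c" by (rule c0_eqI) (simp add: c0_rep distrib_right)
  show "a * (b + c) = a * b + a * c" by (rule c0_eqI) (simp add: c0_rep distrib_left)
  show "r *\<^sub>R a * b = r *\<^sub>R (a * b)" by (rule c0_eqI) (simp add: c0_rep)
  show "a * r *\<^sub>R b = r *\<^sub>R (a * b)" by (rule c0_eqI) (simp add: c0_rep)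
  show "u *\<^sub>C a * b = u *\<^sub>C (a * b)" by (rule c0_eqI) (simp add: c0_rep scaleC_mult_left)
  show "a * u *\<^sub>C b = u *\<^sub>C (a * b)" by (rule c0_eqI) (simp add: c0_rep scaleC_mult_right)
  show "star (a + b) = star a + star b" by (rule c0_eqI) (simp add: c0_rep star_add)
  show "star (u *\<^sub>C a) = cnj u *\<^sub>C star a" by (rule c0_eqI) (simp add: c0_rep star_scaleC)
  show "star (a * b) = star b * star a" by (rule c0_eqI) (simp add: c0_rep star_mult)
  show "star (star a) = a" by (rule c0_eqI) (simp add: c0_rep star_star)
  show sub: "norm (a * b) \<le> norm a * norm b" for a b :: "'a c0"
  proof (rule norm_c0_le)
    fix k
    have "norm (c0_nth (a * b) k) \<le> norm (c0_nth a k) * norm (c0_nth b k)"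
      by (simp add: c0_rep norm_mult_ineq)
    also have "\<dots> \<le> norm a * norm b"
      by (intro mult_mono norm_c0_nth) simp_all
    finally show "norm (c0_nth (a * b) k) \<le> norm a * norm b" .
  qed
  have st: "norm (star a) = norm a"
    by (simp add: norm_c0.rep_eq c0_rep)
  have "norm a \<le> sqrt (norm (star a * a))"
  proof (rule norm_c0_le)
    fix k
    have "(norm (c0_nth a k))\<^sup>2 \<le> norm (star a * a)"
      using norm_c0_nth[of "star a * a" k] by (simp add: c0_rep cstar_identity)
    then show "norm (c0_nth a k) \<le> sqrt (norm (star a * a))" by (rule real_le_rsqrt)
  qed
  then have "(norm a)\<^sup>2 \<le> norm (star a * a)"
    using power_mono[of "norm a" "sqrt (norm (star a * a))" 2] by simp
  then show "norm (star a * a) = (norm a)\<^sup>2"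
    using sub[of "star a" a] by (simp add: st power2_eq_square)
  show "convergent X" if X: "Cauchy X" for X :: "nat \<Rightarrow> 'a c0"
  proof -
    have nth: "dist (c0_nth a k) (c0_nth b k) \<le> dist a b" for a b :: "'a c0" and k
      using norm_c0_nth[of "a - b" k] by (simp add: dist_norm c0_rep)
    have "Cauchy (\<lambda>n. c0_nth (X n) k)" for k
      using X nth unfolding Cauchy_def by (meson le_less_trans)
    then have "\<exists>l. (\<lambda>n. c0_nth (X n) k) \<longlonglongrightarrow> l" for k
      using Cauchy_convergent convergent_def by blast
    then obtain L where L: "\<And>k. (\<lambda>n. c0_nth (X n) k) \<longlonglongrightarrow> L k" by metis
    have unif: "\<exists>N. \<forall>n\<ge>N. \<forall>k. dist (c0_nth (X n) k) (L k) \<le> e" if e: "0 < e" for e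
    proof -
      obtain N where N: "\<And>m n. m \<ge> N \<Longrightarrow> n \<ge> N \<Longrightarrow> dist (X m) (X n) < e"
        using X e unfolding Cauchy_def by blast
      have "dist (c0_nth (X n) k) (L k) \<le> e" if n: "n \<ge> N" for n k
      proof (rule LIMSEQ_le_const2)
        show "(\<lambda>m. dist (c0_nth (X n) k) (c0_nth (X m) k)) \<longlonglongrightarrow> dist (c0_nth (X n) k) (L k)"
          by (intro tendsto_dist tendsto_const L)
        show "\<exists>M. \<forall>m\<ge>M. dist (c0_nth (X n) k) (c0_nth (X m) k) \<le> e"
          using N[OF n] nth by (meson le_less_trans less_imp_le)
      qed
      then show ?thesis by blast
    qed
    have "L \<longlonglongrightarrow> 0"
    proof (rule metric_LIMSEQ_I)
      fix e :: real assume e: "0 < e"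
      obtain n where n: "\<And>k. dist (c0_nth (X n) k) (L k) \<le> e / 2"
        using unif[of "e / 2"] e by auto
      have "c0_nth (X n) \<longlonglongrightarrow> 0" using c0_nth[of "X n"] by simp
      then obtain K where K: "\<And>k. k \<ge> K \<Longrightarrow> dist (c0_nth (X n) k) 0 < e / 2"
        using metric_LIMSEQ_D[of _ 0 "e / 2"] e by (metis half_gt_zero)
      have "dist (L k) 0 < e" if "k \<ge> K" for k
        using dist_triangle3[of "L k" 0 "c0_nth (X n) k"] n[of k] K[OF that] by linarith
      then show "\<exists>K. \<forall>k\<ge>K. dist (L k) 0 < e" by blast
    qed
    then have L': "c0_nth (diag L) = L" by (simp add: diag_inverse)
    have "X \<longlonglongrightarrow> diag L"
    proof (rule metric_LIMSEQ_I)
      fix e :: real assume e: "0 < e"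
      obtain N where N: "\<And>n k. n \<ge> N \<Longrightarrow> dist (c0_nth (X n) k) (L k) \<le> e / 2"
        using unif[of "e / 2"] e by auto
      have "dist (X n) (diag L) \<le> e / 2" if "n \<ge> N" for n
        unfolding dist_norm using N[OF that]
        by (intro norm_c0_le) (simp add: c0_rep L' dist_norm)
      then have "dist (X n) (diag L) < e" if "n \<ge> N" for n
        using that e by (smt (verit) field_sum_of_halves)
      then show "\<exists>N. \<forall>n\<ge>N. dist (X n) (diag L) < e" by blast
    qed
    then show ?thesis by (rule convergentI)
  qed
qed

section \<open>Positive matrices and completely positive maps\<close>

definition star_mat :: "'a::star mat \<Rightarrow> 'a mat" where
  "star_mat A = map_mat star (transpose_mat A)"

text \<open>The positive elements of a C*-algebra are those of the form \<open>y\<^sup>* y\<close>; here for the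
  C*-algebra of \<open>n \<times> n\<close> matrices over a C*-algebra.\<close>

definition positive_mats :: "nat \<Rightarrow> 'a::cstar_algebra mat set" where
  "positive_mats n = {star_mat Y * Y | Y. Y \<in> carrier_mat n n}"

definition star_preserving :: "('a::star \<Rightarrow> 'b::star) \<Rightarrow> bool" where
  "star_preserving f \<longleftrightarrow> (\<forall>a. f (star a) = star (f a))"

definition completely_positive :: "('a::cstar_algebra \<Rightarrow> 'b::cstar_algebra) \<Rightarrow> bool" where
  "completely_positive \<psi> \<longleftrightarrow> bounded_clinear \<psi> \<and> star_preserving \<psi> \<and>
     (\<forall>n. \<forall>A\<in>positive_mats n. map_mat \<psi> A \<in> positive_mats n)"

section \<open>Decomposability with respect to a vanishing sequence of maps\<close>

text \<open>Finite tuples are padded with zero maps.  Uniform boundedness of the norms is implied by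
  their convergence.\<close>

definition vanishing :: "(nat \<Rightarrow> 'a::cstar_algebra \<Rightarrow> 'a) \<Rightarrow> bool" where
  "vanishing \<phi> \<longleftrightarrow> (\<forall>k. bounded_clinear (\<phi> k)) \<and> (\<lambda>k. onorm (\<phi> k)) \<longlonglongrightarrow> 0"

definition decomposable ::
    "(nat \<Rightarrow> 'a::cstar_algebra \<Rightarrow> 'a) \<Rightarrow> ('a \<Rightarrow> 'h::complex_hilbert_space cbop) \<Rightarrow> bool" where
  "decomposable \<phi> f \<longleftrightarrow>
     (\<exists>\<psi> :: nat \<Rightarrow> 'a \<Rightarrow> 'h cbop. (\<forall>k. completely_positive (\<psi> k)) \<and>
       (\<forall>a. (\<lambda>k. \<psi> k (\<phi> k a)) sums f a))"

definition Gamma_pos :: "nat \<Rightarrow> (nat \<Rightarrow> 'a::cstar_algebra \<Rightarrow> 'a) \<Rightarrow> 'a mat set" where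
  "Gamma_pos n \<phi> = {A \<in> carrier_mat n n. \<forall>k. map_mat (\<phi> k) A \<in> positive_mats n}"

text \<open>The abstraction function \<open>diag\<close> is specified only on null sequences, so this is the intended
  map when \<open>\<phi>\<close> is vanishing.\<close>

definition diag_map :: "(nat \<Rightarrow> 'a::cstar_algebra \<Rightarrow> 'a) \<Rightarrow> 'a \<Rightarrow> 'a c0" where
  "diag_map \<phi> a = diag (\<lambda>k. \<phi> k a)"

lemma diag_map_nth:
  assumes "vanishing \<phi>"
  shows "c0_nth (diag_map \<phi> a) k = \<phi> k a"
proof -
  have bl: "bounded_linear (\<phi> k)" and lim: "(\<lambda>k. onorm (\<phi> k)) \<longlonglongrightarrow> 0" for k
    using assms by (auto simp: vanishing_def bounded_clinear_def)
  have "(\<lambda>k. onorm (\<phi> k) * norm a) \<longlonglongrightarrow> 0"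
    using lim by (rule tendsto_mult_left_zero)
  then have "(\<lambda>k. \<phi> k a) \<longlonglongrightarrow> 0"
    by (rule Lim_null_comparison[rotated]) (simp add: onorm[OF bl])
  then show ?thesis by (simp add: diag_map_def diag_inverse)
qed

text \<open>A set that is a C*-algebra in its own right under the inherited operations and norm; the
  algebraic laws and the C*-identity need no separate mention.\<close>

definition cstar_subalgebra :: "'a::cstar_algebra set \<Rightarrow> bool" where
  "cstar_subalgebra X \<longleftrightarrow> 0 \<in> X \<and> (\<forall>x\<in>X. \<forall>y\<in>X. x + y \<in> X) \<and> (\<forall>c. \<forall>x\<in>X. c *\<^sub>C x \<in> X) \<and>
     (\<forall>x\<in>X. \<forall>y\<in>X. x * y \<in> X) \<and> (\<forall>x\<in>X. star x \<in> X) \<and> complete X"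

end

theory Submission
  imports Defs "HOL-Library.Poly_Mapping"
begin

text \<open>
  If \<open>\<phi>\<close>-positivity of a matrix forces \<open>f\<close>-positivity, then \<open>f\<close> factors through
  \<open>\<xi>(a) = diag {\<phi>\<^sub>k(a)}\<^sub>k\<close> as \<open>f = g \<circ> \<xi>\<close>, where \<open>g\<close> is bounded on \<open>X = \<xi>(A)\<close> by the open mapping
  theorem and completely positive. If \<open>g\<close> extends to a completely positive map \<open>\<Phi>\<close> on \<open>c\<^sub>0(A)\<close>, the
  corners \<open>\<psi>\<^sub>k(a) = \<Phi>(E\<^sub>k\<^sub>k \<otimes> a)\<close> decompose \<open>f\<close>.

  The extension is obtained from a single Hahn-Banach argument. Maps into \<open>B(H)\<close> are viewed as
  functionals on finitely supported \<open>H \<times> H\<close> matrices over the unitization, \<open>\<Phi>\<close> having the value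
  \<open>\<langle>x, \<Phi>(b) y\<rangle>\<close> on the matrix with \<open>b\<close> at position \<open>(x, y)\<close>. The functional given by \<open>g\<close> on matrices
  over the unitization of \<open>X\<close> is positive: compressing with an approximate unit of \<open>X\<close>, which exists
  because \<open>X\<close> is a C*-algebra, removes the unit. Sesquilinearity and boundedness of the
  extended form follow from the Cauchy-Schwarz inequality for positive functionals.
\<close>

section \<open>The Hahn-Banach theorem\<close>

text \<open>Hahn-Banach requires every matrix to be dominated by one from the subspace where the
  functional is already given. Diagonal multiples of a unit achieve this, and \<open>X\<close> and
  \<open>c0(A)\<close> may fail to contain one: hence the unitization. \<open>g\<close> prescribes
  nothing at the unit, so its value there can be chosen large enough to keep the functional
  positive.

  The rows and columns are labelled by the vectors of H themselves. Labels carry no linear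
  structure, so the extended functional is not sesquilinear by construction. It becomes so because
  its value on unit entries is a multiple of the inner product: the Cauchy-Schwarz bound for a
  combination of values involves only the norm of the same combination of vectors, and linear
  relations between vectors pass to the form.

  A positive matrix with entries in \<open>X\<close> arrives as a Gram matrix whose factors lie in
  the ambient algebra. Positivity of \<open>g\<close> is stated for such factors, so no square root
  is ever taken inside \<open>X\<close>. This costs nothing, because a Gram relation in
  \<open>c0(A)\<close> is one in each coordinate, which is what \<phi>-positivity asks for.\<close>

definition sublinear :: "('v::real_vector \<Rightarrow> real) \<Rightarrow> bool" where
  "sublinear p \<longleftrightarrow> (\<forall>x y. p (x + y) \<le> p x + p y) \<and> (\<forall>t\<ge>0. \<forall>x. p (t *\<^sub>R x) = t * p x)"

lemma sublinearD:
  assumes "sublinear p"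
  shows "p (x + y) \<le> p x + p y" and "0 \<le> t \<Longrightarrow> p (t *\<^sub>R x) = t * p x" and "p 0 = 0" and "- p (- x) \<le> p x"
proof -
  show a: "p (x + y) \<le> p x + p y" "0 \<le> t \<Longrightarrow> p (t *\<^sub>R x) = t * p x" for x y t
    using assms by (auto simp: sublinear_def)
  show z: "p 0 = 0" using a(2)[of 0 0] by simp
  show "- p (- x) \<le> p x" using a(1)[of x "- x"] z by simp
qed

text \<open>Shared by the infimum of a chain, the perturbation of a minimal functional and the
  infimum over dominating matrices. Upper estimates on members suffice; the reverse scaling
  inequality follows by scaling back with \<open>inverse t\<close>.\<close>

lemma sublinear_Inf:
  fixes R :: "'v::real_vector \<Rightarrow> real set"
  assumes ne: "\<And>x. R x \<noteq> {}" and bdd: "\<And>x. bdd_below (R x)"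
    and add: "\<And>x y a b. a \<in> R x \<Longrightarrow> b \<in> R y \<Longrightarrow> \<exists>c\<in>R (x + y). c \<le> a + b"
    and scale: "\<And>x a t. a \<in> R x \<Longrightarrow> 0 < t \<Longrightarrow> \<exists>c\<in>R (t *\<^sub>R x). c \<le> t * a"
    and zero: "Inf (R 0) = 0"
  shows "sublinear (\<lambda>x. Inf (R x))"
proof -
  have lo: "Inf (R x) \<le> a" if "a \<in> R x" for a x
    by (rule cInf_lower[OF that bdd])
  have gr: "c \<le> Inf (R x)" if "\<And>a. a \<in> R x \<Longrightarrow> c \<le> a" for c x
    by (rule cInf_greatest[OF ne that])
  have sc: "Inf (R (t *\<^sub>R x)) \<le> t * Inf (R x)" if t: "0 < t" for t x
  proof -
    have "Inf (R (t *\<^sub>R x)) / t \<le> Inf (R x)"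
    proof (rule gr)
      fix a assume "a \<in> R x"
      then obtain c where "c \<in> R (t *\<^sub>R x)" "c \<le> t * a" using scale t by blast
      then show "Inf (R (t *\<^sub>R x)) / t \<le> a" using lo[of c "t *\<^sub>R x"] t by (simp add: field_simps)
    qed
    then show ?thesis using t by (simp add: field_simps)
  qed
  have "Inf (R (x + y)) \<le> Inf (R x) + Inf (R y)" for x y
  proof -
    have "Inf (R (x + y)) - Inf (R x) \<le> Inf (R y)"
    proof (rule gr)
      fix b assume b: "b \<in> R y"
      have "Inf (R (x + y)) - b \<le> Inf (R x)"
      proof (rule gr)
        fix a assume "a \<in> R x"
        then obtain c where "c \<in> R (x + y)" "c \<le> a + b" using add b by blast
        then show "Inf (R (x + y)) - b \<le> a" using lo[of c "x + y"] by simp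
      qed
      then show "Inf (R (x + y)) - Inf (R x) \<le> b" by simp
    qed
    then show ?thesis by simp
  qed
  moreover have "Inf (R (t *\<^sub>R x)) = t * Inf (R x)" if "0 \<le> t" for t x
  proof (cases "t = 0")
    case True then show ?thesis using zero by simp
  next
    case False
    with that have t: "0 < t" by simp
    have "Inf (R x) \<le> inverse t * Inf (R (t *\<^sub>R x))"
      using sc[of "inverse t" "t *\<^sub>R x"] t by simp
    then show ?thesis using sc[OF t, of x] t by (simp add: field_simps)
  qed
  ultimately show ?thesis unfolding sublinear_def by blast
qed

text \<open>A minimal sublinear functional is linear, since it cannot lie strictly above
  \<open>x \<mapsto> inf\<^sub>t q (x + t y) - t q y\<close>.\<close>

theorem Hahn_Banach_sublinear:
  fixes p :: "'v::real_vector \<Rightarrow> real"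
  assumes p: "sublinear p"
  obtains s where "linear s" and "\<And>x. s x \<le> p x"
proof -
  define A where "A = {q. sublinear q \<and> q \<le> p}"
  have pA: "p \<in> A" using p by (simp add: A_def)
  \<comment> \<open>Zorn for the reversed order: the maximal element is a minimal sublinear
    functional below \<open>p\<close>.\<close>
  have "\<exists>m\<in>A. \<forall>a\<in>A. m \<ge> a \<longrightarrow> a = m"
  proof (rule predicate_Zorn)
    show "partial_order_on A (relation_of (\<ge>) A)"
      by (rule partial_order_on_relation_ofI) auto
    fix C assume C: "C \<in> Chains (relation_of (\<ge>) A)"
    show "\<exists>u\<in>A. \<forall>a\<in>C. a \<ge> u"
    proof (cases "C = {}")
      case True then show ?thesis using pA by auto
    next
      case False
      have CA: "a \<in> A" if "a \<in> C" for a using C that unfolding Chains_def relation_of_def by auto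
      have tot: "a \<le> b \<or> b \<le> a" if "a \<in> C" "b \<in> C" for a b
        using C that unfolding Chains_def relation_of_def by auto
      \<comment> \<open>Sublinearity bounds every member below by \<open>- p (- x)\<close>, so the
        pointwise infimum exists.\<close>
      have bdd: "bdd_below ((\<lambda>a. a x) ` C)" for x
      proof (rule bdd_belowI2)
        fix a assume "a \<in> C"
        then have "sublinear a" "a \<le> p" using CA by (auto simp: A_def)
        then show "- p (- x) \<le> a x" using sublinearD(4)[of a x] le_funD[of a p "- x"] by linarith
      qed
      define u where "u = (\<lambda>x. INF a\<in>C. a x)"
      have "sublinear u" unfolding u_def
      proof (rule sublinear_Inf)
        fix x show "(\<lambda>a. a x) ` C \<noteq> {}" using False by simp
        show "bdd_below ((\<lambda>a. a x) ` C)" by (rule bdd)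
      next
        fix x y :: 'v and v w assume "v \<in> (\<lambda>a. a x) ` C" "w \<in> (\<lambda>a. a y) ` C"
        then obtain a b where ab: "a \<in> C" "b \<in> C" and vw: "v = a x" "w = b y" by blast
        show "\<exists>c\<in>(\<lambda>a. a (x + y)) ` C. c \<le> v + w"
        proof (cases "a \<le> b")
          case True
          then have "a (x + y) \<le> a x + b y"
            using sublinearD(1)[of a x y] CA[OF ab(1)] le_funD[OF True, of y] by (simp add: A_def)
          then show ?thesis using ab vw by blast
        next
          case False
          then have "b \<le> a" using tot ab by blast
          then have "b (x + y) \<le> a x + b y"
            using sublinearD(1)[of b x y] CA[OF ab(2)] le_funD[OF \<open>b \<le> a\<close>, of x] by (simp add: A_def)
          then show ?thesis using ab vw by blast
        qed
      next
        fix t v and x :: 'v assume "v \<in> (\<lambda>a. a x) ` C" "(0::real) < t"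
        then obtain a where a: "a \<in> C" "v = a x" by blast
        then have "a (t *\<^sub>R x) \<le> t * v" using CA[of a] sublinearD(2)[of a t x] \<open>0 < t\<close> by (simp add: A_def)
        then show "\<exists>c\<in>(\<lambda>a. a (t *\<^sub>R x)) ` C. c \<le> t * v" using a by blast
      next
        have "(INF a\<in>C. a (0::'v)) = (INF a\<in>C. (0::real))"
          by (rule INF_cong) (use CA sublinearD(3) in \<open>auto simp: A_def\<close>)
        then show "(INF a\<in>C. a (0::'v)) = (0::real)" using False by simp
      qed
      moreover have le: "u \<le> a" if "a \<in> C" for a
        unfolding u_def by (rule le_funI, rule cINF_lower[OF bdd that])
      moreover have "u \<le> p" using False le CA unfolding A_def by (metis (mono_tags) ex_in_conv mem_Collect_eq order_trans)
      ultimately show ?thesis unfolding A_def by blast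
    qed
  qed
  then obtain q where q: "sublinear q" "q \<le> p" and min: "\<And>r. sublinear r \<Longrightarrow> r \<le> q \<Longrightarrow> r = q"
    unfolding A_def by (auto intro: order_trans)
  note qD = sublinearD[OF q(1)]
  have add: "q (x + y) = q x + q y" for x y
  proof -
    define F where "F = (\<lambda>t x. q (x + t *\<^sub>R y) - t * q y)"
    have bdd: "bdd_below ((\<lambda>t. F t x) ` {0..})" for x
    proof (rule bdd_belowI2)
      fix t :: real assume "t \<in> {0..}"
      then show "- q (- x) \<le> F t x"
        using qD(1)[of "x + t *\<^sub>R y" "- x"] qD(2)[of t y] by (simp add: F_def)
    qed
    have "sublinear (\<lambda>x. INF t\<in>{0..}. F t x)"
    proof (rule sublinear_Inf)
      fix x show "(\<lambda>t. F t x) ` {0..} \<noteq> {}" by simp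
      show "bdd_below ((\<lambda>t. F t x) ` {0..})" by (rule bdd)
    next
      fix x x' :: 'v and v w assume "v \<in> (\<lambda>t. F t x) ` {0..}" "w \<in> (\<lambda>t. F t x') ` {0..}"
      then obtain t t' where t: "t \<in> {0..}" "t' \<in> {0..}" and vw: "v = F t x" "w = F t' x'" by blast
      have "F (t + t') (x + x') \<le> v + w"
        using qD(1)[of "x + t *\<^sub>R y" "x' + t' *\<^sub>R y"] by (simp add: vw F_def algebra_simps)
      moreover have "t + t' \<in> {0..}" using t by simp
      ultimately show "\<exists>c\<in>(\<lambda>t. F t (x + x')) ` {0..}. c \<le> v + w" by blast
    next
      fix v s :: real and x :: 'v assume "v \<in> (\<lambda>t. F t x) ` {0..}" and s: "0 < s"
      then obtain t where t: "t \<in> {0..}" "v = F t x" by blast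
      have "F (s * t) (s *\<^sub>R x) = s * v"
        using qD(2)[of s "x + t *\<^sub>R y"] s by (simp add: t F_def algebra_simps)
      moreover have "s * t \<in> {0..}" using s t by simp
      ultimately show "\<exists>c\<in>(\<lambda>t. F t (s *\<^sub>R x)) ` {0..}. c \<le> s * v" by (metis image_eqI order_refl)
    next
      have "F t 0 = 0" if "t \<in> {0..}" for t using qD(2)[of t y] that by (simp add: F_def)
      then have "(INF t\<in>{0..}. F t 0) = (INF t\<in>{0::real..}. (0::real))" by (intro INF_cong) auto
      then show "(INF t\<in>{0..}. F t 0) = 0" by simp
    qed
    moreover have "(\<lambda>x. INF t\<in>{0..}. F t x) \<le> q"
    proof (rule le_funI)
      fix x show "(INF t\<in>{0..}. F t x) \<le> q x"
        using cINF_lower[OF bdd, of 0 x] by (simp add: F_def)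
    qed
    \<comment> \<open>The infimum lies below \<open>q\<close> because of \<open>t = 0\<close>, so
      minimality forces equality; then \<open>t = 1\<close> reads
      \<open>q x + q y \<le> q (x + y)\<close>.\<close>
    ultimately have "(\<lambda>x. INF t\<in>{0..}. F t x) = q" by (rule min)
    then have "q x \<le> F 1 x" using cINF_lower[OF bdd, of 1 x] by (metis atLeast_iff zero_le_one)
    then show ?thesis using qD(1)[of x y] by (simp add: F_def)
  qed
  have neg: "q (- x) = - q x" for x using add[of x "- x"] qD(3) by simp
  have "linear q"
  proof (rule linearI[OF add])
    fix t x show "q (t *\<^sub>R x) = t *\<^sub>R q x"
      using qD(2)[of t x] qD(2)[of "- t" x] neg[of "t *\<^sub>R x"] by (cases "0 \<le> t") auto
  qed
  then show ?thesis using q(2) that by (auto simp: le_fun_def)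
qed

section \<open>The open mapping theorem\<close>

text \<open>The closed range is complete, so by Baire the closure of the image of some ball has
  interior in it. This yields preimages up to half the norm, and correcting the residual repeatedly
  gives an exact preimage with a geometric bound.\<close>

lemma open_mapping_bounded_preimages:
  fixes F :: "'a::banach \<Rightarrow> 'b::banach"
  assumes F: "bounded_linear F" and cl: "closed (range F)"
  obtains C where "0 \<le> C" and "\<And>x. x \<in> range F \<Longrightarrow> \<exists>a. F a = x \<and> norm a \<le> C * norm x"
proof -
  interpret F: bounded_linear F by (rule F)
  define X where "X = range F"
  define T where "T n = closure (F ` cball 0 (real n))" for n :: nat
  have TX: "T n \<subseteq> X" for n unfolding T_def X_def using cl by (intro closure_minimal) auto
  have X: "\<Union>(range T) = X"
  proof
    show "X \<subseteq> \<Union>(range T)"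
    proof
      fix x assume "x \<in> X"
      then obtain a where a: "x = F a" unfolding X_def by blast
      obtain n where "norm a \<le> real n" using real_arch_simple by blast
      then have "x \<in> T n" unfolding T_def a using closure_subset by (fastforce simp: dist_norm)
      then show "x \<in> \<Union>(range T)" by blast
    qed
  qed (use TX in blast)
  have "\<exists>n. top_of_set X interior_of T n \<noteq> {}"
  proof (rule ccontr)
    assume H: "\<nexists>n. top_of_set X interior_of T n \<noteq> {}"
    have "top_of_set X interior_of \<Union>(range T) = {}"
    proof (rule Baire_category_alt)
      show "completely_metrizable_space (top_of_set X) \<or>
          locally_compact_space (top_of_set X) \<and> regular_space (top_of_set X)"
        using cl completely_metrizable_space_closedin[OF completely_metrizable_space_euclidean, of X]
        by (simp add: X_def)
      show "closedin (top_of_set X) S \<and> top_of_set X interior_of S = {}" if "S \<in> range T" for S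
        using that H TX by (auto simp: T_def intro!: closed_subset)
    qed simp
    then have "X = {}" unfolding X using interior_of_topspace[of "top_of_set X"] by simp
    then show False unfolding X_def by simp
  qed
  then obtain n x0 where x0: "x0 \<in> top_of_set X interior_of T n" by blast
  define U where "U = top_of_set X interior_of T n"
  have U: "openin (top_of_set X) U" "U \<subseteq> T n" "x0 \<in> U"
    using x0 by (simp_all add: U_def interior_of_subset)
  then obtain r where "0 < r" "ball x0 r \<inter> X \<subseteq> U"
    unfolding openin_contains_ball by blast
  moreover have "x0 \<in> X" using U TX by blast
  ultimately have r: "0 < r" "X \<inter> ball x0 r \<subseteq> T n" "x0 \<in> X"
    using U by blast+
  \<comment> \<open>Approximating both \<open>x0 + x\<close> and \<open>x0\<close> and subtracting
    moves the ball to the origin, at the price of the radius \<open>2 n\<close>.\<close>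
  have near: "\<exists>a. norm a \<le> 2 * real n \<and> norm (x - F a) < e" if x: "x \<in> X" "norm x < r" and e: "0 < e" for x e
  proof -
    obtain b b0 where "x = F b" "x0 = F b0" using x(1) r(3) unfolding X_def by blast
    then have x0x: "x0 + x \<in> X" unfolding X_def using F.add[of b0 b] by (metis rangeI)
    have "x0 + x \<in> T n" "x0 \<in> T n" using x x0x r by (auto simp: dist_norm)
    then obtain y y' where y: "y \<in> F ` cball 0 (real n)" "dist y (x0 + x) < e / 2"
      and y': "y' \<in> F ` cball 0 (real n)" "dist y' x0 < e / 2"
      using e unfolding T_def closure_approachable by (meson half_gt_zero)
    from y(1) y'(1) obtain a a' where a: "y = F a" "norm a \<le> real n" and a': "y' = F a'" "norm a' \<le> real n" by auto
    have "norm (x - F (a - a')) = norm ((y' - x0) - (y - (x0 + x)))" by (simp add: a a' F.diff algebra_simps)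
    also have "\<dots> < e" using norm_triangle_ineq4[of "y' - x0" "y - (x0 + x)"] y(2) y'(2) by (simp add: dist_norm)
    finally have "norm (x - F (a - a')) < e" .
    moreover have "norm (a - a') \<le> 2 * real n" using norm_triangle_ineq4[of a a'] a a' by simp
    ultimately show ?thesis by blast
  qed
  \<comment> \<open>Rescaling \<open>x\<close> to norm \<open>r / 2\<close> multiplies the radius
    \<open>2 n\<close> by \<open>2 * norm x / r\<close>.\<close>
  define K where "K = 4 * real n / r"
  have K0: "0 \<le> K" using r by (simp add: K_def)
  have half: "\<exists>a. norm a \<le> K * norm x \<and> norm (x - F a) \<le> norm x / 2" if x: "x \<in> X" for x
  proof (cases "x = 0")
    case True then show ?thesis by (intro exI[of _ 0]) (simp add: F.zero)
  next
    case False
    define t where "t = r / (2 * norm x)"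
    have t: "0 < t" using False r by (simp add: t_def)
    obtain b where "x = F b" using x unfolding X_def by blast
    then have tx: "t *\<^sub>R x \<in> X" unfolding X_def using F.scaleR[of t b] by (metis rangeI)
    have "norm (t *\<^sub>R x) < r" using False r t by (simp add: t_def)
    from near[OF tx this, of "r / 4"] r obtain a where a: "norm a \<le> 2 * real n" "norm (t *\<^sub>R x - F a) < r / 4" by auto
    have "norm (x - F (inverse t *\<^sub>R a)) = inverse t * norm (t *\<^sub>R x - F a)"
    proof -
      have "x - F (inverse t *\<^sub>R a) = inverse t *\<^sub>R (t *\<^sub>R x - F a)" using t by (simp add: F.scaleR scaleR_diff_right)
      then show ?thesis using t by simp
    qed
    also have "\<dots> \<le> inverse t * (r / 4)" using a t by (intro mult_left_mono) auto
    also have "\<dots> = norm x / 2" using False r by (simp add: t_def field_simps)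
    finally have 1: "norm (x - F (inverse t *\<^sub>R a)) \<le> norm x / 2" .
    have "norm (inverse t *\<^sub>R a) \<le> inverse t * (2 * real n)" using a t by (simp add: mult_left_mono)
    also have "\<dots> = K * norm x" using False r by (simp add: t_def K_def field_simps)
    finally show ?thesis using 1 by blast
  qed
  then obtain c where c: "\<And>x. x \<in> X \<Longrightarrow> norm (c x) \<le> K * norm x" "\<And>x. x \<in> X \<Longrightarrow> norm (x - F (c x)) \<le> norm x / 2"
    by metis
  have "\<exists>a. F a = x \<and> norm a \<le> 2 * K * norm x" if x: "x \<in> X" for x
  proof -
    \<comment> \<open>\<open>y k\<close> is the residual after \<open>k\<close> corrections, so the
      partial sums of \<open>F (c (y k))\<close> telescope.\<close>
    define y where "y k = ((\<lambda>x. x - F (c x)) ^^ k) x" for k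
    have y0: "y 0 = x" and yS: "y (Suc k) = y k - F (c (y k))" for k by (simp_all add: y_def)
    have yX: "y k \<in> X" for k
    proof (induction k)
      case (Suc k)
      then obtain b where "y k = F b" unfolding X_def by blast
      then have "y (Suc k) = F (b - c (y k))" by (simp add: yS F.diff)
      then show ?case by (simp add: X_def)
    qed (simp add: y0 x)
    have yn: "norm (y k) \<le> norm x * (1/2) ^ k" for k
    proof (induction k)
      case (Suc k) then show ?case using c(2)[OF yX[of k]] by (simp add: yS)
    qed (simp add: y0)
    have cn: "norm (c (y k)) \<le> K * norm x * (1/2) ^ k" for k
      using c(1)[OF yX[of k]] mult_left_mono[OF yn[of k] K0] by (simp add: mult.assoc)
    have geo: "(\<lambda>k. K * norm x * (1/2) ^ k) sums (K * norm x * 2)"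
      using sums_mult[OF geometric_sums[of "1/2::real"], of "K * norm x"] by simp
    have sn: "summable (\<lambda>k. norm (c (y k)))"
      by (rule summable_comparison_test'[OF sums_summable[OF geo]]) (simp add: cn)
    define a where "a = suminf (\<lambda>k. c (y k))"
    have "norm a \<le> suminf (\<lambda>k. norm (c (y k)))" unfolding a_def by (rule summable_norm[OF sn])
    also have "\<dots> \<le> K * norm x * 2" using suminf_le[OF cn sn sums_summable[OF geo]] sums_unique[OF geo] by simp
    finally have an: "norm a \<le> 2 * K * norm x" by simp
    have "(\<lambda>k. F (c (y k))) sums F a"
      unfolding a_def by (rule F.sums[OF summable_sums[OF summable_norm_cancel[OF sn]]])
    moreover have "(\<Sum>k<m. F (c (y k))) = x - y m" for m
      by (induction m) (simp_all add: y0 yS)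
    ultimately have "(\<lambda>m. x - y m) \<longlonglongrightarrow> F a" by (simp add: sums_def)
    moreover have "y \<longlonglongrightarrow> 0"
    proof (rule Lim_null_comparison)
      show "\<forall>\<^sub>F k in sequentially. norm (y k) \<le> norm x * (1/2) ^ k" by (simp add: yn)
      show "(\<lambda>k. norm x * (1/2) ^ k) \<longlonglongrightarrow> 0"
        using tendsto_mult_right_zero[OF LIMSEQ_power_zero[of "1/2::real"], of "norm x"] by simp
    qed
    then have "(\<lambda>m. x - y m) \<longlonglongrightarrow> x - 0" by (intro tendsto_diff tendsto_const)
    ultimately have "F a = x" using LIMSEQ_unique by fastforce
    then show ?thesis using an by blast
  qed
  then show ?thesis using that[of "2 * K"] K0 unfolding X_def by auto
qed

section \<open>The square root series\<close>

text \<open>Taylor coefficients of \<open>sqrt (1 - t)\<close> at 0.\<close>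

definition sqrt_coeff :: "nat \<Rightarrow> real" where
  "sqrt_coeff k = (1/2 gchoose k) * (- 1) ^ k"

text \<open>Vandermonde's identity: squaring the series with exponent 1/2 gives exponent 1, that is,
  \<open>1 - t\<close>.\<close>

lemma sqrt_coeff_convolution:
  "(\<Sum>i\<le>n. sqrt_coeff i * sqrt_coeff (n - i)) = (if n = 0 then 1 else if n = 1 then - 1 else 0)"
proof -
  have "(\<Sum>i\<le>n. sqrt_coeff i * sqrt_coeff (n - i)) = (- 1) ^ n * (\<Sum>i=0..n. (1/2 gchoose i) * (1/2 gchoose (n - i)))"
    unfolding sum_distrib_left atMost_atLeast0
    by (rule sum.cong) (auto simp: sqrt_coeff_def mult_ac simp flip: power_add)
  also have "\<dots> = (- 1) ^ n * ((1/2 + 1/2 :: real) gchoose n)" by (simp only: gbinomial_Vandermonde)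
  also have "(1/2 + 1/2 :: real) gchoose n = of_nat (1 choose n)" by (simp add: binomial_gbinomial)
  finally show ?thesis by (auto simp: binomial_eq_0)
qed

lemma gbinomial_minus_sign:
  fixes a :: real
  assumes "a < 0"
  shows "0 \<le> (- 1) ^ n * (a gchoose n)"
proof -
  have "(- 1) ^ n * (a gchoose n) = (\<Prod>i<n. (real i - a)) / fact n"
    by (induction n) (simp_all add: gbinomial_prod_rev lessThan_atLeast0 algebra_simps)
  then show ?thesis using assms by (simp add: prod_nonneg)
qed

text \<open>All coefficients after the first are nonpositive while every partial sum is nonnegative,
  so the absolute values of the later ones sum to at most 1. The series thus converges on the closed
  unit ball, including the elements of norm exactly 1 where it is used.\<close>

lemma summable_sqrt_coeff: "summable (\<lambda>k. \<bar>sqrt_coeff k\<bar>)"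
proof -
  have neg: "sqrt_coeff (Suc k) \<le> 0" for k
  proof -
    have "(1/2 gchoose Suc k) = (1/2) / (1 + real k) * ((1/2 - 1 :: real) gchoose k)"
      using gbinomial_absorption'[of "Suc k" "1/2 :: real"] by simp
    then have "sqrt_coeff (Suc k) = - ((1/2) / (1 + real k)) * ((- 1) ^ k * ((- (1/2) :: real) gchoose k))"
      by (simp add: sqrt_coeff_def)
    also have "\<dots> \<le> 0" using gbinomial_minus_sign[of "- (1/2)" k]
      by (intro mult_nonpos_nonneg) auto
    finally show ?thesis .
  qed
  have "(\<Sum>k<n. \<bar>sqrt_coeff (Suc k)\<bar>) \<le> 1" for n
  proof -
    have "(\<Sum>k\<le>n. sqrt_coeff k) = (- 1) ^ n * ((1/2 - 1 :: real) gchoose n)"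
      unfolding sqrt_coeff_def by (rule gbinomial_sum_lower_neg)
    moreover have "(\<Sum>k\<le>n. sqrt_coeff k) = 1 + (\<Sum>k<n. sqrt_coeff (Suc k))"
      by (simp add: sum.atMost_shift sqrt_coeff_def)
    moreover have "(\<Sum>k<n. \<bar>sqrt_coeff (Suc k)\<bar>) = - (\<Sum>k<n. sqrt_coeff (Suc k))"
      using neg by (simp add: sum_negf)
    ultimately show ?thesis using gbinomial_minus_sign[of "- (1/2)" n] by simp
  qed
  then have "summable (\<lambda>k. \<bar>sqrt_coeff (Suc k)\<bar>)"
    by (intro summableI_nonneg_bounded) auto
  then show ?thesis by (simp add: summable_Suc_iff[of "\<lambda>k. \<bar>sqrt_coeff k\<bar>"])
qed

lemma summable_sqrt_series:
  fixes u :: "nat \<Rightarrow> 'a::real_normed_vector"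
  assumes "\<And>k. norm (u k) \<le> K"
  shows "summable (\<lambda>k. norm (sqrt_coeff k *\<^sub>R u k))"
proof (rule summable_comparison_test')
  show "summable (\<lambda>k. \<bar>sqrt_coeff k\<bar> * K)" by (rule summable_mult2[OF summable_sqrt_coeff])
  show "norm (norm (sqrt_coeff k *\<^sub>R u k)) \<le> \<bar>sqrt_coeff k\<bar> * K" for k
    using assms by (simp add: mult_left_mono)
qed

text \<open>Two sequences are allowed because for operator matrices the factors are entries of
  powers rather than powers.\<close>

lemma sqrt_series_product:
  fixes u v :: "nat \<Rightarrow> 'a::{real_normed_algebra,banach}"
  assumes "\<And>k. norm (u k) \<le> K" and "\<And>k. norm (v k) \<le> K"
  shows "(\<lambda>n. \<Sum>i\<le>n. (sqrt_coeff i * sqrt_coeff (n - i)) *\<^sub>R (u i * v (n - i)))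
    sums (suminf (\<lambda>k. sqrt_coeff k *\<^sub>R u k) * suminf (\<lambda>k. sqrt_coeff k *\<^sub>R v k))"
  using Cauchy_product_sums[OF summable_sqrt_series[of u, OF assms(1)] summable_sqrt_series[of v, OF assms(2)]]
  by (simp add: scaleR_scaleR mult.commute)

lemma sqrt_coeff_sums:
  fixes w :: "nat \<Rightarrow> 'a::real_normed_vector"
  shows "(\<lambda>n. (\<Sum>i\<le>n. sqrt_coeff i * sqrt_coeff (n - i)) *\<^sub>R w n) sums (w 0 - w 1)"
proof -
  have "(\<lambda>n. (\<Sum>i\<le>n. sqrt_coeff i * sqrt_coeff (n - i)) *\<^sub>R w n)
      sums (\<Sum>n\<in>{0,1}. (\<Sum>i\<le>n. sqrt_coeff i * sqrt_coeff (n - i)) *\<^sub>R w n)"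
    by (rule sums_finite) (simp_all add: sqrt_coeff_convolution del: sum.atMost_Suc)
  moreover have "(\<Sum>n\<in>{0,1}. (\<Sum>i\<le>n. sqrt_coeff i * sqrt_coeff (n - i)) *\<^sub>R w n) = w 0 - w 1"
    unfolding sqrt_coeff_convolution by simp
  ultimately show ?thesis by simp
qed

section \<open>The involution\<close>

lemma star_simps:
  fixes x y :: "'a::cstar_algebra"
  shows star_zero [simp]: "star (0::'a) = 0"
    and star_minus: "star (- x) = - star x"
    and star_diff: "star (x - y) = star x - star y"
    and star_scaleR: "star (r *\<^sub>R x) = r *\<^sub>R star x"
proof -
  show z: "star (0::'a) = 0" using star_add[of "0::'a" 0] by simp
  show m: "star (- x) = - star x" for x :: 'a
    using star_add[of x "- x"] z by (simp add: eq_neg_iff_add_eq_0 add.commute)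
  show "star (x - y) = star x - star y"
    using star_add[of x "- y"] m by simp
  show "star (r *\<^sub>R x) = r *\<^sub>R star x"
    using star_scaleC[of "complex_of_real r" x] by (simp add: scaleC_of_real)
qed

lemma bounded_linear_star: "bounded_linear (star :: 'a::cstar_algebra \<Rightarrow> 'a)"
  by (rule bounded_linear_intro[of _ 1]) (simp_all add: star_add star_scaleR)

lemma star_sum: "star (\<Sum>i\<in>I. f i) = (\<Sum>i\<in>I. star (f i :: 'a::cstar_algebra))"
  by (rule linear_sum[OF bounded_linear.linear[OF bounded_linear_star]])

lemma norm_mult_star: "norm (x * star x) = (norm x)\<^sup>2" for x :: "'a::cstar_algebra"
  using cstar_identity[of "star x"] by (simp add: star_star)

section \<open>Unitization\<close>

datatype 'a unitz = Unitz (uvec: 'a) (uscal: complex)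

lemma unitz_eqI: "uvec u = uvec v \<Longrightarrow> uscal u = uscal v \<Longrightarrow> u = v"
  by (rule unitz.expand) simp

text \<open>The action of the unitization on its ideal by left multiplication; its operator norm is
  the C*-norm when the algebra has no unit.\<close>

definition uact :: "'a::cstar_algebra unitz \<Rightarrow> 'a \<Rightarrow> 'a" where
  "uact u y = uvec u * y + uscal u *\<^sub>C y"

lemma bounded_linear_uact: "bounded_linear (uact u)"
  unfolding uact_def
  by (intro bounded_linear_add bounded_linear_mult_right bounded_linear_scaleC)

instantiation unitz :: (cstar_algebra) "{complex_normed_vector, times, one, star}"
begin

definition zero_unitz :: "'a unitz" where "0 = Unitz 0 0"
definition one_unitz :: "'a unitz" where "1 = Unitz 0 1"
definition plus_unitz :: "'a unitz \<Rightarrow> 'a unitz \<Rightarrow> 'a unitz" where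
  "u + v = Unitz (uvec u + uvec v) (uscal u + uscal v)"
definition uminus_unitz :: "'a unitz \<Rightarrow> 'a unitz" where
  "- u = Unitz (- uvec u) (- uscal u)"
definition minus_unitz :: "'a unitz \<Rightarrow> 'a unitz \<Rightarrow> 'a unitz" where
  "u - v = Unitz (uvec u - uvec v) (uscal u - uscal v)"
definition scaleR_unitz :: "real \<Rightarrow> 'a unitz \<Rightarrow> 'a unitz" where
  "r *\<^sub>R u = Unitz (r *\<^sub>R uvec u) (complex_of_real r * uscal u)"
definition scaleC_unitz :: "complex \<Rightarrow> 'a unitz \<Rightarrow> 'a unitz" where
  "c *\<^sub>C u = Unitz (c *\<^sub>C uvec u) (c * uscal u)"
definition times_unitz :: "'a unitz \<Rightarrow> 'a unitz \<Rightarrow> 'a unitz" where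
  "u * v = Unitz (uvec u * uvec v + uscal u *\<^sub>C uvec v + uscal v *\<^sub>C uvec u) (uscal u * uscal v)"
definition star_unitz :: "'a unitz \<Rightarrow> 'a unitz" where
  "star u = Unitz (star (uvec u)) (cnj (uscal u))"

text \<open>The scalar part enters the norm separately so that the norm is definite even if the
  algebra already has a unit.\<close>

definition norm_unitz :: "'a unitz \<Rightarrow> real" where
  "norm u = max (cmod (uscal u)) (onorm (uact u))"
definition dist_unitz :: "'a unitz \<Rightarrow> 'a unitz \<Rightarrow> real" where
  "dist_unitz a b = norm (a - b)"
definition sgn_unitz :: "'a unitz \<Rightarrow> 'a unitz" where
  "sgn_unitz a = scaleR (inverse (norm a)) a"
definition uniformity_unitz :: "('a unitz \<times> 'a unitz) filter" where
  "uniformity_unitz = (INF e\<in>{0 <..}. principal {(a, b). dist a b < e})"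
definition open_unitz :: "'a unitz set \<Rightarrow> bool" where
  "open_unitz U = (\<forall>a\<in>U. eventually (\<lambda>(a', b). a' = a \<longrightarrow> b \<in> U) uniformity)"

lemma unitz_sel [simp]:
  fixes u v :: "'a unitz"
  shows "uvec (0::'a unitz) = 0" "uscal (0::'a unitz) = 0" "uvec (1::'a unitz) = 0" "uscal (1::'a unitz) = 1"
    "uvec (u + v) = uvec u + uvec v" "uscal (u + v) = uscal u + uscal v"
    "uvec (- u) = - uvec u" "uscal (- u) = - uscal u"
    "uvec (u - v) = uvec u - uvec v" "uscal (u - v) = uscal u - uscal v"
    "uvec (r *\<^sub>R u) = r *\<^sub>R uvec u" "uscal (r *\<^sub>R u) = complex_of_real r * uscal u"
    "uvec (c *\<^sub>C u) = c *\<^sub>C uvec u" "uscal (c *\<^sub>C u) = c * uscal u"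
    "uvec (u * v) = uvec u * uvec v + uscal u *\<^sub>C uvec v + uscal v *\<^sub>C uvec u"
    "uscal (u * v) = uscal u * uscal v"
    "uvec (star u) = star (uvec u)" "uscal (star u) = cnj (uscal u)"
  by (simp_all add: zero_unitz_def one_unitz_def plus_unitz_def uminus_unitz_def minus_unitz_def
      scaleR_unitz_def scaleC_unitz_def times_unitz_def star_unitz_def)

lemma norm_uscal_le: "cmod (uscal u) \<le> norm u" for u :: "'a unitz"
  by (simp add: norm_unitz_def)

lemma norm_uact_le: "norm (uact u y) \<le> norm u * norm y" for u :: "'a unitz"
proof -
  have "norm (uact u y) \<le> onorm (uact u) * norm y" by (rule onorm[OF bounded_linear_uact])
  also have "\<dots> \<le> norm u * norm y" by (intro mult_right_mono) (simp_all add: norm_unitz_def)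
  finally show ?thesis .
qed

lemma norm_unitz_le:
  fixes u :: "'a unitz"
  assumes "cmod (uscal u) \<le> K" and "\<And>y. norm (uact u y) \<le> K * norm y"
  shows "norm u \<le> K"
  unfolding norm_unitz_def using assms order_trans[OF norm_ge_zero assms(1)] by (auto intro!: onorm_bound)

lemma uact_simps:
  fixes u v :: "'a unitz"
  shows "uact (u + v) y = uact u y + uact v y"
    and "uact (r *\<^sub>R u) y = r *\<^sub>R uact u y"
    and "uact (c *\<^sub>C u) y = c *\<^sub>C uact u y"
    and "uact (u * v) y = uact u (uact v y)"
    and "star (uact u y) * uact v y = star y * uact (star u * v) y"
  by (simp_all add: uact_def algebra_simps scaleC_add_left scaleC_add_right scaleR_add_right
      scaleC_scaleC scaleC_mult_left scaleC_mult_right star_add star_mult star_scaleC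
      flip: scaleC_of_real)

instance
proof
  fix a b c :: "'a unitz" and r s :: real and u v :: complex
  show "dist a b = norm (a - b)" by (rule dist_unitz_def)
  show "sgn a = scaleR (inverse (norm a)) a" by (rule sgn_unitz_def)
  show "(uniformity :: ('a unitz \<times> 'a unitz) filter) = (INF e\<in>{0 <..}. principal {(a, b). dist a b < e})"
    by (rule uniformity_unitz_def)
  show "open U = (\<forall>a\<in>U. eventually (\<lambda>(a', b). a' = a \<longrightarrow> b \<in> U) uniformity)" for U :: "'a unitz set"
    by (rule open_unitz_def)
  show "a + b + c = a + (b + c)" "a + b = b + a" "0 + a = a" "- a + a = 0" "a - b = a + - b"
    by (rule unitz_eqI; simp)+
  show "r *\<^sub>R (a + b) = r *\<^sub>R a + r *\<^sub>R b" "(r + s) *\<^sub>R a = r *\<^sub>R a + s *\<^sub>R a"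
    "r *\<^sub>R s *\<^sub>R a = (r * s) *\<^sub>R a" "1 *\<^sub>R a = a"
    by (rule unitz_eqI; simp add: algebra_simps)+
  show "u *\<^sub>C (a + b) = u *\<^sub>C a + u *\<^sub>C b" "(u + v) *\<^sub>C a = u *\<^sub>C a + v *\<^sub>C a"
    "u *\<^sub>C v *\<^sub>C a = (u * v) *\<^sub>C a" "complex_of_real r *\<^sub>C a = r *\<^sub>R a"
    by (rule unitz_eqI; simp add: algebra_simps scaleC_add_right scaleC_add_left scaleC_scaleC scaleC_of_real)+
  have leC: "norm (u *\<^sub>C a) \<le> cmod u * norm a" for u and a :: "'a unitz"
    using norm_uscal_le[of a] norm_uact_le[of a]
    by (intro norm_unitz_le) (simp_all add: norm_mult mult_left_mono uact_simps norm_scaleC mult.assoc)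
  show nC: "norm (u *\<^sub>C a) = cmod u * norm a" for u
  proof (cases "u = 0")
    case True
    have "0 \<le> norm (u *\<^sub>C a)" using norm_uscal_le order_trans norm_ge_zero by blast
    then show ?thesis using leC[of u a] True by simp
  next
    case False
    have "inverse u *\<^sub>C u *\<^sub>C a = a" by (rule unitz_eqI) (simp_all add: scaleC_scaleC False)
    then have "norm a \<le> cmod (inverse u) * norm (u *\<^sub>C a)" using leC[of "inverse u" "u *\<^sub>C a"] by simp
    then have "cmod u * norm a \<le> norm (u *\<^sub>C a)" using False by (simp add: norm_inverse norm_divide field_simps)
    then show ?thesis using leC[of u a] by simp
  qed
  have "r *\<^sub>R a = complex_of_real r *\<^sub>C a" by (rule unitz_eqI) (simp_all add: scaleC_of_real)
  then show "norm (r *\<^sub>R a) = \<bar>r\<bar> * norm a" using nC[of "complex_of_real r"] by simp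
  show "norm (a + b) \<le> norm a + norm b"
  proof (rule norm_unitz_le)
    show "cmod (uscal (a + b)) \<le> norm a + norm b"
      using norm_triangle_ineq[of "uscal a" "uscal b"] norm_uscal_le[of a] norm_uscal_le[of b] by simp
    show "norm (uact (a + b) y) \<le> (norm a + norm b) * norm y" for y
      using norm_triangle_ineq[of "uact a y" "uact b y"] norm_uact_le[of a y] norm_uact_le[of b y]
      by (simp add: uact_simps distrib_right)
  qed
  show "(norm a = 0) = (a = 0)"
  proof
    assume n: "norm a = 0"
    then have "uscal a = 0" using norm_uscal_le[of a] by simp
    \<comment> \<open>With the scalar part gone, evaluating at the adjoint gives
      \<open>b * star b = 0\<close> for the vector part \<open>b\<close>.\<close>
    moreover have "uact a (star (uvec a)) = 0" using norm_uact_le[of a "star (uvec a)"] n by simp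
    ultimately have "uvec a * star (uvec a) = 0" by (simp add: uact_def)
    then have "norm (uvec a) = 0" using norm_mult_star[of "uvec a"] by simp
    then show "a = 0" using \<open>uscal a = 0\<close> by (intro unitz_eqI) simp_all
  next
    assume "a = 0"
    moreover have "norm (0::'a unitz) \<le> 0" by (rule norm_unitz_le) (simp_all add: uact_def)
    moreover have "0 \<le> norm (0::'a unitz)" using norm_uscal_le order_trans norm_ge_zero by blast
    ultimately show "norm a = 0" by simp
  qed
qed

end

definition unitz_emb :: "'a::cstar_algebra \<Rightarrow> 'a unitz" where
  "unitz_emb b = Unitz b 0"

lemma unitz_emb_sel [simp]: "uvec (unitz_emb b) = b" "uscal (unitz_emb b) = 0"
  by (simp_all add: unitz_emb_def)

lemma norm_unitz_emb [simp]: "norm (unitz_emb b) = norm b"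
proof (rule antisym)
  show "norm (unitz_emb b) \<le> norm b"
    by (rule norm_unitz_le) (simp_all add: uact_def norm_mult_ineq)
  show "norm b \<le> norm (unitz_emb b)"
  proof (cases "b = 0")
    case False
    have "norm b * norm b \<le> norm (unitz_emb b) * norm b"
      using norm_uact_le[of "unitz_emb b" "star b"]
      by (simp add: uact_def norm_mult_star power2_eq_square)
    then show ?thesis using False by simp
  qed simp
qed

text \<open>Subtracting the scalar part costs at most another \<open>norm u\<close>. The estimate
  makes the vector parts of a Cauchy sequence Cauchy, which completeness needs.\<close>

lemma norm_uvec_le: "norm (uvec u) \<le> 2 * norm u"
proof -
  have "norm (Unitz 0 c :: 'a unitz) \<le> cmod c" for c
    by (rule norm_unitz_le) (simp_all add: uact_def norm_scaleC)
  from this[of "uscal u"] have "norm (Unitz 0 (uscal u) :: 'a unitz) \<le> norm u"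
    using norm_uscal_le[of u] by linarith
  moreover have "unitz_emb (uvec u) = u - Unitz 0 (uscal u)" by (rule unitz_eqI) simp_all
  ultimately show ?thesis
    using norm_triangle_ineq4[of u "Unitz 0 (uscal u)"] norm_unitz_emb[of "uvec u"] by simp
qed

instance unitz :: (cstar_algebra) "{cstar_algebra, real_normed_algebra_1}"
proof
  fix a b c :: "'a unitz" and r :: real and u :: complex
  note S = distrib_left distrib_right scaleC_add_left scaleC_add_right scaleC_scaleC
    scaleC_mult_left scaleC_mult_right mult_ac add_ac
  show "a * b * c = a * (b * c)" by (rule unitz_eqI; simp add: S)
  show "(a + b) * c = a * c + b * c" by (rule unitz_eqI; simp add: S)
  show "a * (b + c) = a * b + a * c" by (rule unitz_eqI; simp add: S)
  show l: "u *\<^sub>C a * b = u *\<^sub>C (a * b)" for u by (rule unitz_eqI; simp add: S)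
  show r: "a * u *\<^sub>C b = u *\<^sub>C (a * b)" for u by (rule unitz_eqI; simp add: S)
  show "r *\<^sub>R a * b = r *\<^sub>R (a * b)" "a * r *\<^sub>R b = r *\<^sub>R (a * b)"
    using l[of "complex_of_real r"] r[of "complex_of_real r"] by (simp_all add: scaleC_of_real)
  show "star (a + b) = star a + star b" by (rule unitz_eqI; simp add: star_add)
  show "star (u *\<^sub>C a) = cnj u *\<^sub>C star a" by (rule unitz_eqI; simp add: star_scaleC)
  show "star (a * b) = star b * star a" by (rule unitz_eqI; simp add: S star_add star_mult star_scaleC)
  show "star (star a) = a" by (rule unitz_eqI; simp add: star_star)
  show "1 * a = a" "a * 1 = a" by (rule unitz_eqI; simp)+
  show "(0::'a unitz) \<noteq> 1" by (metis unitz_sel(2,4) zero_neq_one)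
  show "norm (1::'a unitz) = 1"
  proof (rule antisym)
    show "norm (1::'a unitz) \<le> 1" by (rule norm_unitz_le) (simp_all add: uact_def)
    show "1 \<le> norm (1::'a unitz)" using norm_uscal_le[of "1::'a unitz"] by simp
  qed
  show sub: "norm (a * b) \<le> norm a * norm b" for a b :: "'a unitz"
  proof (rule norm_unitz_le)
    show "cmod (uscal (a * b)) \<le> norm a * norm b"
      by (simp add: norm_mult norm_uscal_le mult_mono)
    fix y
    have "norm (uact (a * b) y) \<le> norm a * norm (uact b y)" by (simp add: uact_simps norm_uact_le)
    also have "\<dots> \<le> norm a * (norm b * norm y)" by (intro mult_left_mono norm_uact_le) simp
    finally show "norm (uact (a * b) y) \<le> norm a * norm b * norm y" by (simp add: mult.assoc)
  qed
  have le: "(norm a)\<^sup>2 \<le> norm (star a * a)" for a :: "'a unitz"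
  proof -
    have "norm a \<le> sqrt (norm (star a * a))"
    proof (rule norm_unitz_le)
      have "(cmod (uscal a))\<^sup>2 \<le> norm (star a * a)"
        using norm_uscal_le[of "star a * a"] by (simp add: norm_mult power2_eq_square)
      then show "cmod (uscal a) \<le> sqrt (norm (star a * a))" by (rule real_le_rsqrt)
      fix y
      \<comment> \<open>The C*-identity of the original algebra at \<open>uact a y\<close> brings in
        \<open>star a * a\<close>.\<close>
      have "(norm (uact a y))\<^sup>2 = norm (star y * uact (star a * a) y)"
        by (simp add: uact_simps(5)[symmetric] cstar_identity)
      also have "\<dots> \<le> norm (star y) * norm (uact (star a * a) y)" by (rule norm_mult_ineq)
      also have "\<dots> \<le> norm y * (norm (star a * a) * norm y)" by (simp add: mult_left_mono norm_uact_le)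
      also have "\<dots> = (sqrt (norm (star a * a)) * norm y)\<^sup>2"
        by (simp add: power_mult_distrib power2_eq_square[of "norm y"])
      finally show "norm (uact a y) \<le> sqrt (norm (star a * a)) * norm y"
        by (rule power2_le_imp_le) simp
    qed
    then show ?thesis using power_mono[of "norm a" "sqrt (norm (star a * a))" 2] by simp
  qed
  have st: "star (star a) = a" for a :: "'a unitz" by (rule unitz_eqI) (simp_all add: star_star)
  have "norm a \<le> norm (star a)" for a :: "'a unitz"
  proof (cases "norm a = 0")
    case False
    have "norm a * norm a \<le> norm (star a) * norm a"
      using le[of a] sub[of "star a" a] by (simp add: power2_eq_square)
    then show ?thesis using False by simp
  qed simp
  from this[of a] this[of "star a"] have "norm (star a) = norm a" by (simp add: st)
  then show "norm (star a * a) = (norm a)\<^sup>2"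
    using le[of a] sub[of "star a" a] by (simp add: power2_eq_square)
  show "convergent X" if X: "Cauchy X" for X :: "nat \<Rightarrow> 'a unitz"
  proof -
    have "Cauchy (\<lambda>n. uvec (X n))"
    proof (rule metric_CauchyI)
      fix e :: real assume "0 < e"
      then obtain M where M: "\<And>m n. m \<ge> M \<Longrightarrow> n \<ge> M \<Longrightarrow> dist (X m) (X n) < e / 2"
        using X unfolding Cauchy_def by (meson half_gt_zero)
      have "dist (uvec (X m)) (uvec (X n)) < e" if "m \<ge> M" "n \<ge> M" for m n
        using norm_uvec_le[of "X m - X n"] M[OF that] by (simp add: dist_norm)
      then show "\<exists>M. \<forall>m\<ge>M. \<forall>n\<ge>M. dist (uvec (X m)) (uvec (X n)) < e" by blast
    qed
    then obtain b where b: "(\<lambda>n. uvec (X n)) \<longlonglongrightarrow> b" using Cauchy_convergent convergent_def by blast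
    have "dist (uscal (X m)) (uscal (X n)) \<le> dist (X m) (X n)" for m n
      using norm_uscal_le[of "X m - X n"] by (simp add: dist_norm)
    then have "Cauchy (\<lambda>n. uscal (X n))" using X unfolding Cauchy_def by (meson le_less_trans)
    then obtain c where c: "(\<lambda>n. uscal (X n)) \<longlonglongrightarrow> c" using Cauchy_convergent convergent_def by blast
    have "X \<longlonglongrightarrow> Unitz b c"
    proof (rule LIM_zero_cancel, rule Lim_null_comparison)
      have "norm (X n - Unitz b c) \<le> norm (uvec (X n) - b) + cmod (uscal (X n) - c)" for n
      proof (rule norm_unitz_le)
        fix y
        have "norm (uact (X n - Unitz b c) y) \<le> norm ((uvec (X n) - b) * y) + norm ((uscal (X n) - c) *\<^sub>C y)"
          by (simp add: uact_def norm_triangle_ineq)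
        also have "\<dots> \<le> (norm (uvec (X n) - b) + cmod (uscal (X n) - c)) * norm y"
          using norm_mult_ineq[of "uvec (X n) - b" y] by (simp add: norm_scaleC distrib_right)
        finally show "norm (uact (X n - Unitz b c) y) \<le> (norm (uvec (X n) - b) + cmod (uscal (X n) - c)) * norm y" .
      qed simp
      then show "\<forall>\<^sub>F n in sequentially. norm (X n - Unitz b c) \<le> norm (uvec (X n) - b) + cmod (uscal (X n) - c)"
        by simp
      show "(\<lambda>n. norm (uvec (X n) - b) + cmod (uscal (X n) - c)) \<longlonglongrightarrow> 0"
        by (intro tendsto_add_zero tendsto_norm_zero LIM_zero b c)
    qed
    then show ?thesis by (rule convergentI)
  qed
qed

lemma unitz_emb_simps:
  "unitz_emb 0 = 0" "unitz_emb (a + b) = unitz_emb a + unitz_emb b"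
  "unitz_emb (a - b) = unitz_emb a - unitz_emb b" "unitz_emb (a * b) = unitz_emb a * unitz_emb b"
  "unitz_emb (r *\<^sub>R a) = r *\<^sub>R unitz_emb a"
  "unitz_emb (c *\<^sub>C a) = c *\<^sub>C unitz_emb a" "unitz_emb (star a) = star (unitz_emb a)"
  by (rule unitz_eqI; simp)+

section \<open>Approximate units in C*-subalgebras\<close>

lemma scaleC_minus_left [simp]: "(- c) *\<^sub>C x = - (c *\<^sub>C x)" for x :: "'a::complex_normed_vector"
proof -
  have "(- c) *\<^sub>C x + c *\<^sub>C x = 0" using scaleC_add_left[of "- c" c x] by simp
  then show ?thesis by (simp add: eq_neg_iff_add_eq_0)
qed

lemma star_one [simp]: "star (1::'a::{cstar_algebra,real_normed_algebra_1}) = 1"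
  by (metis mult_1 mult_1_right star_mult star_star)

lemma star_power: "star (x ^ n) = star x ^ n" for x :: "'a::{cstar_algebra,real_normed_algebra_1}"
  by (induction n) (simp_all add: star_mult power_commutes)

lemma power_norm_le_one: "norm (T ^ k) \<le> 1" if "norm T \<le> 1" for T :: "'a::real_normed_algebra_1"
  using norm_power_ineq[of T k] power_le_one[OF norm_ge_zero that, of k] by linarith

definition sqrt_one_minus :: "'a::{real_normed_algebra_1,banach} \<Rightarrow> 'a" where
  "sqrt_one_minus T = suminf (\<lambda>k. sqrt_coeff k *\<^sub>R T ^ k)"

lemma sums_sqrt_one_minus:
  assumes "norm T \<le> 1"
  shows "(\<lambda>k. sqrt_coeff k *\<^sub>R T ^ k) sums sqrt_one_minus T"
  unfolding sqrt_one_minus_def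
  by (intro summable_sums summable_norm_cancel[OF summable_sqrt_series[of _ 1]] power_norm_le_one assms)

lemma sqrt_one_minus_square:
  assumes "norm T \<le> 1"
  shows "sqrt_one_minus T * sqrt_one_minus T = 1 - T"
proof -
  have "(\<lambda>n. \<Sum>i\<le>n. (sqrt_coeff i * sqrt_coeff (n - i)) *\<^sub>R (T ^ i * T ^ (n - i)))
      sums (sqrt_one_minus T * sqrt_one_minus T)"
    unfolding sqrt_one_minus_def by (rule sqrt_series_product) (rule power_norm_le_one[OF assms])+
  moreover have "(\<Sum>i\<le>n. (sqrt_coeff i * sqrt_coeff (n - i)) *\<^sub>R (T ^ i * T ^ (n - i)))
      = (\<Sum>i\<le>n. sqrt_coeff i * sqrt_coeff (n - i)) *\<^sub>R T ^ n" for n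
    by (simp add: scaleR_sum_left flip: power_add)
  ultimately show ?thesis
    using sqrt_coeff_sums[of "\<lambda>n. T ^ n"] sums_unique2 by fastforce
qed

lemma sqrt_one_minus_commute:
  assumes "norm T \<le> 1" and "x * T = T * x"
  shows "x * sqrt_one_minus T = sqrt_one_minus T * x"
proof -
  have "x * T ^ k = T ^ k * x" for k
    using power_commuting_commutes[of T x k] assms(2) by simp
  then show ?thesis
    using sums_mult[OF sums_sqrt_one_minus[OF assms(1)], of x] sums_mult2[OF sums_sqrt_one_minus[OF assms(1)], of x]
      sums_unique2 by fastforce
qed

lemma star_sqrt_one_minus:
  fixes T :: "'a::{cstar_algebra,real_normed_algebra_1}"
  assumes "norm T \<le> 1" and "star T = T"
  shows "star (sqrt_one_minus T) = sqrt_one_minus T"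
proof -
  have "(\<lambda>k. star (sqrt_coeff k *\<^sub>R T ^ k)) sums star (sqrt_one_minus T)"
    by (rule bounded_linear.sums[OF bounded_linear_star sums_sqrt_one_minus[OF assms(1)]])
  then show ?thesis
    using sums_sqrt_one_minus[OF assms(1)] sums_unique2 by (fastforce simp: star_scaleR star_power assms(2))
qed

text \<open>\<open>x + \<i> sqrt (1 - x\<^sup>2)\<close> is unitary.\<close>

lemma norm_one_minus_square_le:
  fixes x :: "'a::{cstar_algebra,real_normed_algebra_1}"
  assumes x: "star x = x" "norm x \<le> 1"
  shows "norm (1 - x * x) \<le> 1"
proof -
  have n: "norm (x * x) \<le> 1"
    using norm_mult_ineq[of x x] mult_le_one[OF x(2) norm_ge_zero x(2)] by simp
  define z where "z = sqrt_one_minus (x * x)"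
  have z: "z * z = 1 - x * x" "star z = z" "x * z = z * x"
    unfolding z_def using n x
    by (auto intro!: sqrt_one_minus_square star_sqrt_one_minus sqrt_one_minus_commute simp: star_mult mult.assoc)
  define u where "u = x + \<i> *\<^sub>C z"
  have su: "star u = x - \<i> *\<^sub>C z"
    by (simp add: u_def star_add star_scaleC x z)
  have "star u * u = 1"
    unfolding su unfolding u_def
    by (simp add: algebra_simps scaleC_mult_left scaleC_mult_right scaleC_scaleC scaleC_diff_right scaleC_add_right z)
  then have nu: "norm u = 1"
    using cstar_identity[of u] by (simp add: power2_eq_square square_eq_1_iff) (smt (verit) norm_ge_zero)
  \<comment> \<open>\<open>z\<close> is the imaginary part of the unitary \<open>u\<close>, hence a
    contraction, and \<open>1 - x * x\<close> is its square.\<close>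
  have "2 * norm z = norm ((2 * \<i>) *\<^sub>C z)" by (simp add: norm_scaleC)
  also have "(2 * \<i>) *\<^sub>C z = u - star u"
    unfolding su unfolding u_def using scaleC_add_left[of "\<i>" "\<i>" z] by (simp only: mult_2 add_diff_add diff_diff_eq2) simp
  also have "norm (u - star u) \<le> norm u + norm (star u)" by (rule norm_triangle_ineq4)
  finally have "norm z \<le> 1" using nu by simp
  then show ?thesis
    using norm_mult_ineq[of z z] mult_le_one[of "norm z" "norm z"] by (simp add: z)
qed

lemma cstar_subalgebraD:
  assumes "cstar_subalgebra X"
  shows "0 \<in> X" "x \<in> X \<Longrightarrow> y \<in> X \<Longrightarrow> x + y \<in> X" "x \<in> X \<Longrightarrow> y \<in> X \<Longrightarrow> x - y \<in> X"
    "x \<in> X \<Longrightarrow> c *\<^sub>C x \<in> X" "x \<in> X \<Longrightarrow> r *\<^sub>R x \<in> X" "x \<in> X \<Longrightarrow> y \<in> X \<Longrightarrow> x * y \<in> X"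
    "x \<in> X \<Longrightarrow> star x \<in> X"
proof -
  show 1: "0 \<in> X" "x \<in> X \<Longrightarrow> y \<in> X \<Longrightarrow> x + y \<in> X" "x \<in> X \<Longrightarrow> c *\<^sub>C x \<in> X"
      "x \<in> X \<Longrightarrow> y \<in> X \<Longrightarrow> x * y \<in> X" "x \<in> X \<Longrightarrow> star x \<in> X" for x y c
    using assms by (auto simp: cstar_subalgebra_def)
  show 2: "x \<in> X \<Longrightarrow> r *\<^sub>R x \<in> X" for x r
    using 1(3)[of x "complex_of_real r"] by (simp add: scaleC_of_real)
  show "x \<in> X \<Longrightarrow> y \<in> X \<Longrightarrow> x - y \<in> X"
    using 1(2)[of x "(- 1) *\<^sub>R y"] 2[of y "- 1"] by simp
qed

lemma cstar_subalgebra_sum: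
  assumes "cstar_subalgebra X" and "\<And>i. i \<in> I \<Longrightarrow> f i \<in> X"
  shows "(\<Sum>i\<in>I. f i) \<in> X"
  using assms(2) by (induction I rule: infinite_finite_induct) (simp_all add: cstar_subalgebraD[OF assms(1)])

text \<open>With \<open>k = x\<^sup>* x\<close> and \<open>t = 1 - k\<^sup>2\<close>, the averages \<open>1 - e = (1 + t + \<dots> + t\<^sup>N\<^sup>-\<^sup>1) / N\<close> satisfy
  \<open>\<parallel>x (1 - e)\<parallel>\<^sup>4 \<le> \<parallel>k\<^sup>2 (1 - e)\<parallel> = \<parallel>1 - t\<^sup>N\<parallel> / N\<close>.\<close>

lemma approximate_right_unit:
  fixes x :: "'a::cstar_algebra"
  assumes X: "cstar_subalgebra X" and x: "x \<in> X" and d: "0 < d"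
  shows "\<exists>e\<in>X. norm (1 - unitz_emb e) \<le> 1 \<and> norm (x - x * e) \<le> d"
proof (cases "x = 0")
  case True
  then show ?thesis using d by (intro bexI[of _ 0]) (simp_all add: unitz_emb_simps cstar_subalgebraD[OF X])
next
  case False
  note D = cstar_subalgebraD[OF X]
  define y where "y = inverse (norm x) *\<^sub>R x"
  have y: "y \<in> X" "norm y = 1" using D x False by (simp_all add: y_def)
  define k where "k = star y * y"
  have k: "k \<in> X" "norm k = 1" "star k = k"
    using D y by (simp_all add: k_def cstar_identity star_mult star_star)
  define K where "K = unitz_emb k"
  have K: "star K = K" "norm K \<le> 1" using k by (simp_all add: K_def flip: unitz_emb_simps)
  define T where "T = 1 - K * K"
  have T: "norm T \<le> 1" "star T = T" unfolding T_def using K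
    by (auto intro!: norm_one_minus_square_le simp: star_diff star_mult)
  \<comment> \<open>\<open>2 / N\<close> has to lie below the fourth power of the target, since two
    uses of the C*-identity bound \<open>norm w ^ 4\<close>.\<close>
  obtain N :: nat where N: "2 / (d / norm x) ^ 4 < real N" using reals_Archimedean2 by blast
  have dx: "0 < (d / norm x) ^ 4" using d False by simp
  have N0: "0 < real N" using N dx by (meson divide_nonneg_pos less_le_not_le linorder_not_le order_trans zero_le_numeral)
  define A where "A = (1 / real N) *\<^sub>R (\<Sum>j<N. T ^ j)"
  have nA: "norm A \<le> 1"
  proof -
    have "norm (\<Sum>j<N. T ^ j) \<le> (\<Sum>j<N. 1)" by (rule sum_norm_le) (rule power_norm_le_one[OF T(1)])
    then show ?thesis using N0 by (simp add: A_def)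
  qed
  have sA: "star A = A" by (simp add: A_def star_scaleR star_sum star_power T)
  have KT: "K * T = T * K" by (simp add: T_def algebra_simps)
  have "K * T ^ j = T ^ j * K" for j
    using power_commuting_commutes[of T K j] KT by simp
  then have KA: "K * A = A * K" by (simp add: A_def sum_distrib_left sum_distrib_right)
  have "(1 - T) * (\<Sum>j<n. T ^ j) = 1 - T ^ n" for n
    by (induction n) (simp_all add: distrib_left, simp add: left_diff_distrib)
  then have "(1 - T) * A = (1 / real N) *\<^sub>R (1 - T ^ N)"
    unfolding A_def mult_scaleR_right by simp
  moreover have "1 - T = K * K" by (simp add: T_def)
  ultimately have "K * K * A = (1 / real N) *\<^sub>R (1 - T ^ N)" by simp
  moreover have "norm (1 - T ^ N) \<le> 2"
    using norm_triangle_ineq4[of 1 "T ^ N"] power_norm_le_one[OF T(1), of N] by simp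
  ultimately have KKA: "norm (K * K * A) \<le> 2 / real N"
    using N0 by (simp add: divide_right_mono)
  \<comment> \<open>\<open>w\<close> is the normalized error \<open>y (1 - e)\<close>;
    \<open>v\<close> is \<open>star w * w\<close>, and \<open>star v * v\<close> contains the small
    factor \<open>K * K * A\<close>.\<close>
  define w where "w = unitz_emb y * A"
  define v where "v = K * (A * A)"
  have "star w * w = A * K * A"
    by (simp add: w_def star_mult sA K_def k_def unitz_emb_simps mult.assoc)
  also have "\<dots> = K * A * A" by (simp only: KA)
  also have "\<dots> = v" by (simp add: v_def mult.assoc)
  finally have wv: "(norm w)\<^sup>2 = norm v" using cstar_identity[of w] by simp
  have AK: "A * K = K * A" "A * (K * z) = K * (A * z)" for z
    by (simp_all only: KA mult.assoc[symmetric])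
  have "star v * v = (K * K * A) * (A * A * A)"
    by (simp add: v_def star_mult sA K mult.assoc AK)
  then have "(norm v)\<^sup>2 = norm ((K * K * A) * (A * A * A))" using cstar_identity[of v] by simp
  also have "\<dots> \<le> norm (K * K * A) * norm (A * A * A)" by (rule norm_mult_ineq)
  also have "\<dots> \<le> norm (K * K * A) * 1"
  proof (rule mult_left_mono)
    have "norm (A ^ 3) \<le> 1" by (rule power_norm_le_one[OF nA])
    then show "norm (A * A * A) \<le> 1" by (simp add: power3_eq_cube)
  qed simp
  also have "\<dots> \<le> (d / norm x) ^ 4"
  proof -
    have "2 < real N * (d / norm x) ^ 4" using N dx by (simp only: pos_divide_less_eq)
    then have "2 / real N \<le> (d / norm x) ^ 4" using N0 by (simp only: pos_divide_le_eq) (simp add: mult.commute)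
    then show ?thesis using KKA by simp
  qed
  finally have "norm w ^ 4 \<le> (d / norm x) ^ 4" by (simp flip: wv power_mult)
  then have nw: "norm w \<le> d / norm x" using d by (simp add: power_mono_iff)
  \<comment> \<open>\<open>1 - T ^ j\<close> is a polynomial in \<open>k\<close> without constant
    term, so it comes from \<open>X\<close>.\<close>
  have "1 - T ^ j \<in> unitz_emb ` X" for j
  proof (induction j)
    case 0 then show ?case using D(1) by (auto simp: image_iff unitz_emb_simps intro!: bexI[of _ 0])
  next
    case (Suc j)
    then obtain b where b: "b \<in> X" "1 - T ^ j = unitz_emb b" by blast
    have "1 - T ^ Suc j = (1 - T ^ j) + (1 - (1 - T ^ j)) * (1 - T)" by (simp add: algebra_simps power_commutes)
    also have "1 - T = unitz_emb (k * k)" by (simp add: T_def K_def unitz_emb_simps)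
    also have "(1 - T ^ j) + (1 - (1 - T ^ j)) * unitz_emb (k * k) = unitz_emb (b + k * k - b * (k * k))"
      unfolding b by (simp add: unitz_emb_simps algebra_simps)
    finally have "1 - T ^ Suc j = unitz_emb (b + k * k - b * (k * k))" .
    moreover have "b + k * k - b * (k * k) \<in> X" by (simp add: D b k)
    ultimately show ?case by (rule image_eqI)
  qed
  then have "\<forall>j. \<exists>b. b \<in> X \<and> 1 - T ^ j = unitz_emb b" by blast
  then obtain b where b: "\<And>j. b j \<in> X" "\<And>j. 1 - T ^ j = unitz_emb (b j)" by metis
  define e where "e = (1 / real N) *\<^sub>R (\<Sum>j<N. b j)"
  have eX: "e \<in> X" unfolding e_def using b(1) by (intro D(5) cstar_subalgebra_sum[OF X])
  have es: "unitz_emb (\<Sum>j<n. b j) = (\<Sum>j<n. unitz_emb (b j))" for n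
    by (induction n) (simp_all add: unitz_emb_simps)
  have "unitz_emb e = (1 / real N) *\<^sub>R (\<Sum>j<N. 1 - T ^ j)" by (simp add: e_def unitz_emb_simps es b)
  also have "\<dots> = (1 / real N) *\<^sub>R of_nat N - A"
    by (simp add: sum_subtractf A_def scaleR_diff_right)
  also have "(1 / real N) *\<^sub>R (of_nat N :: 'a unitz) = 1"
    unfolding of_real_of_nat_eq[symmetric, where 'a = "'a unitz"] of_real_def using N0 by simp
  finally have e: "1 - unitz_emb e = A" by simp
  have "unitz_emb (x - x * e) = unitz_emb x * (1 - unitz_emb e)" by (simp add: unitz_emb_simps algebra_simps)
  also have "unitz_emb x = norm x *\<^sub>R unitz_emb y" using False by (simp add: y_def unitz_emb_simps)
  finally have "norm (x - x * e) = norm x * norm w"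
    unfolding e w_def norm_unitz_emb[of "x - x * e", symmetric] by simp
  also have "\<dots> \<le> d" using nw False by (simp add: field_simps)
  finally show ?thesis using eX e nA by auto
qed

text \<open>Complements multiply: \<open>1 - c = (1 - e) * (1 - e')\<close> for
  \<open>c = e + e' - e * e'\<close>. A contractive complement keeps the estimates already obtained,
  so \<open>e'\<close> only has to treat the error that \<open>e\<close> leaves on the new
  element.\<close>

lemma approximate_right_unit_finite:
  fixes S :: "'a::cstar_algebra set"
  assumes X: "cstar_subalgebra X" and S: "finite S" "S \<subseteq> X" and d: "0 < d"
  shows "\<exists>e\<in>X. norm (1 - unitz_emb e) \<le> 1 \<and> (\<forall>x\<in>S. norm (x - x * e) \<le> d)"
  using S
proof (induction S rule: finite_induct)
  case empty
  then show ?case by (intro bexI[of _ 0]) (simp_all add: unitz_emb_simps cstar_subalgebraD[OF X])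
next
  case (insert x S)
  note D = cstar_subalgebraD[OF X]
  obtain e where e: "e \<in> X" "norm (1 - unitz_emb e) \<le> 1" "\<And>y. y \<in> S \<Longrightarrow> norm (y - y * e) \<le> d"
    using insert by auto
  have "x - x * e \<in> X" using insert.prems e D by auto
  then obtain e' where e': "e' \<in> X" "norm (1 - unitz_emb e') \<le> 1" "norm ((x - x * e) - (x - x * e) * e') \<le> d"
    using approximate_right_unit[OF X _ d] by blast
  define c where "c = e + e' - e * e'"
  have c: "1 - unitz_emb c = (1 - unitz_emb e) * (1 - unitz_emb e')"
    by (simp add: c_def unitz_emb_simps algebra_simps)
  have yc: "y - y * c = (y - y * e) - (y - y * e) * e'" for y
    by (simp add: c_def algebra_simps)
  have le: "norm (z - z * e') \<le> norm z" for z
  proof -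
    have "norm (z - z * e') = norm (unitz_emb z * (1 - unitz_emb e'))"
      unfolding norm_unitz_emb[of "z - z * e'", symmetric] by (simp add: unitz_emb_simps algebra_simps)
    also have "\<dots> \<le> norm z * 1"
      using norm_mult_ineq[of "unitz_emb z" "1 - unitz_emb e'"] mult_left_mono[OF e'(2), of "norm z"] by simp
    finally show ?thesis by simp
  qed
  have "norm (1 - unitz_emb c) \<le> 1"
    unfolding c using norm_mult_ineq[of "1 - unitz_emb e" "1 - unitz_emb e'"]
      mult_le_one[OF e(2) norm_ge_zero e'(2)] by linarith
  moreover have "norm (y - y * c) \<le> d" if "y \<in> insert x S" for y
    using that e'(3) e(3)[of y] le[of "y - y * e"] unfolding yc by auto
  moreover have "c \<in> X" using D e e' by (simp add: c_def)
  ultimately show ?case by blast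
qed

section \<open>Positive operator matrices\<close>

lemma cbop_apply_simps:
  shows "cbop_apply T (x + y) = cbop_apply T x + cbop_apply T y"
    and "cbop_apply T (c *\<^sub>C x) = c *\<^sub>C cbop_apply T x"
    and "cbop_apply T (r *\<^sub>R x) = r *\<^sub>R cbop_apply T x"
    and "cbop_apply T 0 = 0"
    and "cbop_apply 0 x = 0"
    and "cbop_apply (S - T) x = cbop_apply S x - cbop_apply T x"
proof -
  have "bounded_clinear (cbop_apply T)" by (rule bounded_clinear_cbop_apply)
  then have b: "bounded_linear (cbop_apply T)" and "cbop_apply T (c *\<^sub>C x) = c *\<^sub>C cbop_apply T x"
    by (auto simp: bounded_clinear_def)
  then show "cbop_apply T (c *\<^sub>C x) = c *\<^sub>C cbop_apply T x" by simp
  interpret bounded_linear "cbop_apply T" by (rule b)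
  show "cbop_apply T (x + y) = cbop_apply T x + cbop_apply T y"
    "cbop_apply T (r *\<^sub>R x) = r *\<^sub>R cbop_apply T x" "cbop_apply T 0 = 0"
    by (simp_all add: add scaleR)
  show "cbop_apply 0 x = 0" by transfer simp
  show "cbop_apply (S - T) x = cbop_apply S x - cbop_apply T x" by transfer (simp add: blinfun.diff_left)
qed

lemma cbop_apply_sum_right: "cbop_apply T (\<Sum>i\<in>I. f i) = (\<Sum>i\<in>I. cbop_apply T (f i))"
  by (induction I rule: infinite_finite_induct) (simp_all add: cbop_apply_simps)

lemma cbop_apply_sum_left: "cbop_apply (\<Sum>i\<in>I. T i) x = (\<Sum>i\<in>I. cbop_apply (T i) x)"
  by (induction I rule: infinite_finite_induct) (simp_all add: cbop_apply_simps plus_cbop_apply)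

lemma cinner_sum_right: "cinner x (\<Sum>i\<in>I. f i) = (\<Sum>i\<in>I. cinner x (f i))"
  by (induction I rule: infinite_finite_induct) (simp_all add: cinner_add_right)

lemma cinner_sum_left: "cinner (\<Sum>i\<in>I. f i) x = (\<Sum>i\<in>I. cinner (f i) x)"
  by (induction I rule: infinite_finite_induct) (simp_all add: cinner_add_left)

lift_definition cbop_id :: "'h::complex_hilbert_space cbop" is id_blinfun
  by (simp add: bounded_clinear_def bounded_linear_ident)

lemma cbop_id_apply [simp]: "cbop_apply cbop_id x = x"
  by transfer simp

lemma cbop_id_mult [simp]: "cbop_id * T = T" "T * cbop_id = T"
  by (rule cbop_eqI; simp add: times_cbop_apply)+

lemma star_cbop_id [simp]: "star cbop_id = cbop_id"
  by (rule star_cbop_eqI) simp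

section \<open>Operator matrices acting on tuples of vectors\<close>

definition mapply :: "nat \<Rightarrow> (nat \<Rightarrow> nat \<Rightarrow> 'h::complex_hilbert_space cbop) \<Rightarrow> (nat \<Rightarrow> 'h) \<Rightarrow> nat \<Rightarrow> 'h" where
  "mapply n T x i = (\<Sum>j<n. cbop_apply (T i j) (x j))"

definition tinner :: "nat \<Rightarrow> (nat \<Rightarrow> 'h::complex_hilbert_space) \<Rightarrow> (nat \<Rightarrow> 'h) \<Rightarrow> complex" where
  "tinner n x y = (\<Sum>i<n. cinner (x i) (y i))"

definition tnorm2 :: "nat \<Rightarrow> (nat \<Rightarrow> 'h::complex_hilbert_space) \<Rightarrow> real" where
  "tnorm2 n x = (\<Sum>i<n. (norm (x i))\<^sup>2)"

definition mform :: "nat \<Rightarrow> (nat \<Rightarrow> nat \<Rightarrow> 'h::complex_hilbert_space cbop) \<Rightarrow> (nat \<Rightarrow> 'h) \<Rightarrow> (nat \<Rightarrow> 'h) \<Rightarrow> complex" where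
  "mform n T x y = (\<Sum>i<n. \<Sum>j<n. cinner (x i) (cbop_apply (T i j) (y j)))"

definition tsingle :: "nat \<Rightarrow> 'h::complex_hilbert_space \<Rightarrow> nat \<Rightarrow> 'h" where
  "tsingle i x = (\<lambda>k. if k = i then x else 0)"

definition nonneg_complex :: "complex \<Rightarrow> bool" where
  "nonneg_complex z \<longleftrightarrow> Im z = 0 \<and> 0 \<le> Re z"

lemma nonneg_complexI: "0 \<le> r \<Longrightarrow> nonneg_complex (complex_of_real r)"
  by (simp add: nonneg_complex_def)

lemma nonneg_complex_sum: "(\<And>i. i \<in> I \<Longrightarrow> nonneg_complex (f i)) \<Longrightarrow> nonneg_complex (\<Sum>i\<in>I. f i)"
  by (auto simp: nonneg_complex_def intro: sum_nonneg)

lemma nonneg_complex_cinner_self: "nonneg_complex (cinner x x)"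
  unfolding cinner_self by (rule nonneg_complexI) simp

lemma mform_tinner: "mform n T x y = tinner n x (mapply n T y)"
  by (simp add: mform_def tinner_def mapply_def cinner_sum_right)

lemma mform_bilinear:
  "mform n T (\<lambda>k. x k + x' k) y = mform n T x y + mform n T x' y"
  "mform n T x (\<lambda>k. y k + y' k) = mform n T x y + mform n T x y'"
  "mform n T x (\<lambda>k. c *\<^sub>C y k) = c * mform n T x y"
  "mform n T (\<lambda>k. c *\<^sub>C x k) y = cnj c * mform n T x y"
  by (simp_all add: mform_def cinner_add_left cinner_add_right cbop_apply_simps cinner_scaleC_right
      cinner_scaleC_left sum.distrib sum_distrib_left)

lemma mform_tsingle:
  assumes "i < n" "j < n"
  shows "mform n T (tsingle i x) (tsingle j y) = cinner x (cbop_apply (T i j) y)"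
proof -
  have "(\<Sum>b<n. cinner (tsingle i x a) (cbop_apply (T a b) (tsingle j y b)))
      = (if a = i then cinner x (cbop_apply (T i j) y) else 0)" for a
  proof -
    have "(\<Sum>b<n. cinner (tsingle i x a) (cbop_apply (T a b) (tsingle j y b)))
        = (\<Sum>b<n. if b = j then cinner (tsingle i x a) (cbop_apply (T a j) y) else 0)"
      by (intro sum.cong) (auto simp: tsingle_def cbop_apply_simps)
    then show ?thesis using assms by (auto simp: tsingle_def)
  qed
  then show ?thesis using assms by (simp add: mform_def)
qed

lemma tinner_self: "tinner n x x = complex_of_real (tnorm2 n x)"
  by (simp add: tinner_def tnorm2_def cinner_self)

lemma tnorm2_tsingle: "j < n \<Longrightarrow> tnorm2 n (tsingle j x) = (norm x)\<^sup>2"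
proof -
  assume j: "j < n"
  have "tnorm2 n (tsingle j x) = (\<Sum>i<n. if i = j then (norm x)\<^sup>2 else 0)"
    unfolding tnorm2_def tsingle_def by (intro sum.cong) auto
  then show ?thesis using j by simp
qed

lemma norm_le_tnorm2: "i < n \<Longrightarrow> (norm (x i))\<^sup>2 \<le> tnorm2 n x"
  unfolding tnorm2_def by (rule member_le_sum) auto

definition positive_form :: "nat \<Rightarrow> (nat \<Rightarrow> nat \<Rightarrow> 'h::complex_hilbert_space cbop) \<Rightarrow> bool" where
  "positive_form n T \<longleftrightarrow> (\<forall>x. nonneg_complex (mform n T x x))"

text \<open>Polarization: the values \<open>c = 0, 1, -1\<close> and \<open>\<i>\<close> separate
  the cross terms. Hermitian symmetry thus follows from mere reality of a quadratic form, both for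
  operator matrices and for maps on \<open>X\<close>.\<close>

lemma hermitian_of_real_diagonal:
  fixes b b' :: complex
  assumes "\<And>c. Im (a + c * b + cnj c * b' + c * cnj c * d) = 0"
  shows "b = cnj b'"
proof -
  have "Im a = 0" "Im (a + b + b' + d) = 0" "Im (a + \<i> * b - \<i> * b' + d) = 0" "Im (a - b - b' + d) = 0"
    using assms[of 0] assms[of 1] assms[of "\<i>"] assms[of "- 1"] by simp_all
  then show ?thesis by (simp add: complex_eq_iff)
qed

lemma positive_form_star:
  assumes T: "positive_form n T" and ij: "i < n" "j < n"
  shows "star (T i j) = T j i"
proof (rule star_cbop_eqI)
  fix x y
  have "cinner x (cbop_apply (T i j) y) = cnj (cinner y (cbop_apply (T j i) x))"
  proof (rule hermitian_of_real_diagonal)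
    fix c
    have "mform n T (\<lambda>k. tsingle i x k + c *\<^sub>C tsingle j y k) (\<lambda>k. tsingle i x k + c *\<^sub>C tsingle j y k)
      = cinner x (cbop_apply (T i i) x) + c * cinner x (cbop_apply (T i j) y)
        + cnj c * cinner y (cbop_apply (T j i) x) + c * cnj c * cinner y (cbop_apply (T j j) y)"
      by (simp add: mform_bilinear mform_tsingle ij algebra_simps)
    then show "Im (cinner x (cbop_apply (T i i) x) + c * cinner x (cbop_apply (T i j) y)
        + cnj c * cinner y (cbop_apply (T j i) x) + c * cnj c * cinner y (cbop_apply (T j j) y)) = 0"
      using T unfolding positive_form_def nonneg_complex_def by metis
  qed
  then show "cinner (cbop_apply (T j i) x) y = cinner x (cbop_apply (T i j) y)"
    by (metis cinner_commute)
qed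

lemma mform_bound:
  "cmod (mform n T x x) \<le> (\<Sum>i<n. \<Sum>j<n. norm (T i j)) * tnorm2 n x"
proof -
  have "cmod (cinner (x i) (cbop_apply (T i j) (x j))) \<le> norm (T i j) * tnorm2 n x" if "i < n" "j < n" for i j
  proof -
    have "norm (x i) * norm (x j) \<le> tnorm2 n x"
    proof -
      have "2 * (norm (x i) * norm (x j)) \<le> (norm (x i))\<^sup>2 + (norm (x j))\<^sup>2"
        using sum_squares_bound[of "norm (x i)" "norm (x j)"] by simp
      then show ?thesis using norm_le_tnorm2[OF that(1), of x] norm_le_tnorm2[OF that(2), of x] by linarith
    qed
    then have "norm (T i j) * (norm (x i) * norm (x j)) \<le> norm (T i j) * tnorm2 n x"
      by (rule mult_left_mono) simp
    moreover have "cmod (cinner (x i) (cbop_apply (T i j) (x j))) \<le> norm (x i) * (norm (T i j) * norm (x j))"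
      using Cauchy_Schwarz mult_left_mono[OF norm_cbop_apply[of "T i j" "x j"], of "norm (x i)"]
      by (meson norm_ge_zero order_trans)
    ultimately show ?thesis by (simp add: mult_ac)
  qed
  then have "cmod (mform n T x x) \<le> (\<Sum>i<n. \<Sum>j<n. norm (T i j) * tnorm2 n x)"
    unfolding mform_def by (intro sum_norm_le) auto
  then show ?thesis by (simp add: sum_distrib_right)
qed

lemma star_mat_mult_entry:
  assumes "Y \<in> carrier_mat n n" "i < n" "j < n"
  shows "(star_mat Y * Y) $$ (i, j) = (\<Sum>l<n. star (Y $$ (l, i)) * Y $$ (l, j))"
  using assms by (simp add: star_mat_def scalar_prod_def lessThan_atLeast0)

lemma positive_mats_carrier: "A \<in> positive_mats n \<Longrightarrow> A \<in> carrier_mat n n"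
  by (auto simp: positive_mats_def star_mat_def)

lemma positive_form_of_positive_mats:
  fixes A :: "'h::complex_hilbert_space cbop mat"
  assumes "A \<in> positive_mats n"
  shows "positive_form n (\<lambda>i j. A $$ (i, j))"
  unfolding positive_form_def
proof
  fix x
  obtain Y where Y: "Y \<in> carrier_mat n n" and A: "A = star_mat Y * Y"
    using assms by (auto simp: positive_mats_def)
  have "mform n (\<lambda>i j. A $$ (i, j)) x x
      = (\<Sum>i<n. \<Sum>j<n. \<Sum>l<n. cinner (cbop_apply (Y $$ (l, i)) (x i)) (cbop_apply (Y $$ (l, j)) (x j)))"
    unfolding mform_def A
    by (intro sum.cong refl)
      (simp add: star_mat_mult_entry[OF Y] cbop_apply_sum_left cinner_sum_right times_cbop_apply cinner_star_cbop_right)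
  also have "\<dots> = (\<Sum>i<n. \<Sum>l<n. \<Sum>j<n. cinner (cbop_apply (Y $$ (l, i)) (x i)) (cbop_apply (Y $$ (l, j)) (x j)))"
    by (intro sum.cong refl sum.swap)
  also have "\<dots> = (\<Sum>l<n. \<Sum>i<n. \<Sum>j<n. cinner (cbop_apply (Y $$ (l, i)) (x i)) (cbop_apply (Y $$ (l, j)) (x j)))"
    by (rule sum.swap)
  also have "\<dots> = (\<Sum>l<n. cinner (\<Sum>i<n. cbop_apply (Y $$ (l, i)) (x i)) (\<Sum>j<n. cbop_apply (Y $$ (l, j)) (x j)))"
    by (intro sum.cong refl) (simp add: cinner_sum_left cinner_sum_right, rule sum.swap)
  finally show "nonneg_complex (mform n (\<lambda>i j. A $$ (i, j)) x x)"
    by (simp add: nonneg_complex_sum nonneg_complex_cinner_self)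
qed

text \<open>Powers are kept as families of entries so that the square root series can be summed
  entry by entry in the algebra of operators.\<close>

fun mpow :: "nat \<Rightarrow> (nat \<Rightarrow> nat \<Rightarrow> 'h::complex_hilbert_space cbop) \<Rightarrow> nat \<Rightarrow> nat \<Rightarrow> nat \<Rightarrow> 'h cbop" where
  "mpow n S 0 i j = (if i = j then cbop_id else 0)"
| "mpow n S (Suc k) i j = (\<Sum>l<n. S i l * mpow n S k l j)"

lemma mpow_add:
  assumes "i < n"
  shows "mpow n S (a + b) i j = (\<Sum>l<n. mpow n S a i l * mpow n S b l j)"
  using assms
proof (induction a arbitrary: i)
  case 0
  have "(\<Sum>l<n. mpow n S 0 i l * mpow n S b l j) = (\<Sum>l<n. if l = i then mpow n S b i j else 0)"
    by (intro sum.cong) auto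
  then show ?case using 0 by simp
next
  case (Suc a)
  have "mpow n S (Suc a + b) i j = (\<Sum>m<n. S i m * (\<Sum>l<n. mpow n S a m l * mpow n S b l j))"
    using Suc.IH by simp
  also have "\<dots> = (\<Sum>l<n. (\<Sum>m<n. S i m * mpow n S a m l) * mpow n S b l j)"
    unfolding sum_distrib_left sum_distrib_right by (subst sum.swap) (simp add: mult.assoc)
  finally show ?case by simp
qed

lemma mpow_1: "j < n \<Longrightarrow> mpow n S 1 i j = S i j"
proof -
  assume j: "j < n"
  have "mpow n S 1 i j = (\<Sum>l<n. if l = j then S i j else 0)"
    unfolding One_nat_def mpow.simps by (intro sum.cong) auto
  then show ?thesis using j by simp
qed

lemma star_mpow:
  assumes S: "\<And>i j. i < n \<Longrightarrow> j < n \<Longrightarrow> star (S i j) = S j i" and "i < n" "j < n"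
  shows "star (mpow n S k i j) = mpow n S k j i"
  using assms(2,3)
proof (induction k arbitrary: i j)
  case (Suc k)
  have "mpow n S (k + 1) j i = (\<Sum>l<n. mpow n S k j l * S l i)"
    using Suc.prems by (simp add: mpow_add mpow_1 del: mpow.simps add_Suc_right One_nat_def)
  then show ?case using Suc by (simp add: star_sum star_mult S)
qed simp

lemma mapply_mpow_Suc: "mapply n (mpow n S (Suc k)) x i = mapply n S (mapply n (mpow n S k) x) i"
  unfolding mapply_def cbop_apply_sum_right
  by (subst sum.swap) (simp add: cbop_apply_sum_left times_cbop_apply)

lemma tnorm2_mpow_le:
  assumes "\<And>x. tnorm2 n (mapply n S x) \<le> tnorm2 n x"
  shows "tnorm2 n (mapply n (mpow n S k) x) \<le> tnorm2 n x"
proof (induction k)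
  case 0
  have "mapply n (mpow n S 0) x i = x i" if "i < n" for i
  proof -
    have "mapply n (mpow n S 0) x i = (\<Sum>j<n. if j = i then x i else 0)"
      unfolding mapply_def by (intro sum.cong) (auto simp: cbop_apply_simps)
    then show ?thesis using that by simp
  qed
  then show ?case by (simp add: tnorm2_def del: mpow.simps)
next
  case (Suc k)
  have "mapply n (mpow n S (Suc k)) x = mapply n S (mapply n (mpow n S k) x)"
    by (rule ext) (rule mapply_mpow_Suc)
  then show ?case using Suc assms[of "mapply n (mpow n S k) x"] by (simp del: mpow.simps)
qed

text \<open>Contractivity on tuples, tested on one that is zero outside \<open>j\<close>, bounds the
  entries of all powers uniformly; this is the hypothesis of the square root series.\<close>

lemma norm_mpow_le:
  assumes "\<And>x. tnorm2 n (mapply n S x) \<le> tnorm2 n x" and "i < n" "j < n"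
  shows "norm (mpow n S k i j) \<le> 1"
proof (rule norm_cbop_le)
  fix x
  have "mapply n (mpow n S k) (tsingle j x) i = (\<Sum>l<n. if l = j then cbop_apply (mpow n S k i j) x else 0)"
    unfolding mapply_def tsingle_def by (intro sum.cong) (auto simp: cbop_apply_simps)
  then have "(norm (cbop_apply (mpow n S k i j) x))\<^sup>2 \<le> tnorm2 n (mapply n (mpow n S k) (tsingle j x))"
    using norm_le_tnorm2[OF assms(2), of "mapply n (mpow n S k) (tsingle j x)"] assms(3) by simp
  also have "\<dots> \<le> (norm x)\<^sup>2"
    using tnorm2_mpow_le[OF assms(1), of k "tsingle j x"] by (simp add: tnorm2_tsingle assms(3))
  finally show "norm (cbop_apply (mpow n S k i j) x) \<le> 1 * norm x" by (simp add: power2_le_iff_abs_le)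
qed simp

text \<open>Expand \<open>0 \<le> \<langle>x - S x, S (x - S x)\<rangle>\<close>.\<close>

lemma tnorm2_mapply_le:
  assumes S: "positive_form n S" and le: "\<And>x. Re (mform n S x x) \<le> tnorm2 n x"
  shows "tnorm2 n (mapply n S x) \<le> tnorm2 n x"
proof -
  define y where "y = mapply n S x"
  have herm: "mform n S y x = tnorm2 n y" by (simp only: mform_tinner y_def[symmetric] tinner_self)
  have "mform n S x y = (\<Sum>j<n. \<Sum>i<n. cinner (cbop_apply (S j i) (x i)) (y j))"
    unfolding mform_def
    by (subst sum.swap, intro sum.cong refl) (simp add: positive_form_star[OF S] flip: cinner_star_cbop)
  also have "\<dots> = tinner n y y" by (simp add: tinner_def y_def mapply_def cinner_sum_left)
  finally have herm': "mform n S x y = tnorm2 n y" by (simp add: tinner_self)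
  have "mform n S (\<lambda>k. x k + (- 1) *\<^sub>C y k) (\<lambda>k. x k + (- 1) *\<^sub>C y k)
      = mform n S x x - 2 * tnorm2 n y + mform n S y y"
    unfolding mform_bilinear herm herm' by simp
  moreover have "0 \<le> Re (mform n S (\<lambda>k. x k + (- 1) *\<^sub>C y k) (\<lambda>k. x k + (- 1) *\<^sub>C y k))"
    using S by (auto simp: positive_form_def nonneg_complex_def)
  ultimately have "0 \<le> Re (mform n S x x) - 2 * tnorm2 n y + Re (mform n S y y)" by simp
  then show ?thesis using le[of x] le[of y] unfolding y_def by linarith
qed

text \<open>After scaling, \<open>S = 1 - c T\<close> is positive with quadratic form at most the
  identity, so its powers have bounded entries and the square root series in \<open>S\<close>
  squares to \<open>1 - S = c T\<close>. The factor \<open>sqrt K\<close> undoes the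
  scaling.\<close>

lemma positive_form_sqrt:
  assumes T: "positive_form n T"
  shows "\<exists>R. \<forall>i<n. \<forall>j<n. star (R i j) = R j i \<and> (\<Sum>l<n. R i l * R l j) = T i j"
proof -
  \<comment> \<open>The added 1 keeps \<open>K\<close> invertible when all entries vanish.\<close>
  define K where "K = (\<Sum>i<n. \<Sum>j<n. norm (T i j)) + 1"
  have K: "0 < K" unfolding K_def by (intro add_nonneg_pos sum_nonneg) auto
  define c where "c = inverse K"
  have c: "0 < c" "K * c = 1" using K by (simp_all add: c_def)
  define S where "S i j = (if i = j then cbop_id else 0) - c *\<^sub>R T i j" for i j
  have mS: "mform n S x x = tnorm2 n x - c * mform n T x x" for x
  proof -
    have "(\<Sum>j<n. cinner (x i) (cbop_apply (if i = j then cbop_id else 0) (x j)))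
        = cinner (x i) (x i)" if "i < n" for i
    proof -
      have "(\<Sum>j<n. cinner (x i) (cbop_apply (if i = j then cbop_id else 0) (x j)))
          = (\<Sum>j<n. if j = i then cinner (x i) (x i) else 0)"
        by (intro sum.cong) (auto simp: cbop_apply_simps)
      then show ?thesis using that by simp
    qed
    then have "mform n S x x = (\<Sum>i<n. cinner (x i) (x i)) - c * mform n T x x"
      by (simp add: mform_def S_def cbop_apply_simps scaleR_cbop_apply cinner_diff_right
          cinner_scaleR_right sum_subtractf sum_distrib_left)
    then show ?thesis by (simp only: tinner_def[of n x x, symmetric] tinner_self)
  qed
  have T0: "Im (mform n T x x) = 0" "0 \<le> Re (mform n T x x)" for x
    using T by (auto simp: positive_form_def nonneg_complex_def)
  have "Re (mform n T x x) \<le> K * tnorm2 n x" for x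
  proof -
    have "0 \<le> tnorm2 n x" by (simp add: tnorm2_def sum_nonneg)
    then show ?thesis
      using mform_bound[of n T x] complex_Re_le_cmod[of "mform n T x x"] by (simp add: K_def distrib_right)
  qed
  then have "c * Re (mform n T x x) \<le> tnorm2 n x" for x
    using K by (simp add: c_def field_simps)
  moreover have mS': "Re (mform n S x x) = tnorm2 n x - c * Re (mform n T x x)" "Im (mform n S x x) = 0" for x
    by (simp_all add: mS T0(1))
  moreover have "0 \<le> c * Re (mform n T x x)" for x using T0(2) c by simp
  ultimately have S: "positive_form n S" and "\<And>x. Re (mform n S x x) \<le> tnorm2 n x"
    by (simp_all add: positive_form_def nonneg_complex_def)
  then have contr: "tnorm2 n (mapply n S x) \<le> tnorm2 n x" for x
    by (intro tnorm2_mapply_le)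
  define P where "P = mpow n S"
  have P: "norm (P k i j) \<le> 1" if "i < n" "j < n" for i j k
    unfolding P_def by (rule norm_mpow_le[OF contr that])
  define R where "R i j = suminf (\<lambda>k. sqrt_coeff k *\<^sub>R P k i j)" for i j
  have R_sums: "(\<lambda>k. sqrt_coeff k *\<^sub>R P k i j) sums R i j" if "i < n" "j < n" for i j
    unfolding R_def
    by (intro summable_sums summable_norm_cancel[OF summable_sqrt_series[of _ 1]] P that)
  have star_R: "star (R i j) = R j i" if ij: "i < n" "j < n" for i j
  proof -
    have "(\<lambda>k. star (sqrt_coeff k *\<^sub>R P k i j)) sums star (R i j)"
      by (rule bounded_linear.sums[OF bounded_linear_star R_sums[OF ij]])
    moreover have "star (P k i j) = P k j i" for k
      unfolding P_def by (rule star_mpow[OF positive_form_star[OF S] ij])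
    ultimately have "(\<lambda>k. sqrt_coeff k *\<^sub>R P k j i) sums star (R i j)" by (simp add: star_scaleR)
    then show ?thesis using R_sums[OF ij(2,1)] sums_unique2 by blast
  qed
  have RR: "(\<Sum>l<n. R i l * R l j) = c *\<^sub>R T i j" if ij: "i < n" "j < n" for i j
  proof -
    have "(\<lambda>m. \<Sum>l<n. \<Sum>a\<le>m. (sqrt_coeff a * sqrt_coeff (m - a)) *\<^sub>R (P a i l * P (m - a) l j))
        sums (\<Sum>l<n. R i l * R l j)"
      unfolding R_def using P ij by (intro sums_sum sqrt_series_product) auto
    moreover have "(\<Sum>l<n. \<Sum>a\<le>m. (sqrt_coeff a * sqrt_coeff (m - a)) *\<^sub>R (P a i l * P (m - a) l j))
        = (\<Sum>a\<le>m. sqrt_coeff a * sqrt_coeff (m - a)) *\<^sub>R P m i j" for m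
    proof -
      have "(\<Sum>l<n. \<Sum>a\<le>m. (sqrt_coeff a * sqrt_coeff (m - a)) *\<^sub>R (P a i l * P (m - a) l j))
          = (\<Sum>a\<le>m. (sqrt_coeff a * sqrt_coeff (m - a)) *\<^sub>R (\<Sum>l<n. P a i l * P (m - a) l j))"
        by (subst sum.swap) (simp add: scaleR_sum_right)
      also have "\<dots> = (\<Sum>a\<le>m. (sqrt_coeff a * sqrt_coeff (m - a)) *\<^sub>R P m i j)"
      proof (intro sum.cong refl)
        fix a assume "a \<in> {..m}"
        then show "(sqrt_coeff a * sqrt_coeff (m - a)) *\<^sub>R (\<Sum>l<n. P a i l * P (m - a) l j)
            = (sqrt_coeff a * sqrt_coeff (m - a)) *\<^sub>R P m i j"
          using mpow_add[OF ij(1), of S a "m - a" j] by (simp add: P_def)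
      qed
      finally show ?thesis by (simp add: scaleR_sum_left)
    qed
    ultimately have "(\<lambda>m. (\<Sum>a\<le>m. sqrt_coeff a * sqrt_coeff (m - a)) *\<^sub>R P m i j) sums (\<Sum>l<n. R i l * R l j)"
      by (simp only:)
    \<comment> \<open>The convolution coefficients leave only degrees 0 and 1, hence
      \<open>1 - S\<close>.\<close>
    then have "(\<Sum>l<n. R i l * R l j) = P 0 i j - P 1 i j"
      using sqrt_coeff_sums[of "\<lambda>m. P m i j"] by (rule sums_unique2)
    then show ?thesis unfolding P_def mpow_1[OF ij(2)] by (simp add: S_def)
  qed
  show ?thesis
  proof (intro exI[of _ "\<lambda>i j. sqrt K *\<^sub>R R i j"] allI impI conjI)
    show "star (sqrt K *\<^sub>R R i j) = sqrt K *\<^sub>R R j i" if "i < n" "j < n" for i j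
      using that by (simp add: star_scaleR star_R)
    show "(\<Sum>l<n. (sqrt K *\<^sub>R R i l) * (sqrt K *\<^sub>R R l j)) = T i j" if "i < n" "j < n" for i j
    proof -
      have "(\<Sum>l<n. (sqrt K *\<^sub>R R i l) * (sqrt K *\<^sub>R R l j)) = K *\<^sub>R (\<Sum>l<n. R i l * R l j)"
        using K by (simp add: scaleR_sum_right)
      then show ?thesis using c by (simp add: RR[OF that])
    qed
  qed
qed

text \<open>Turns positivity in the matrix algebra over B(H) into a test on vectors. The square root
  \<open>R\<close> is self-adjoint and therefore serves as the factor \<open>Y\<close>.\<close>

lemma positive_mats_iff_positive_form:
  fixes A :: "'h::complex_hilbert_space cbop mat"
  assumes A: "A \<in> carrier_mat n n"
  shows "A \<in> positive_mats n \<longleftrightarrow> positive_form n (\<lambda>i j. A $$ (i, j))"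
proof
  assume "positive_form n (\<lambda>i j. A $$ (i, j))"
  from positive_form_sqrt[OF this] obtain R
    where R: "\<forall>i<n. \<forall>j<n. star (R i j) = R j i \<and> (\<Sum>l<n. R i l * R l j) = A $$ (i, j)"
    by (rule exE)
  define Y where "Y = mat n n (\<lambda>(i, j). R i j)"
  have Y: "Y \<in> carrier_mat n n" by (simp add: Y_def)
  have "A = star_mat Y * Y"
  proof (rule eq_matI)
    fix i j assume "i < dim_row (star_mat Y * Y)" "j < dim_col (star_mat Y * Y)"
    then have ij: "i < n" "j < n" using Y by (auto simp: star_mat_def)
    show "A $$ (i, j) = (star_mat Y * Y) $$ (i, j)"
    proof -
      have "A $$ (i, j) = (\<Sum>l<n. R i l * R l j)" using R ij by simp
      also have "\<dots> = (\<Sum>l<n. star (Y $$ (l, i)) * Y $$ (l, j))"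
        using R ij by (intro sum.cong) (simp_all add: Y_def)
      finally show ?thesis by (simp only: star_mat_mult_entry[OF Y ij])
    qed
  qed (use A Y in \<open>auto simp: star_mat_def\<close>)
  then show "A \<in> positive_mats n" using Y by (auto simp: positive_mats_def)
qed (rule positive_form_of_positive_mats)

section \<open>Finitely supported operator matrices\<close>

abbreviation "lookup \<equiv> Poly_Mapping.lookup"
abbreviation "keys \<equiv> Poly_Mapping.keys"

instantiation poly_mapping :: (type, real_vector) real_vector
begin

lift_definition scaleR_poly_mapping :: "real \<Rightarrow> ('a \<Rightarrow>\<^sub>0 'b) \<Rightarrow> 'a \<Rightarrow>\<^sub>0 'b" is "\<lambda>r f k. r *\<^sub>R f k"
  by (rule finite_subset[rotated]) auto

instance
proof
  fix r s :: real and f g :: "'a \<Rightarrow>\<^sub>0 'b"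
  show "r *\<^sub>R (f + g) = r *\<^sub>R f + r *\<^sub>R g" "(r + s) *\<^sub>R f = r *\<^sub>R f + s *\<^sub>R f"
    "r *\<^sub>R s *\<^sub>R f = (r * s) *\<^sub>R f" "1 *\<^sub>R f = f"
    by (rule poly_mapping_eqI; simp add: scaleR_poly_mapping.rep_eq lookup_add scaleR_add_right scaleR_add_left)+
qed

end

lemma lookup_scaleR [simp]: "lookup (r *\<^sub>R f) k = r *\<^sub>R lookup f k"
  by (simp add: scaleR_poly_mapping.rep_eq)

lemma single_scaleR: "Poly_Mapping.single k (r *\<^sub>R b) = r *\<^sub>R Poly_Mapping.single k b"
  by (rule poly_mapping_eqI) (simp add: lookup_single when_def)

lemma poly_mapping_sum_single: "(\<Sum>k\<in>keys v. Poly_Mapping.single k (lookup v k)) = v"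
proof (rule poly_mapping_eqI)
  fix k
  have "(\<Sum>j\<in>keys v. lookup (Poly_Mapping.single j (lookup v j)) k) = (\<Sum>j\<in>keys v. if j = k then lookup v k else 0)"
    by (intro sum.cong) (auto simp: lookup_single when_def)
  then show "lookup (\<Sum>k\<in>keys v. Poly_Mapping.single k (lookup v k)) k = lookup v k"
    by (simp add: lookup_sum in_keys_iff)
qed

text \<open>The skew-adjoint part is ignored, so that a functional which is nonnegative on these matrices is
  automatically hermitian.\<close>

definition hermitian_positive :: "('i \<times> 'i \<Rightarrow>\<^sub>0 'u::cstar_algebra) \<Rightarrow> bool" where
  "hermitian_positive v \<longleftrightarrow> (\<exists>m (w :: nat \<Rightarrow> 'i \<Rightarrow> 'u). \<forall>a b.
     lookup v (a, b) + star (lookup v (b, a)) = (\<Sum>k<m. star (w k a) * w k b))"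

lemma sum_lessThan_append:
  fixes m n :: nat
  shows "(\<Sum>k<m + n. f k) = (\<Sum>k<m. f k) + (\<Sum>k<n. (f (m + k) :: 'a::comm_monoid_add))"
  by (induction n) (simp_all add: add.assoc)

lemma hermitian_positive_add:
  assumes "hermitian_positive v" "hermitian_positive v'"
  shows "hermitian_positive (v + v')"
proof -
  obtain m w where w: "\<And>a b. lookup v (a, b) + star (lookup v (b, a)) = (\<Sum>k<(m::nat). star (w k a) * w k b)"
    using assms(1) unfolding hermitian_positive_def by blast
  obtain m' w' where w': "\<And>a b. lookup v' (a, b) + star (lookup v' (b, a)) = (\<Sum>k<(m'::nat). star (w' k a) * w' k b)"
    using assms(2) unfolding hermitian_positive_def by blast
  define u where "u k = (if k < m then w k else w' (k - m))" for k
  have "lookup (v + v') (a, b) + star (lookup (v + v') (b, a)) = (\<Sum>k<m + m'. star (u k a) * u k b)" for a b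
  proof -
    have "lookup (v + v') (a, b) + star (lookup (v + v') (b, a))
      = (lookup v (a, b) + star (lookup v (b, a))) + (lookup v' (a, b) + star (lookup v' (b, a)))"
      by (simp add: lookup_add star_add)
    also have "\<dots> = (\<Sum>k<m. star (u k a) * u k b) + (\<Sum>k<m'. star (u (m + k) a) * u (m + k) b)"
      unfolding w w' by (simp add: u_def)
    finally show ?thesis by (simp only: sum_lessThan_append)
  qed
  then show ?thesis unfolding hermitian_positive_def by blast
qed

lemma hermitian_positive_scaleR:
  assumes "hermitian_positive v" "0 \<le> r"
  shows "hermitian_positive (r *\<^sub>R v)"
proof -
  obtain m w where w: "\<And>a b. lookup v (a, b) + star (lookup v (b, a)) = (\<Sum>k<(m::nat). star (w k a) * w k b)"
    using assms(1) unfolding hermitian_positive_def by blast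
  have "lookup (r *\<^sub>R v) (a, b) + star (lookup (r *\<^sub>R v) (b, a))
      = (\<Sum>k<m. star (sqrt r *\<^sub>R w k a) * (sqrt r *\<^sub>R w k b))" for a b
  proof -
    have "lookup (r *\<^sub>R v) (a, b) + star (lookup (r *\<^sub>R v) (b, a)) = r *\<^sub>R (lookup v (a, b) + star (lookup v (b, a)))"
      by (simp add: star_scaleR scaleR_add_right)
    also have "\<dots> = (\<Sum>k<m. star (sqrt r *\<^sub>R w k a) * (sqrt r *\<^sub>R w k b))"
      unfolding w using assms(2) by (simp add: scaleR_sum_right star_scaleR)
    finally show ?thesis .
  qed
  then show ?thesis
    unfolding hermitian_positive_def by (intro exI[of _ m] exI[of _ "\<lambda>k a. sqrt r *\<^sub>R w k a"]) blast
qed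

lemma hermitian_positive_antihermitian:
  assumes "\<And>a b. lookup v (a, b) + star (lookup v (b, a)) = 0"
  shows "hermitian_positive v"
  unfolding hermitian_positive_def by (rule exI[of _ 0]) (simp add: assms)

text \<open>The labels \<open>x i\<close> may repeat, so \<open>w a\<close> collects all
  \<open>u i\<close> placed at the label \<open>a\<close>.\<close>

lemma hermitian_positive_gram:
  fixes u :: "'j \<Rightarrow> 'u::cstar_algebra" and x :: "'j \<Rightarrow> 'i"
  assumes "finite I"
  shows "hermitian_positive (\<Sum>i\<in>I. \<Sum>j\<in>I. Poly_Mapping.single (x i, x j) (star (u i) * u j))"
proof -
  define w where "w a = (\<Sum>i\<in>I. if x i = a then u i else 0)" for a
  have l: "lookup (\<Sum>i\<in>I. \<Sum>j\<in>I. Poly_Mapping.single (x i, x j) (star (u i) * u j)) (a, b) = star (w a) * w b" for a b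
    unfolding w_def lookup_sum star_sum sum_product
    by (intro sum.cong refl) (auto simp: lookup_single when_def)
  \<comment> \<open>The matrix is hermitian, so adding its adjoint doubles it: two copies of
    \<open>w\<close>.\<close>
  show ?thesis
    unfolding hermitian_positive_def l
    by (intro exI[of _ 2] exI[of _ "\<lambda>_. w"]) (simp add: star_mult star_star numeral_2_eq_2)
qed

text \<open>The order relation between \<open>u * star u\<close> and the squared norm of
  \<open>u\<close>, in Gram form. Both the domination of single entries and the bound on the
  extended form rest on it.\<close>

lemma norm_square_minus_square:
  fixes u :: "'u::{cstar_algebra,real_normed_algebra_1}"
  obtains z where "star z * z = (norm u)\<^sup>2 *\<^sub>R 1 - u * star u"
proof (cases "u = 0")
  case True
  then show ?thesis using that[of 0] by simp
next
  case False
  define T where "T = inverse ((norm u)\<^sup>2) *\<^sub>R (u * star u)"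
  have T: "norm T \<le> 1" "star T = T"
    using False by (simp_all add: T_def norm_mult_star star_scaleR star_mult star_star)
  have "star (norm u *\<^sub>R sqrt_one_minus T) * (norm u *\<^sub>R sqrt_one_minus T) = (norm u)\<^sup>2 *\<^sub>R (1 - T)"
    by (simp add: star_scaleR star_sqrt_one_minus T sqrt_one_minus_square power2_eq_square)
  also have "\<dots> = (norm u)\<^sup>2 *\<^sub>R 1 - u * star u"
    using False by (simp add: T_def scaleR_diff_right)
  finally show ?thesis by (rule that)
qed

text \<open>From \<open>(1, - u\<^sup>*)\<^sup>* (1, - u\<^sup>*) \<ge> 0\<close> the off-diagonal entry \<open>u\<close> is dominated by the diagonal matrix
  with entries \<open>\<parallel>u\<parallel>\<^sup>2 / 2\<close> and \<open>1 / 2\<close>.\<close>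

lemma hermitian_positive_dominate_single:
  fixes u :: "'u::{cstar_algebra,real_normed_algebra_1}"
  shows "hermitian_positive (Poly_Mapping.single (x, x) (((norm u)\<^sup>2 / 2) *\<^sub>R 1)
    + Poly_Mapping.single (y, y) ((1 / 2) *\<^sub>R 1) - Poly_Mapping.single (x, y) u)"
    (is "hermitian_positive ?v")
proof -
  obtain z where z: "star z * z = (norm u)\<^sup>2 *\<^sub>R 1 - u * star u" by (rule norm_square_minus_square)
  \<comment> \<open>Row 0 produces \<open>- u\<close>, \<open>- star u\<close> and also
    \<open>u * star u\<close> at \<open>(x, x)\<close>; row 1 fills the latter up to the square of
    the norm. If \<open>x = y\<close>, the two terms of row 0 add up.\<close>
  define w where "w k a = (if k = (0::nat) then (if a = y then 1 else 0) - (if a = x then star u else 0)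
    else if a = x then z else 0)" for k a
  define P where "P = ((norm u)\<^sup>2 / 2) *\<^sub>R (1::'u)"
  define Q where "Q = (1 / 2) *\<^sub>R (1::'u)"
  have PQ: "P + P = (norm u)\<^sup>2 *\<^sub>R 1" "Q + Q = 1" "star P = P" "star Q = Q"
    by (simp_all add: P_def Q_def star_scaleR flip: scaleR_add_left)
  have v: "lookup ?v (a, b) = (if a = x \<and> b = x then P else 0) + (if a = y \<and> b = y then Q else 0)
      - (if a = x \<and> b = y then u else 0)" for a b
    unfolding P_def[symmetric] Q_def[symmetric] by (auto simp: lookup_add lookup_minus lookup_single when_def)
  have "lookup ?v (a, b) + star (lookup ?v (b, a)) = (\<Sum>k<2. star (w k a) * w k b)" for a b
  proof -
    have "lookup ?v (a, b) + star (lookup ?v (b, a))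
        = (if a = x \<and> b = x then P + P else 0) + (if a = y \<and> b = y then Q + Q else 0)
        - (if a = x \<and> b = y then u else 0) - (if a = y \<and> b = x then star u else 0)"
      unfolding v
      by (cases "a = x"; cases "b = x"; cases "a = y"; cases "b = y")
        (simp_all add: star_add star_diff star_minus PQ(3,4) algebra_simps)
    also have "\<dots> = ((if a = y then 1 else 0) - (if a = x then u else 0)) * ((if b = y then 1 else 0) - (if b = x then star u else 0))
        + (if a = x \<and> b = x then star z * z else 0)"
      unfolding z PQ(1,2)
      by (cases "a = x"; cases "b = x"; cases "a = y"; cases "b = y") (simp_all add: algebra_simps)
    also have "\<dots> = (\<Sum>k<2. star (w k a) * w k b)"
      by (cases "a = x"; cases "b = x"; cases "a = y"; cases "b = y")
        (simp_all add: numeral_2_eq_2 w_def star_diff star_star star_minus)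
    finally show ?thesis .
  qed
  then show ?thesis unfolding hermitian_positive_def by blast
qed

text \<open>Complex polarization: the coefficients 1 and \<open>\<i>\<close> together kill both
  cross terms.\<close>

lemma cbop_eq_zeroI:
  assumes "\<And>x. cinner x (cbop_apply D x) = 0"
  shows "D = 0"
proof (rule cbop_eqI)
  fix y
  have "cinner x (cbop_apply D y) = 0" for x
  proof -
    have 1: "c * cinner x (cbop_apply D y) + cnj c * cinner y (cbop_apply D x) = 0" for c
      using assms[of "x + c *\<^sub>C y"] assms[of x] assms[of y]
      by (simp add: cinner_add_left cinner_add_right cbop_apply_simps cinner_scaleC_left cinner_scaleC_right add.commute)
    show ?thesis using 1[of 1] 1[of "\<i>"] by (simp add: complex_eq_iff)
  qed
  from this[of "cbop_apply D y"] show "cbop_apply D y = cbop_apply 0 y"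
    by (simp add: cinner_self cbop_apply_simps)
qed

text \<open>Riesz representation in the first variable, applied to the conjugate because the form is
  antilinear there.\<close>

lemma cbop_of_form:
  fixes B :: "'h::complex_hilbert_space \<Rightarrow> 'h \<Rightarrow> complex"
  assumes add_l: "\<And>x x' y. B (x + x') y = B x y + B x' y"
    and add_r: "\<And>x y y'. B x (y + y') = B x y + B x y'"
    and scale_l: "\<And>c x y. B (c *\<^sub>C x) y = cnj c * B x y"
    and scale_r: "\<And>c x y. B x (c *\<^sub>C y) = c * B x y"
    and bound: "\<And>x y. cmod (B x y) \<le> K * norm x * norm y" and K: "0 \<le> K"
  shows "\<exists>T. (\<forall>x y. cinner x (cbop_apply T y) = B x y) \<and> norm T \<le> K"
proof -
  have "\<exists>z. \<forall>x. cinner x z = B x y" for y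
  proof -
    have "bounded_linear (\<lambda>x. cnj (B x y))"
    proof (rule bounded_linear_intro)
      show "cnj (B (r *\<^sub>R x) y) = r *\<^sub>R cnj (B x y)" for r x
        using scale_l[of "complex_of_real r" x y] by (simp add: scaleC_of_real scaleR_conv_of_real)
      show "norm (cnj (B x y)) \<le> norm x * (K * norm y)" for x
        using bound[of x y] by (simp add: mult_ac)
    qed (simp add: add_l)
    then obtain z where "\<And>x. cnj (B x y) = cinner z x"
      by (rule riesz_representation) (simp_all add: scale_l)
    then show ?thesis by (metis cinner_commute complex_cnj_cnj)
  qed
  then obtain S where S: "\<And>x y. cinner x (S y) = B x y" by metis
  have eqI: "u = v" if "\<And>x. cinner x u = cinner x v" for u v :: 'h
    using cinner_eqI[of u v] that by (metis cinner_commute)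
  have add: "S (x + y) = S x + S y" for x y
    by (rule eqI) (simp add: S cinner_add_right add_r)
  have sc: "S (c *\<^sub>C x) = c *\<^sub>C S x" for c x
    by (rule eqI) (simp add: S cinner_scaleC_right scale_r)
  have bd: "norm (S y) \<le> K * norm y" for y
  proof (rule norm_le_of_cinner)
    show "cmod (cinner (S y) (S y)) \<le> K * norm y * norm (S y)"
      unfolding S using bound[of "S y" y] by (simp add: mult_ac)
  qed (use K in simp)
  have "bounded_linear S"
  proof (rule bounded_linear_intro)
    show "S (r *\<^sub>R x) = r *\<^sub>R S x" for r x
      using sc[of "complex_of_real r" x] by (simp add: scaleC_of_real)
    show "norm (S y) \<le> norm y * K" for y using bd[of y] by (simp add: mult.commute)
  qed (rule add)
  then have "cbop_apply (Abs_cbop (Blinfun S)) = S"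
    unfolding cbop_apply.rep_eq
    by (subst Abs_cbop_inverse) (simp_all add: bounded_linear_Blinfun_apply bounded_clinear_def sc)
  then show ?thesis
    using S bd by (intro exI[of _ "Abs_cbop (Blinfun S)"]) (auto intro!: norm_cbop_le K)
qed

section \<open>Extension of completely positive maps\<close>

lemma nonpos_of_le_epsilon:
  fixes r K :: real
  assumes "\<And>d. 0 < d \<Longrightarrow> r \<le> K * d"
  shows "r \<le> 0"
proof (rule ccontr)
  assume "\<not> r \<le> 0"
  then have r: "0 < r" by simp
  define d where "d = r / (2 * (\<bar>K\<bar> + 1))"
  have d: "0 < d" using r by (simp add: d_def)
  have "r \<le> K * d" by (rule assms[OF d])
  also have "\<dots> \<le> (\<bar>K\<bar> + 1) * d" using d by (intro mult_right_mono) auto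
  also have "\<dots> = r / 2" by (simp add: d_def field_simps)
  finally show False using r by simp
qed

lemma unitz_emb_sum: "unitz_emb (\<Sum>i\<in>I. f i) = (\<Sum>i\<in>I. unitz_emb (f i))"
  by (induction I rule: infinite_finite_induct) (simp_all add: unitz_emb_simps)

lemma uscal_sum: "uscal (\<Sum>i\<in>I. f i) = (\<Sum>i\<in>I. uscal (f i :: 'a::cstar_algebra unitz))"
  by (induction I rule: infinite_finite_induct) simp_all

lemma cmod_cinner_cbop_le: "cmod (cinner x (cbop_apply T y)) \<le> norm T * norm x * norm y"
proof -
  have "cmod (cinner x (cbop_apply T y)) \<le> norm x * norm (cbop_apply T y)" by (rule Cauchy_Schwarz)
  also have "\<dots> \<le> norm x * (norm T * norm y)" by (intro mult_left_mono norm_cbop_apply) simp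
  finally show ?thesis by (simp add: mult_ac)
qed

text \<open>Positivity is only required for Gram matrices \<open>z\<^sup>* z\<close> whose entries lie in \<open>X\<close>, but here \<open>z\<close>
  ranges over the ambient algebra.\<close>

lemma quadratic_nonneg_bound:
  fixes a b n :: real
  assumes q: "\<And>t. 0 \<le> t\<^sup>2 * (b * a) + 2 * t * b + n" and "0 \<le> b" "0 \<le> a" "0 \<le> n"
  shows "b \<le> a * n"
proof (cases "a = 0 \<or> b = 0")
  case True
  then consider "b = 0" | "0 < b" "a = 0" using assms(2) by fastforce
  then show ?thesis
  proof cases
    case 2
    then show ?thesis using q[of "- (n + 1) / b"] assms(4) by simp
  qed (use assms in simp)
next
  case False
  then have a: "0 < a" using assms(3) by simp
  \<comment> \<open>\<open>t = - 1 / a\<close> minimizes the quadratic.\<close>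
  have "0 \<le> b / a - 2 * b / a + n"
    using q[of "- 1 / a"] a by (simp add: power2_eq_square)
  then show ?thesis using a by (simp add: field_simps)
qed

text \<open>The factors \<open>z\<close> will be compressed witnesses of
  \<open>hermitian_positive\<close>, which live in the ambient algebra and whose number
  \<open>m\<close> is unrelated to the size of \<open>F\<close>.\<close>

locale cp_on_subalgebra =
  fixes X :: "'b::cstar_algebra set" and g :: "'b \<Rightarrow> 'h::complex_hilbert_space cbop" and C :: real
  assumes X: "cstar_subalgebra X" and C: "0 \<le> C"
    and g_add: "x \<in> X \<Longrightarrow> y \<in> X \<Longrightarrow> g (x + y) = g x + g y"
    and g_scaleC: "x \<in> X \<Longrightarrow> g (c *\<^sub>C x) = c *\<^sub>C g x"
    and g_bound: "x \<in> X \<Longrightarrow> norm (g x) \<le> C * norm x"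
    and g_pos: "finite F \<Longrightarrow> (\<And>x y. x \<in> F \<Longrightarrow> y \<in> F \<Longrightarrow> (\<Sum>k<m. star (z k x) * z k y) \<in> X) \<Longrightarrow>
      nonneg_complex (\<Sum>x\<in>F. \<Sum>y\<in>F. cinner x (cbop_apply (g (\<Sum>k<(m::nat). star (z k x) * z k y)) y))"
begin

lemmas XD = cstar_subalgebraD[OF X]

lemma g_zero: "g 0 = 0"
  using g_scaleC[OF XD(1), of 0] by simp

lemma g_diff: "x \<in> X \<Longrightarrow> y \<in> X \<Longrightarrow> g (x - y) = g x - g y"
  using g_add[of "x - y" y] XD(3)[of x y] by simp

text \<open>Positivity makes the quadratic form of \<open>g (star y * y)\<close> real, and
  polarization turns this into a symmetry between \<open>g (star y * z)\<close> and
  \<open>g (star z * y)\<close>. Approximate units bring such products arbitrarily near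
  \<open>x\<close>, and boundedness transfers the symmetry.\<close>

lemma g_star: assumes x: "x \<in> X" shows "g (star x) = star (g x)"
proof -
  have polar: "cinner t (cbop_apply (g (star y * z)) t) = cnj (cinner t (cbop_apply (g (star z * y)) t))"
    if y: "y \<in> X" and z: "z \<in> X" for y z t
  proof (rule hermitian_of_real_diagonal)
    fix c
    have m: "star y * y \<in> X" "star y * z \<in> X" "star z * y \<in> X" "star z * z \<in> X" "y + c *\<^sub>C z \<in> X"
      using XD y z by simp_all
    have e: "star (y + c *\<^sub>C z) * (y + c *\<^sub>C z)
        = star y * y + c *\<^sub>C (star y * z) + cnj c *\<^sub>C (star z * y) + (c * cnj c) *\<^sub>C (star z * z)"
      by (simp add: star_add star_scaleC distrib_left distrib_right scaleC_mult_left scaleC_mult_right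
          scaleC_scaleC scaleC_add_right mult.commute[of c])
    have "Im (cinner t (cbop_apply (g (star (y + c *\<^sub>C z) * (y + c *\<^sub>C z))) t)) = 0"
      using g_pos[where F = "{t}" and m = 1 and z = "\<lambda>_ _. y + c *\<^sub>C z"] XD m(5) by (simp add: nonneg_complex_def)
    then show "Im (cinner t (cbop_apply (g (star y * y)) t) + c * cinner t (cbop_apply (g (star y * z)) t)
        + cnj c * cinner t (cbop_apply (g (star z * y)) t) + c * cnj c * cinner t (cbop_apply (g (star z * z)) t)) = 0"
      unfolding e using m XD
      by (simp add: g_add g_scaleC plus_cbop_apply scaleC_cbop_apply cinner_add_right cinner_scaleC_right)
  qed
  have "g (star x) - star (g x) = 0"
  proof (rule cbop_eq_zeroI)
    fix t
    define q where "q y = cinner t (cbop_apply (g (star y)) t) - cnj (cinner t (cbop_apply (g y) t))" for y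
    have "cmod (q x) \<le> (2 * C * norm t * norm t) * d" if d: "0 < d" for d
    proof -
      obtain e where e: "e \<in> X" "norm (x - x * e) \<le> d"
        using approximate_right_unit[OF X x d] by blast
      have m: "x * e \<in> X" "x - x * e \<in> X" "star (x * e) \<in> X" "star x \<in> X" using XD x e by simp_all
      have "q (x * e) = 0"
        using polar[OF e(1) m(4)] by (simp add: q_def star_mult star_star)
      then have "q x = q (x - x * e)"
        using m x XD by (simp add: q_def star_diff g_diff cbop_apply_simps cinner_diff_right)
      also have "cmod (q (x - x * e)) \<le> cmod (cinner t (cbop_apply (g (star (x - x * e))) t)) + cmod (cinner t (cbop_apply (g (x - x * e)) t))"
        unfolding q_def using norm_triangle_ineq4 by (metis complex_mod_cnj)
      also have "\<dots> \<le> (C * d) * norm t * norm t + (C * d) * norm t * norm t"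
      proof -
        have b: "cmod (cinner t (cbop_apply (g y) t)) \<le> (C * d) * norm t * norm t" if "y \<in> X" "norm y \<le> d" for y
        proof -
          have "norm (g y) \<le> C * d" using g_bound[OF that(1)] mult_left_mono[OF that(2) C] by linarith
          then show ?thesis
            using cmod_cinner_cbop_le[of t "g y" t] mult_right_mono[of "norm (g y)" "C * d" "norm t * norm t"]
            by (simp add: mult.assoc)
        qed
        show ?thesis using m XD e by (intro add_mono b) simp_all
      qed
      finally show ?thesis by (simp add: algebra_simps)
    qed
    then have "cmod (q x) \<le> 0" by (rule nonpos_of_le_epsilon)
    moreover have "cinner t (cbop_apply (star (g x)) t) = cnj (cinner t (cbop_apply (g x) t))"
      unfolding cinner_star_cbop_right by (rule cinner_commute)
    ultimately show "cinner t (cbop_apply (g (star x) - star (g x)) t) = 0"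
      by (simp add: q_def cbop_apply_simps cinner_diff_right)
  qed
  then show ?thesis by simp
qed

text \<open>The unit of the unitization is sent to \<open>4 C\<close>: it has to dominate \<open>g (a\<^sup>* a)\<close> for approximate units
  \<open>a\<close> of norm at most \<open>2\<close>.\<close>

definition uform :: "'b unitz \<Rightarrow> 'h \<Rightarrow> 'h \<Rightarrow> complex" where
  "uform u x y = cinner x (cbop_apply (g (uvec u)) y) + complex_of_real (4 * C) * uscal u * cinner x y"

definition sub_mats :: "('h \<times> 'h \<Rightarrow>\<^sub>0 'b unitz) set" where
  "sub_mats = {v. \<forall>k. uvec (lookup v k) \<in> X}"

definition mat_form :: "('h \<times> 'h \<Rightarrow>\<^sub>0 'b unitz) \<Rightarrow> real" where
  "mat_form v = Re (\<Sum>k\<in>keys v. uform (lookup v k) (fst k) (snd k))"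

lemma uform_zero: "uform 0 x y = 0"
  by (simp add: uform_def g_zero cbop_apply_simps)

lemma uform_add: "uvec u \<in> X \<Longrightarrow> uvec v \<in> X \<Longrightarrow> uform (u + v) x y = uform u x y + uform v x y"
  by (simp add: uform_def g_add plus_cbop_apply cinner_add_right algebra_simps)

lemma uform_scaleC: "uvec u \<in> X \<Longrightarrow> uform (c *\<^sub>C u) x y = c * uform u x y"
  by (simp add: uform_def g_scaleC scaleC_cbop_apply cinner_scaleC_right algebra_simps)

lemma uform_scaleR: "uvec u \<in> X \<Longrightarrow> uform (r *\<^sub>R u) x y = r * uform u x y"
  using uform_scaleC[of u "complex_of_real r"] by (simp add: scaleC_of_real)

lemma uform_star: "uvec u \<in> X \<Longrightarrow> uform (star u) y x = cnj (uform u x y)"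
  by (simp add: uform_def g_star cinner_star_cbop_right)
    (metis cinner_commute)

lemma mat_form_superset:
  assumes "finite A" "keys v \<subseteq> A"
  shows "mat_form v = Re (\<Sum>k\<in>A. uform (lookup v k) (fst k) (snd k))"
  unfolding mat_form_def
  by (rule arg_cong[of _ _ Re], rule sum.mono_neutral_left[OF assms])
    (auto simp: in_keys_iff uform_zero)

lemma sub_mats_closed:
  "0 \<in> sub_mats" "v \<in> sub_mats \<Longrightarrow> v' \<in> sub_mats \<Longrightarrow> v + v' \<in> sub_mats"
  "v \<in> sub_mats \<Longrightarrow> r *\<^sub>R v \<in> sub_mats"
  "uvec u \<in> X \<Longrightarrow> Poly_Mapping.single k u \<in> sub_mats"
  by (auto simp: sub_mats_def XD lookup_add lookup_single when_def)

lemma mat_form_add: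
  assumes "v \<in> sub_mats" "v' \<in> sub_mats"
  shows "mat_form (v + v') = mat_form v + mat_form v'"
proof -
  let ?A = "keys v \<union> keys v'"
  have "mat_form (v + v') = Re (\<Sum>k\<in>?A. uform (lookup v k) (fst k) (snd k) + uform (lookup v' k) (fst k) (snd k))"
  proof -
    have "uvec (lookup v k) \<in> X" "uvec (lookup v' k) \<in> X" for k
      using assms unfolding sub_mats_def by blast+
    then show ?thesis
      using mat_form_superset[of ?A "v + v'"] keys_add[of v v'] by (simp add: lookup_add uform_add)
  qed
  then show ?thesis
    by (simp add: sum.distrib mat_form_superset[of ?A v] mat_form_superset[of ?A v'])
qed

lemma mat_form_scaleR:
  assumes "v \<in> sub_mats"
  shows "mat_form (r *\<^sub>R v) = r * mat_form v"
proof -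
  have "mat_form (r *\<^sub>R v) = Re (\<Sum>k\<in>keys v. r * uform (lookup v k) (fst k) (snd k))"
  proof -
    have "uvec (lookup v k) \<in> X" for k
      using assms unfolding sub_mats_def by blast+
    moreover have "keys (r *\<^sub>R v) \<subseteq> keys v" by (auto simp: in_keys_iff)
    ultimately show ?thesis
      using mat_form_superset[of "keys v" "r *\<^sub>R v"] by (simp add: uform_scaleR)
  qed
  then show ?thesis by (simp add: mat_form_def flip: sum_distrib_left)
qed

lemma mat_form_single: "mat_form (Poly_Mapping.single (x, y) u) = Re (uform u x y)"
  by (subst mat_form_superset[of "{(x, y)}"]) auto

text \<open>Compress by an approximate unit \<open>a\<close> of \<open>X\<close> for the entries of the matrix: then all scalars
  disappear and \<open>g_pos\<close> applies.\<close>

lemma mat_form_nonneg: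
  assumes e: "e \<in> sub_mats" and pos: "hermitian_positive e"
  shows "0 \<le> mat_form e"
proof -
  obtain m w where w: "\<And>x y. lookup e (x, y) + star (lookup e (y, x)) = (\<Sum>k<(m::nat). star (w k x) * w k y)"
    using pos unfolding hermitian_positive_def by blast
  define F where "F = fst ` keys e \<union> snd ` keys e"
  have F: "finite F" by (simp add: F_def)
  \<comment> \<open>Adding the adjoint doubles the form and makes the matrix a Gram matrix.\<close>
  define h where "h x y = lookup e (x, y) + star (lookup e (y, x))" for x y
  have hX: "uvec (h x y) \<in> X" for x y using e XD by (simp add: h_def sub_mats_def)
  have hstar: "star (h x y) = h y x" for x y by (simp add: h_def star_add star_star add.commute)
  have "keys e \<subseteq> F \<times> F" by (force simp: F_def)
  then have S1: "mat_form e = Re (\<Sum>x\<in>F. \<Sum>y\<in>F. uform (lookup e (x, y)) x y)"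
    using F by (subst mat_form_superset[of "F \<times> F"]) (auto simp: sum.cartesian_product split_def)
  have "(\<Sum>x\<in>F. \<Sum>y\<in>F. uform (h x y) x y)
      = (\<Sum>x\<in>F. \<Sum>y\<in>F. uform (lookup e (x, y)) x y) + (\<Sum>x\<in>F. \<Sum>y\<in>F. cnj (uform (lookup e (y, x)) y x))"
    using e XD by (simp add: h_def sub_mats_def uform_add uform_star sum.distrib)
  also have "(\<Sum>x\<in>F. \<Sum>y\<in>F. cnj (uform (lookup e (y, x)) y x)) = cnj (\<Sum>x\<in>F. \<Sum>y\<in>F. uform (lookup e (x, y)) x y)"
    by (subst sum.swap) simp
  finally have S2: "Re (\<Sum>x\<in>F. \<Sum>y\<in>F. uform (h x y) x y) = 2 * mat_form e"
    by (simp add: S1)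
  define L where "L = (\<Sum>x\<in>F. \<Sum>y\<in>F. norm x * norm y)"
  have "- (2 * mat_form e) \<le> (3 * C * L) * d" if d: "0 < d" for d
  proof -
    define A where "A = (\<lambda>(x, y). uvec (h x y)) ` (F \<times> F)"
    have A: "finite A" "A \<subseteq> X" using F hX by (auto simp: A_def)
    obtain a where a: "a \<in> X" "norm (1 - unitz_emb a) \<le> 1" "\<And>x. x \<in> A \<Longrightarrow> norm (x - x * a) \<le> d"
      using approximate_right_unit_finite[OF X A d] by blast
    have na: "norm a \<le> 2"
      using norm_triangle_ineq4[of 1 "1 - unitz_emb a"] a(2) by simp
    have compress: "norm (uvec (h x y) - star a * uvec (h x y) * a) \<le> 3 * d" if xy: "x \<in> F" "y \<in> F" for x y
    proof -
      define b where "b = uvec (h x y)"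
      \<comment> \<open>\<open>A\<close> contains the adjoint because \<open>h\<close> is hermitian,
        so the right unit \<open>a\<close> also controls multiplication by \<open>star a\<close>
        from the left.\<close>
      have bA: "b \<in> A" "star b \<in> A"
        using xy by (auto simp: A_def b_def hstar[of x y, symmetric] image_iff intro!: bexI[of _ "(x, y)"] bexI[of _ "(y, x)"])
          (metis hstar unitz_sel(17))
      have "norm (b - star a * b * a) = norm ((b - b * a) + (b - star a * b) * a)" by (simp add: algebra_simps)
      then have "norm (b - star a * b * a) \<le> norm (b - b * a) + norm (b - star a * b) * norm a"
        using norm_triangle_ineq[of "b - b * a" "(b - star a * b) * a"] norm_mult_ineq[of "b - star a * b" a]
        by linarith
      also have "norm (b - star a * b) = norm (star b - star b * a)"
        using norm_star[of "b - star a * b"] by (simp add: star_diff star_mult star_star)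
      also have "norm (b - b * a) + norm (star b - star b * a) * norm a \<le> d + d * 2"
        using a(3)[OF bA(1)] a(3)[OF bA(2)] na d by (intro add_mono mult_mono) auto
      finally show ?thesis by (simp add: b_def)
    qed
    define z where "z k x = uvec (w k x * unitz_emb a)" for k x
    have embz: "unitz_emb (z k x) = w k x * unitz_emb a" for k x
      by (rule unitz_eqI) (simp_all add: z_def)
    \<comment> \<open>The scalar part of \<open>h\<close> now multiplies \<open>star a * a\<close>,
      an element of \<open>X\<close>.\<close>
    have gram: "(\<Sum>k<m. star (z k x) * z k y) = star a * uvec (h x y) * a + uscal (h x y) *\<^sub>C (star a * a)" for x y
    proof -
      have "unitz_emb (\<Sum>k<m. star (z k x) * z k y) = star (unitz_emb a) * h x y * unitz_emb a"
        by (simp add: unitz_emb_sum unitz_emb_simps embz star_mult h_def w sum_distrib_left sum_distrib_right mult.assoc)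
      then have "(\<Sum>k<m. star (z k x) * z k y) = uvec (star (unitz_emb a) * h x y * unitz_emb a)"
        by (metis unitz_emb_sel(1))
      then show ?thesis by (simp add: distrib_right scaleC_mult_left)
    qed
    have aa: "star a * a \<in> X" "star a * uvec (h x y) * a \<in> X" for x y using XD a hX by simp_all
    define q where "q x y = cinner x (cbop_apply (g (star a * uvec (h x y) * a)) y)" for x y
    define T where "T = g (star a * a)"
    have "nonneg_complex (\<Sum>x\<in>F. \<Sum>y\<in>F. cinner x (cbop_apply (g (\<Sum>k<m. star (z k x) * z k y)) y))"
      by (rule g_pos[OF F]) (simp add: gram XD aa)
    then have "nonneg_complex (\<Sum>x\<in>F. \<Sum>y\<in>F. q x y + uscal (h x y) * cinner x (cbop_apply T y))"
      by (simp add: gram g_add g_scaleC XD aa q_def T_def plus_cbop_apply scaleC_cbop_apply cinner_add_right cinner_scaleC_right)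
    then have pos1: "0 \<le> Re (\<Sum>x\<in>F. \<Sum>y\<in>F. q x y) + Re (\<Sum>x\<in>F. \<Sum>y\<in>F. uscal (h x y) * cinner x (cbop_apply T y))"
      by (simp add: nonneg_complex_def sum.distrib)
    \<comment> \<open>The scalar parts of the witnesses combine the vectors of \<open>F\<close> into
      \<open>t k\<close>. The scalar term becomes a sum of diagonal values of \<open>T\<close>,
      which can be compared with \<open>4 C\<close>.\<close>
    define t where "t k = (\<Sum>x\<in>F. uscal (w k x) *\<^sub>C x)" for k
    have scal: "(\<Sum>x\<in>F. \<Sum>y\<in>F. uscal (h x y) * cinner x (cbop_apply R y)) = (\<Sum>k<m. cinner (t k) (cbop_apply R (t k)))" for R
    proof -
      have "(\<Sum>x\<in>F. \<Sum>y\<in>F. uscal (h x y) * cinner x (cbop_apply R y))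
          = (\<Sum>x\<in>F. \<Sum>y\<in>F. \<Sum>k<m. cinner (uscal (w k x) *\<^sub>C x) (cbop_apply R (uscal (w k y) *\<^sub>C y)))"
        by (simp add: h_def w uscal_sum sum_distrib_right sum_distrib_left cbop_apply_simps cinner_scaleC_left cinner_scaleC_right mult_ac)
      also have "\<dots> = (\<Sum>x\<in>F. \<Sum>k<m. \<Sum>y\<in>F. cinner (uscal (w k x) *\<^sub>C x) (cbop_apply R (uscal (w k y) *\<^sub>C y)))"
        by (intro sum.cong refl sum.swap)
      also have "\<dots> = (\<Sum>k<m. \<Sum>x\<in>F. \<Sum>y\<in>F. cinner (uscal (w k x) *\<^sub>C x) (cbop_apply R (uscal (w k y) *\<^sub>C y)))"
        by (rule sum.swap)
      also have "\<dots> = (\<Sum>k<m. cinner (t k) (cbop_apply R (t k)))"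
        unfolding t_def cbop_apply_sum_right by (simp only: cinner_sum_left) (simp only: cinner_sum_right)
      finally show ?thesis .
    qed
    have nT: "norm T \<le> 4 * C"
    proof -
      have "norm T \<le> C * (norm a)\<^sup>2" using g_bound[OF aa(1)] by (simp add: T_def cstar_identity)
      also have "\<dots> \<le> C * 2\<^sup>2" using na C by (intro mult_left_mono power_mono) auto
      finally show ?thesis by simp
    qed
    have "Re (cinner v (cbop_apply T v)) \<le> 4 * C * Re (cinner v (cbop_apply cbop_id v))" for v
    proof -
      have "Re (cinner v (cbop_apply T v)) \<le> norm T * norm v * norm v"
        using complex_Re_le_cmod cmod_cinner_cbop_le order_trans by blast
      also have "\<dots> \<le> 4 * C * (norm v * norm v)"
        unfolding mult.assoc[of "norm T"] by (rule mult_right_mono[OF nT]) simp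
      finally show ?thesis by (simp add: cinner_self power2_eq_square flip: of_real_mult)
    qed
    then have "Re (\<Sum>k<m. cinner (t k) (cbop_apply T (t k))) \<le> 4 * C * Re (\<Sum>k<m. cinner (t k) (cbop_apply cbop_id (t k)))"
      by (simp add: sum_distrib_left sum_mono del: cbop_id_apply)
    then have scal_le: "Re (\<Sum>x\<in>F. \<Sum>y\<in>F. uscal (h x y) * cinner x (cbop_apply T y))
        \<le> 4 * C * Re (\<Sum>x\<in>F. \<Sum>y\<in>F. uscal (h x y) * cinner x y)"
      using scal[of T] scal[of cbop_id] by simp
    have "Re (\<Sum>x\<in>F. \<Sum>y\<in>F. q x y) - 3 * C * L * d \<le> Re (\<Sum>x\<in>F. \<Sum>y\<in>F. cinner x (cbop_apply (g (uvec (h x y))) y))"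
    proof -
      have "Re (q x y) - Re (cinner x (cbop_apply (g (uvec (h x y))) y)) \<le> 3 * C * d * (norm x * norm y)"
        if xy: "x \<in> F" "y \<in> F" for x y
      proof -
        define b where "b = uvec (h x y) - star a * uvec (h x y) * a"
        have b: "b \<in> X" using XD hX aa by (simp add: b_def)
        have "norm (g b) \<le> C * (3 * d)"
          using g_bound[OF b] mult_left_mono[OF compress[OF xy] C] by (simp add: b_def)
        then have "norm (g b) * (norm x * norm y) \<le> C * (3 * d) * (norm x * norm y)"
          by (rule mult_right_mono) simp
        then have "cmod (cinner x (cbop_apply (g b) y)) \<le> 3 * C * d * (norm x * norm y)"
          using cmod_cinner_cbop_le[of x "g b" y] by (simp add: mult_ac)
        moreover have "cinner x (cbop_apply (g b) y) = cinner x (cbop_apply (g (uvec (h x y))) y) - q x y"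
          using hX aa by (simp add: b_def q_def g_diff cbop_apply_simps cinner_diff_right)
        ultimately show ?thesis
          using complex_Re_le_cmod[of "- cinner x (cbop_apply (g b) y)"] by (simp add: norm_minus_commute)
      qed
      then have "(\<Sum>x\<in>F. \<Sum>y\<in>F. Re (q x y) - Re (cinner x (cbop_apply (g (uvec (h x y))) y)))
          \<le> (\<Sum>x\<in>F. \<Sum>y\<in>F. 3 * C * d * (norm x * norm y))"
        by (intro sum_mono) auto
      then show ?thesis by (simp add: L_def sum_subtractf sum_distrib_left algebra_simps)
    qed
    moreover have "(\<Sum>x\<in>F. \<Sum>y\<in>F. uform (h x y) x y) = (\<Sum>x\<in>F. \<Sum>y\<in>F. cinner x (cbop_apply (g (uvec (h x y))) y))
        + complex_of_real (4 * C) * (\<Sum>x\<in>F. \<Sum>y\<in>F. uscal (h x y) * cinner x y)"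
      by (simp add: uform_def sum.distrib sum_distrib_left mult.assoc)
    ultimately show ?thesis using S2 scal_le pos1 by simp
  qed
  then have "- (2 * mat_form e) \<le> 0" by (rule nonpos_of_le_epsilon)
  then show ?thesis by simp
qed


text \<open>The domination that Hahn-Banach needs: single entries lie below diagonal multiples of
  the unit, and dominating matrices can be added.\<close>

lemma dominated: "\<exists>e\<in>sub_mats. hermitian_positive (e - v)"
proof -
  have single: "\<exists>e\<in>sub_mats. hermitian_positive (e - Poly_Mapping.single k u)" for k u
  proof (cases k)
    case (Pair x y)
    let ?e = "Poly_Mapping.single (x, x) (((norm u)\<^sup>2 / 2) *\<^sub>R 1) + Poly_Mapping.single (y, y) ((1 / 2) *\<^sub>R 1)"
    have "?e \<in> sub_mats" by (intro sub_mats_closed) (simp_all add: XD(1))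
    moreover have "hermitian_positive (?e - Poly_Mapping.single k u)"
      unfolding Pair by (rule hermitian_positive_dominate_single)
    ultimately show ?thesis by blast
  qed
  have "\<exists>e\<in>sub_mats. hermitian_positive (e - (\<Sum>k\<in>K. Poly_Mapping.single k (lookup v k)))" if "finite K" for K
    using that
  proof (induction K rule: finite_induct)
    case empty
    then show ?case
      by (intro bexI[of _ 0]) (simp_all add: sub_mats_closed hermitian_positive_antihermitian)
  next
    case (insert k K)
    obtain e where e: "e \<in> sub_mats" "hermitian_positive (e - (\<Sum>k\<in>K. Poly_Mapping.single k (lookup v k)))"
      using insert.IH by blast
    obtain e' where e': "e' \<in> sub_mats" "hermitian_positive (e' - Poly_Mapping.single k (lookup v k))"
      using single by blast
    have "hermitian_positive ((e' + e) - (\<Sum>k\<in>insert k K. Poly_Mapping.single k (lookup v k)))"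
      using hermitian_positive_add[OF e'(2) e(2)] insert.hyps by (simp add: algebra_simps)
    then show ?case using sub_mats_closed(2)[OF e'(1) e(1)] by blast
  qed
  from this[of "keys v"] show ?thesis by (simp add: poly_mapping_sum_single)
qed

text \<open>\<open>Inf (R v)\<close> is the infimum of \<open>mat_form\<close> over the matrices of
  the subspace above \<open>v\<close>. A linear functional below it is nonnegative on positive
  \<open>v\<close>, since 0 dominates \<open>- v\<close>, and agrees with \<open>mat_form\<close> on
  the subspace, since it lies below it at both \<open>e\<close> and \<open>- e\<close>.\<close>

lemma extension_functional:
  "\<exists>s. linear s \<and> (\<forall>v. hermitian_positive v \<longrightarrow> 0 \<le> s v) \<and> (\<forall>e\<in>sub_mats. s e = mat_form e)"
proof -
  define R where "R v = mat_form ` {e \<in> sub_mats. hermitian_positive (e - v)}" for v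
  have hp0: "hermitian_positive (0 :: 'h \<times> 'h \<Rightarrow>\<^sub>0 'b unitz)" by (rule hermitian_positive_antihermitian) simp
  have m0: "mat_form 0 = 0" by (simp add: mat_form_def)
  have ne: "R v \<noteq> {}" for v using dominated[of v] by (auto simp: R_def)
  \<comment> \<open>If \<open>e\<close> dominates \<open>v\<close> and \<open>e'\<close> dominates
    \<open>- v\<close>, then \<open>e + e'\<close> is positive and in the subspace. This bounds each
    \<open>R v\<close> below.\<close>
  have pair: "0 \<le> a + b" if "a \<in> R v" "b \<in> R (- v)" for a b v
  proof -
    from that(1) obtain e where e: "e \<in> sub_mats" "hermitian_positive (e - v)" "a = mat_form e"
      unfolding R_def by blast
    from that(2) obtain e' where e': "e' \<in> sub_mats" "hermitian_positive (e' - (- v))" "b = mat_form e'"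
      unfolding R_def by blast
    have "hermitian_positive (e + e')"
      using hermitian_positive_add[OF e(2) e'(2)] by simp
    then show ?thesis
      using mat_form_nonneg[OF sub_mats_closed(2)[OF e(1) e'(1)]] mat_form_add[OF e(1) e'(1)] e e' by simp
  qed
  have bdd: "bdd_below (R v)" for v
  proof -
    obtain b where "b \<in> R (- v)" using ne by blast
    then have "- b \<le> a" if "a \<in> R v" for a using pair[OF that] by fastforce
    then show ?thesis by (rule bdd_belowI)
  qed
  have mem: "mat_form e \<in> R v" if "e \<in> sub_mats" "hermitian_positive (e - v)" for e v
    using that by (auto simp: R_def)
  have lower: "Inf (R v) \<le> mat_form e" if "e \<in> sub_mats" "hermitian_positive (e - v)" for e v
    by (rule cInf_lower[OF mem[OF that] bdd])
  have "sublinear (\<lambda>v. Inf (R v))"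
  proof (rule sublinear_Inf[OF ne bdd])
    fix v v' a b assume "a \<in> R v" "b \<in> R v'"
    then obtain e e' where e: "e \<in> sub_mats" "hermitian_positive (e - v)" "a = mat_form e"
      and e': "e' \<in> sub_mats" "hermitian_positive (e' - v')" "b = mat_form e'"
      by (auto simp: R_def)
    have "hermitian_positive ((e + e') - (v + v'))"
      using hermitian_positive_add[OF e(2) e'(2)] by (simp add: algebra_simps)
    from mem[OF sub_mats_closed(2)[OF e(1) e'(1)] this]
    show "\<exists>c\<in>R (v + v'). c \<le> a + b"
      using mat_form_add[OF e(1) e'(1)] e e' by (metis order_refl)
  next
    fix v a and t :: real assume "a \<in> R v" and t: "0 < t"
    then obtain e where e: "e \<in> sub_mats" "hermitian_positive (e - v)" "a = mat_form e"
      by (auto simp: R_def)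
    have "hermitian_positive (t *\<^sub>R e - t *\<^sub>R v)"
      using hermitian_positive_scaleR[OF e(2), of t] t by (simp add: scaleR_diff_right)
    from mem[OF sub_mats_closed(3)[OF e(1)] this]
    show "\<exists>c\<in>R (t *\<^sub>R v). c \<le> t * a"
      using mat_form_scaleR[OF e(1)] e by (metis order_refl)
  next
    have "Inf (R 0) \<le> 0" using lower[of 0 0] hp0 by (simp add: sub_mats_closed m0)
    moreover have "0 \<le> Inf (R 0)"
      by (rule cInf_greatest[OF ne]) (auto simp: R_def intro: mat_form_nonneg)
    ultimately show "Inf (R 0) = 0" by simp
  qed
  then obtain s where s: "linear s" and le: "\<And>v. s v \<le> Inf (R v)"
    by (rule Hahn_Banach_sublinear) blast
  have "0 \<le> s v" if "hermitian_positive v" for v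
  proof -
    have "s (- v) \<le> 0"
      using le[of "- v"] lower[of 0 "- v"] that by (simp add: sub_mats_closed m0)
    then show ?thesis using linear_neg[OF s, of v] by simp
  qed
  moreover have "s e = mat_form e" if e: "e \<in> sub_mats" for e
  proof -
    have le': "s e \<le> mat_form e" if "e \<in> sub_mats" for e
      using le[of e] lower[OF that, of e] hp0 by simp
    have "s ((- 1) *\<^sub>R e) \<le> mat_form ((- 1) *\<^sub>R e)"
      by (rule le'[OF sub_mats_closed(3)[OF e]])
    then show ?thesis
      using le'[OF e] mat_form_scaleR[OF e, of "- 1"] linear_scale[OF s, of "- 1" e] by simp
  qed
  ultimately show ?thesis using s by blast
qed

section \<open>The sesquilinear form of the extended functional\<close>

context
  fixes s :: "('h \<times> 'h \<Rightarrow>\<^sub>0 'b unitz) \<Rightarrow> real"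
  assumes s: "linear s" and s_pos: "hermitian_positive v \<Longrightarrow> 0 \<le> s v"
    and s_sub: "e \<in> sub_mats \<Longrightarrow> s e = mat_form e"
begin

text \<open>A complex linear functional is recovered from its real part \<open>s\<close> as
  \<open>s(u) - \<i> s(\<i> u)\<close>.\<close>

definition ext_form :: "'b unitz \<Rightarrow> 'h \<Rightarrow> 'h \<Rightarrow> complex" where
  "ext_form u x y = Complex (s (Poly_Mapping.single (x, y) u)) (- s (Poly_Mapping.single (x, y) (\<i> *\<^sub>C u)))"

lemma ext_form_add: "ext_form (u + v) x y = ext_form u x y + ext_form v x y"
  by (simp add: ext_form_def scaleC_add_right single_add linear_add[OF s] complex_eq_iff)

lemma ext_form_scaleR: "ext_form (r *\<^sub>R u) x y = r * ext_form u x y"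
  by (simp add: ext_form_def scaleC_scaleR_commute single_scaleR linear_scale[OF s] complex_eq_iff)

lemma ext_form_scaleC: "ext_form (c *\<^sub>C u) x y = c * ext_form u x y"
proof -
  have i: "ext_form (\<i> *\<^sub>C u) x y = \<i> * ext_form u x y"
    by (simp add: ext_form_def scaleC_scaleC single_uminus linear_neg[OF s] complex_eq_iff)
  have c: "complex_of_real (Re c) + complex_of_real (Im c) * \<i> = c" by (simp add: complex_eq_iff)
  have "(complex_of_real (Re c) + complex_of_real (Im c) * \<i>) *\<^sub>C u = Re c *\<^sub>R u + Im c *\<^sub>R \<i> *\<^sub>C u"
    by (simp only: scaleC_add_left flip: scaleC_scaleC) (simp only: scaleC_of_real)
  then have "ext_form (c *\<^sub>C u) x y = ext_form (Re c *\<^sub>R u + Im c *\<^sub>R \<i> *\<^sub>C u) x y"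
    unfolding c by simp
  also have "\<dots> = (complex_of_real (Re c) + complex_of_real (Im c) * \<i>) * ext_form u x y"
    by (simp add: ext_form_add ext_form_scaleR i algebra_simps)
  finally show ?thesis unfolding c .
qed

text \<open>The difference of the two single-entry matrices is skew-adjoint, so it and its negative
  are both \<open>hermitian_positive\<close>, and \<open>s\<close> vanishes on it.\<close>

lemma ext_form_star: "ext_form (star u) y x = cnj (ext_form u x y)"
proof -
  have eq: "s (Poly_Mapping.single (x, y) u) = s (Poly_Mapping.single (y, x) (star u))" for u
  proof -
    let ?v = "Poly_Mapping.single (x, y) u - Poly_Mapping.single (y, x) (star u)"
    have v: "lookup ?v (a, b) + star (lookup ?v (b, a)) = 0" for a b
      by (cases "a = x"; cases "b = y"; cases "a = y"; cases "b = x")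
        (simp_all add: lookup_minus lookup_single when_def star_diff star_star star_minus)
    have "0 \<le> s ?v" by (rule s_pos, rule hermitian_positive_antihermitian, rule v)
    moreover have "0 \<le> s (- ?v)"
    proof (rule s_pos, rule hermitian_positive_antihermitian)
      fix a b
      show "lookup (- ?v) (a, b) + star (lookup (- ?v) (b, a)) = 0"
        using v[of a b] by (simp only: lookup_uminus star_minus minus_add_distrib[symmetric] minus_zero)
    qed
    ultimately show ?thesis by (simp add: linear_diff[OF s] linear_neg[OF s])
  qed
  show ?thesis
    using eq[of u] eq[of "\<i> *\<^sub>C u"]
    by (simp add: ext_form_def star_scaleC complex_eq_iff single_uminus linear_neg[OF s])
qed

lemma ext_form_sub: "uvec u \<in> X \<Longrightarrow> ext_form u x y = uform u x y"
  using XD(4)[of "uvec u" "\<i>"]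
  by (simp add: ext_form_def s_sub sub_mats_closed mat_form_single uform_scaleC complex_eq_iff)

lemma ext_form_one: "ext_form 1 x y = complex_of_real (4 * C) * cinner x y"
  by (simp add: ext_form_sub XD uform_def g_zero cbop_apply_simps)

lemma ext_form_gram:
  assumes "finite I"
  shows "nonneg_complex (\<Sum>i\<in>I. \<Sum>j\<in>I. ext_form (star (u i) * u j) (x i) (x j))" (is "nonneg_complex ?z")
proof -
  have "cnj ?z = (\<Sum>i\<in>I. \<Sum>j\<in>I. ext_form (star (u j) * u i) (x j) (x i))"
    unfolding cnj_sum by (intro sum.cong refl) (simp add: star_mult star_star flip: ext_form_star)
  also have "\<dots> = ?z" by (rule sum.swap)
  finally have "Im (cnj ?z) = Im ?z" by (rule arg_cong)
  then have "Im ?z = 0" unfolding cnj.sel(2) by linarith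
  moreover have "Re ?z = s (\<Sum>i\<in>I. \<Sum>j\<in>I. Poly_Mapping.single (x i, x j) (star (u i) * u j))"
    by (simp add: ext_form_def linear_sum[OF s])
  ultimately show ?thesis
    using s_pos[OF hermitian_positive_gram[OF assms]] by (simp add: nonneg_complex_def)
qed

text \<open>\<open>u * star u\<close> occurs because \<open>star u\<close> is the element placed at
  \<open>x\<close> in the Cauchy-Schwarz argument; \<open>4 * C\<close> is the value at the
  unit.\<close>

lemma ext_form_square_le: "Re (ext_form (u * star u) x x) \<le> 4 * C * (norm u)\<^sup>2 * (norm x)\<^sup>2"
proof -
  obtain z where z: "star z * z = (norm u)\<^sup>2 *\<^sub>R 1 - u * star u" by (rule norm_square_minus_square)
  have "0 \<le> Re (ext_form (star z * z) x x)"
    using ext_form_gram[of "{()}" "\<lambda>_. z" "\<lambda>_. x"] by (simp add: nonneg_complex_def)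
  moreover have "ext_form ((norm u)\<^sup>2 *\<^sub>R 1) x x = ext_form (star z * z) x x + ext_form (u * star u) x x"
    unfolding z by (simp flip: ext_form_add)
  moreover have "ext_form ((norm u)\<^sup>2 *\<^sub>R 1) x x = complex_of_real (4 * C * (norm u)\<^sup>2 * (norm x)\<^sup>2)"
    by (simp add: ext_form_scaleR ext_form_one cinner_self)
  ultimately have "complex_of_real (4 * C * (norm u)\<^sup>2 * (norm x)\<^sup>2) = ext_form (star z * z) x x + ext_form (u * star u) x x"
    by (simp only:)
  then have "4 * C * (norm u)\<^sup>2 * (norm x)\<^sup>2 = Re (ext_form (star z * z) x x) + Re (ext_form (u * star u) x x)"
    by (metis Re_complex_of_real plus_complex.sel(1))
  then show ?thesis using \<open>0 \<le> Re (ext_form (star z * z) x x)\<close> by linarith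
qed

text \<open>Cauchy-Schwarz between \<open>star u\<close> at the label \<open>x\<close> and the
  scalars \<open>c i\<close> at the labels \<open>y i\<close>. On unit entries the form is a
  multiple of the inner product, so the second factor is the norm of the combined vector, and every
  linear relation among the \<open>y i\<close> is inherited by the form.\<close>

lemma ext_form_bound_sum:
  assumes I: "finite I"
  shows "cmod (\<Sum>i\<in>I. c i * ext_form u x (y i)) \<le> 4 * C * norm u * norm x * norm (\<Sum>i\<in>I. c i *\<^sub>C y i)"
proof -
  define B where "B = (\<Sum>i\<in>I. c i * ext_form u x (y i))"
  define v where "v = (\<Sum>i\<in>I. c i *\<^sub>C y i)"
  define A where "A = 4 * C * (norm u)\<^sup>2 * (norm x)\<^sup>2"
  define N where "N = 4 * C * (norm v)\<^sup>2"
  have quad: "0 \<le> t\<^sup>2 * ((cmod B)\<^sup>2 * A) + 2 * t * (cmod B)\<^sup>2 + N" for t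
  proof -
    \<comment> \<open>The factor \<open>B\<close> adjusts the phase so that each family of cross
      terms sums to the real number \<open>t * (cmod B)^2\<close>.\<close>
    define d where "d = complex_of_real t * B"
    \<comment> \<open>\<open>None\<close> stands for the vector \<open>x\<close> and
      \<open>Some i\<close> for \<open>y i\<close>.\<close>
    define J where "J = insert None (Some ` I)"
    define U where "U j = (case j of None \<Rightarrow> d *\<^sub>C star u | Some i \<Rightarrow> c i *\<^sub>C 1)" for j
    define Z where "Z j = (case j of None \<Rightarrow> x | Some i \<Rightarrow> y i)" for j
    have J: "finite J" using I by (simp add: J_def)
    have sumJ: "(\<Sum>j\<in>J. F j) = F None + (\<Sum>i\<in>I. F (Some i))" for F :: "_ \<Rightarrow> complex"
      unfolding J_def using I by (subst sum.insert) (auto simp: sum.reindex)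
    have 1: "ext_form (star (U None) * U None) (Z None) (Z None) = (t\<^sup>2 * (cmod B)\<^sup>2) * ext_form (u * star u) x x"
    proof -
      have "star (U None) * U None = (cnj d * d) *\<^sub>C (u * star u)"
        by (simp add: U_def star_scaleC star_star scaleC_mult_left scaleC_mult_right scaleC_scaleC mult.commute)
      moreover have "cnj d * d = complex_of_real ((cmod d)\<^sup>2)"
        by (simp only: complex_norm_square mult.commute[of "cnj d"])
      moreover have "(cmod d)\<^sup>2 = t\<^sup>2 * (cmod B)\<^sup>2"
        by (simp add: d_def norm_mult power_mult_distrib)
      ultimately show ?thesis by (simp add: ext_form_scaleC Z_def)
    qed
    have 2: "ext_form (star (U None) * U (Some i)) (Z None) (Z (Some i)) = cnj d * (c i * ext_form u x (y i))" for i
      by (simp add: U_def Z_def star_scaleC star_star scaleC_mult_left scaleC_mult_right ext_form_scaleC)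
    have 3: "ext_form (star (U (Some i)) * U None) (Z (Some i)) (Z None) = cnj (cnj d * (c i * ext_form u x (y i)))" for i
      unfolding 2[symmetric] by (simp add: star_mult star_star flip: ext_form_star)
    have 4: "ext_form (star (U (Some i)) * U (Some j)) (Z (Some i)) (Z (Some j))
        = complex_of_real (4 * C) * cinner (c i *\<^sub>C y i) (c j *\<^sub>C y j)" for i j
      by (simp add: U_def Z_def star_scaleC scaleC_mult_left scaleC_mult_right ext_form_scaleC ext_form_one
          cinner_scaleC_left cinner_scaleC_right)
    have "(\<Sum>i\<in>I. cnj d * (c i * ext_form u x (y i))) = cnj d * B"
      by (simp add: B_def sum_distrib_left)
    also have "\<dots> = complex_of_real (t * (cmod B)\<^sup>2)"
    proof -
      have "B * cnj B = complex_of_real ((cmod B)\<^sup>2)" by (simp only: complex_norm_square)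
      then show ?thesis by (simp add: d_def mult.commute[of "cnj B"])
    qed
    finally have 5: "(\<Sum>i\<in>I. cnj d * (c i * ext_form u x (y i))) = complex_of_real (t * (cmod B)\<^sup>2)" .
    have 6: "(\<Sum>i\<in>I. cnj (cnj d * (c i * ext_form u x (y i)))) = complex_of_real (t * (cmod B)\<^sup>2)"
      unfolding cnj_sum[symmetric] 5 by simp
    have 7: "(\<Sum>i\<in>I. \<Sum>j\<in>I. complex_of_real (4 * C) * cinner (c i *\<^sub>C y i) (c j *\<^sub>C y j)) = complex_of_real N"
    proof -
      have "(\<Sum>i\<in>I. \<Sum>j\<in>I. complex_of_real (4 * C) * cinner (c i *\<^sub>C y i) (c j *\<^sub>C y j)) = complex_of_real (4 * C) * cinner v v"
        unfolding v_def cinner_sum_left unfolding cinner_sum_right by (simp only: sum_distrib_left)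
      then show ?thesis by (simp add: cinner_self N_def)
    qed
    have "(\<Sum>i\<in>J. \<Sum>j\<in>J. ext_form (star (U i) * U j) (Z i) (Z j))
        = (t\<^sup>2 * (cmod B)\<^sup>2) * ext_form (u * star u) x x + 2 * complex_of_real (t * (cmod B)\<^sup>2) + complex_of_real N"
      unfolding sumJ 1 2 3 4 sum.distrib 5 6 7 by simp
    moreover have "0 \<le> Re (\<Sum>i\<in>J. \<Sum>j\<in>J. ext_form (star (U i) * U j) (Z i) (Z j))"
      using ext_form_gram[OF J] by (simp add: nonneg_complex_def)
    ultimately have "0 \<le> t\<^sup>2 * (cmod B)\<^sup>2 * Re (ext_form (u * star u) x x) + 2 * (t * (cmod B)\<^sup>2) + N"
      by (simp flip: of_real_power of_real_mult)
    moreover have "t\<^sup>2 * (cmod B)\<^sup>2 * Re (ext_form (u * star u) x x) \<le> t\<^sup>2 * (cmod B)\<^sup>2 * A"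
      unfolding A_def by (intro mult_left_mono ext_form_square_le) simp
    ultimately show ?thesis by (simp add: mult.assoc)
  qed
  have "(cmod B)\<^sup>2 \<le> A * N"
    by (rule quadratic_nonneg_bound[OF quad]) (simp_all add: A_def N_def C)
  also have "\<dots> = (4 * C * norm u * norm x * norm v)\<^sup>2"
    by (simp add: A_def N_def power2_eq_square)
  finally show ?thesis
    unfolding B_def v_def by (rule power2_le_imp_le) (simp add: C)
qed

lemma ext_form_bound: "cmod (ext_form u x y) \<le> 4 * C * norm u * norm x * norm y"
  using ext_form_bound_sum[of "{()}" "\<lambda>_. 1" u x "\<lambda>_. y"] by simp

text \<open>The bound for the relation \<open>y + y' - (y + y') = 0\<close> has right-hand side
  0.\<close>

lemma ext_form_add_right: "ext_form u x (y + y') = ext_form u x y + ext_form u x y'"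
proof -
  have "ext_form u x y + (ext_form u x y' - ext_form u x (y + y')) = 0"
    using ext_form_bound_sum[of "{0, 1, 2 :: nat}" "\<lambda>i. if i = 2 then - 1 else 1" u x
        "\<lambda>i. if i = 0 then y else if i = 1 then y' else y + y'"]
    by simp
  then show ?thesis by (simp add: complex_eq_iff)
qed

lemma ext_form_scaleC_right: "ext_form u x (c *\<^sub>C y) = c * ext_form u x y"
  using ext_form_bound_sum[of "{0, 1 :: nat}" "\<lambda>i. if i = 0 then c else - 1" u x
      "\<lambda>i. if i = 0 then y else c *\<^sub>C y"]
  by simp

lemma ext_form_flip: "ext_form u x y = cnj (ext_form (star u) y x)"
  using ext_form_star[of "star u" x y] by (simp add: star_star)

lemma extension_of_functional:
  "\<exists>\<Phi>. bounded_clinear \<Phi> \<and> star_preserving \<Phi> \<and> (\<forall>x\<in>X. \<Phi> x = g x) \<and>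
    (\<forall>(I :: nat set) b x. finite I \<longrightarrow>
      nonneg_complex (\<Sum>i\<in>I. \<Sum>j\<in>I. cinner (x i) (cbop_apply (\<Phi> (star (b i) * b j)) (x j))))"
proof -
  have "\<exists>T. (\<forall>x y. cinner x (cbop_apply T y) = ext_form (unitz_emb b) x y) \<and> norm T \<le> 4 * C * norm b" for b
  proof (rule cbop_of_form)
    \<comment> \<open>Linearity is known in the second variable; hermitian symmetry carries it to
      the first.\<close>
    show "ext_form (unitz_emb b) (x + x') y = ext_form (unitz_emb b) x y + ext_form (unitz_emb b) x' y" for x x' y
      by (subst (1 2 3) ext_form_flip) (simp add: ext_form_add_right)
    show "ext_form (unitz_emb b) (c *\<^sub>C x) y = cnj c * ext_form (unitz_emb b) x y" for c x y
      by (subst (1 2) ext_form_flip) (simp add: ext_form_scaleC_right)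
    show "cmod (ext_form (unitz_emb b) x y) \<le> 4 * C * norm b * norm x * norm y" for x y
      using ext_form_bound[of "unitz_emb b" x y] by simp
  qed (simp_all add: ext_form_add_right ext_form_scaleC_right C)
  then obtain \<Phi> where \<Phi>: "\<And>b x y. cinner x (cbop_apply (\<Phi> b) y) = ext_form (unitz_emb b) x y"
    and bd: "\<And>b. norm (\<Phi> b) \<le> 4 * C * norm b" by metis
  have eqI: "S = T" if "\<And>x y. cinner x (cbop_apply S y) = cinner x (cbop_apply T y)" for S T :: "'h cbop"
  proof -
    have "S - T = 0" by (rule cbop_eq_zeroI) (simp add: cbop_apply_simps cinner_diff_right that)
    then show ?thesis by simp
  qed
  have "bounded_linear \<Phi>"
  proof (rule bounded_linear_intro)
    show "\<Phi> (a + b) = \<Phi> a + \<Phi> b" for a b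
      by (rule eqI) (simp add: \<Phi> plus_cbop_apply cinner_add_right unitz_emb_simps ext_form_add)
    show "\<Phi> (r *\<^sub>R b) = r *\<^sub>R \<Phi> b" for r b
      by (rule eqI) (simp add: \<Phi> scaleR_cbop_apply cinner_scaleR_right unitz_emb_simps ext_form_scaleR)
    show "norm (\<Phi> b) \<le> norm b * (4 * C)" for b using bd[of b] by (simp add: mult.commute)
  qed
  moreover have "\<Phi> (c *\<^sub>C b) = c *\<^sub>C \<Phi> b" for c b
    by (rule eqI) (simp add: \<Phi> scaleC_cbop_apply cinner_scaleC_right unitz_emb_simps ext_form_scaleC)
  moreover have "\<Phi> (star b) = star (\<Phi> b)" for b
  proof (rule eqI)
    fix x y
    have "cinner x (cbop_apply (star (\<Phi> b)) y) = cnj (cinner y (cbop_apply (\<Phi> b) x))"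
      unfolding cinner_star_cbop_right by (rule cinner_commute)
    then show "cinner x (cbop_apply (\<Phi> (star b)) y) = cinner x (cbop_apply (star (\<Phi> b)) y)"
      by (simp add: \<Phi> unitz_emb_simps ext_form_star)
  qed
  moreover have "\<Phi> x = g x" if "x \<in> X" for x
    by (rule eqI) (simp add: \<Phi> ext_form_sub that uform_def)
  moreover have "nonneg_complex (\<Sum>i\<in>I. \<Sum>j\<in>I. cinner (x i) (cbop_apply (\<Phi> (star (b i) * b j)) (x j)))"
    if "finite I" for I :: "nat set" and b x
    using ext_form_gram[OF that, of "\<lambda>i. unitz_emb (b i)" x] by (simp add: \<Phi> unitz_emb_simps)
  ultimately show ?thesis
    unfolding bounded_clinear_def star_preserving_def by blast
qed

end

theorem completely_positive_extension:
  "\<exists>\<Phi>. bounded_clinear \<Phi> \<and> star_preserving \<Phi> \<and> (\<forall>x\<in>X. \<Phi> x = g x) \<and>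
    (\<forall>(I :: nat set) b x. finite I \<longrightarrow>
      nonneg_complex (\<Sum>i\<in>I. \<Sum>j\<in>I. cinner (x i) (cbop_apply (\<Phi> (star (b i) * b j)) (x j))))"
  using extension_functional extension_of_functional by blast

end

section \<open>Decomposability\<close>

lemma bounded_linear_cinner_cbop: "bounded_linear (\<lambda>T. cinner x (cbop_apply T y))"
proof (rule bounded_linear_intro)
  show "cmod (cinner x (cbop_apply T y)) \<le> norm T * (norm x * norm y)" for T
    using cmod_cinner_cbop_le[of x T y] by (simp add: mult.assoc)
qed (simp_all add: plus_cbop_apply scaleR_cbop_apply cinner_add_right cinner_scaleR_right scaleR_conv_of_real)

lemma nonneg_complex_sums:
  assumes "u sums z" and "\<And>k. nonneg_complex (u k)"
  shows "nonneg_complex z"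
proof -
  have "(\<lambda>k. Re (u k)) sums Re z" "(\<lambda>k. Im (u k)) sums Im z"
    using assms(1) sums_complex_iff by blast+
  moreover have "Im (u k) = 0" "0 \<le> Re (u k)" for k using assms(2) by (auto simp: nonneg_complex_def)
  ultimately show ?thesis
    unfolding nonneg_complex_def
    using sums_le[OF _ sums_zero, of "\<lambda>k. Re (u k)" "Re z"] sums_unique2[OF _ sums_zero, of "Im z"] by simp
qed

lemma positive_form_sums:
  assumes "\<And>i j. i < n \<Longrightarrow> j < n \<Longrightarrow> (\<lambda>k. S k i j) sums T i j" and "\<And>k. positive_form n (S k)"
  shows "positive_form n T"
  unfolding positive_form_def
proof
  fix x
  have "(\<lambda>k. mform n (S k) x x) sums mform n T x x"
    unfolding mform_def
    by (intro sums_sum bounded_linear.sums[OF bounded_linear_cinner_cbop] assms(1)) auto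
  then show "nonneg_complex (mform n T x x)"
    by (rule nonneg_complex_sums) (use assms(2) in \<open>auto simp: positive_form_def\<close>)
qed

lemma positive_form_cong:
  "(\<And>i j. i < n \<Longrightarrow> j < n \<Longrightarrow> S i j = T i j) \<Longrightarrow> positive_form n S \<longleftrightarrow> positive_form n T"
  by (simp add: positive_form_def mform_def)

text \<open>Each term of the series is positive on every tuple of vectors, and this test survives
  norm convergence of the entries.\<close>

lemma decomposable_imp_positive:
  assumes "decomposable \<phi> f" and A: "A \<in> Gamma_pos n \<phi>"
  shows "map_mat f A \<in> positive_mats n"
proof -
  obtain \<psi> where cp: "\<And>k. completely_positive (\<psi> k)" and sums: "\<And>a. (\<lambda>k. \<psi> k (\<phi> k a)) sums f a"
    using assms(1) by (auto simp: decomposable_def)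
  have Ac: "A \<in> carrier_mat n n" and A\<phi>: "\<And>k. map_mat (\<phi> k) A \<in> positive_mats n"
    using A by (auto simp: Gamma_pos_def)
  have "positive_form n (\<lambda>i j. f (A $$ (i, j)))"
  proof (rule positive_form_sums)
    show "(\<lambda>k. \<psi> k (\<phi> k (A $$ (i, j)))) sums f (A $$ (i, j))" for i j by (rule sums)
    fix k
    have "map_mat (\<psi> k) (map_mat (\<phi> k) A) \<in> positive_mats n"
      using cp[of k] A\<phi> by (auto simp: completely_positive_def)
    then have "positive_form n (\<lambda>i j. map_mat (\<psi> k) (map_mat (\<phi> k) A) $$ (i, j))"
      by (rule positive_form_of_positive_mats)
    then show "positive_form n (\<lambda>i j. \<psi> k (\<phi> k (A $$ (i, j))))"
      using Ac by (subst positive_form_cong[of n _ "\<lambda>i j. map_mat (\<psi> k) (map_mat (\<phi> k) A) $$ (i, j)"]) auto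
  qed
  then have "positive_form n (\<lambda>i j. map_mat f A $$ (i, j))"
    using Ac by (subst positive_form_cong[of n _ "\<lambda>i j. f (A $$ (i, j))"]) auto
  then show ?thesis using Ac by (simp add: positive_mats_iff_positive_form)
qed

section \<open>Corners of the algebra of vanishing sequences\<close>

definition c0_single :: "nat \<Rightarrow> 'a::cstar_algebra \<Rightarrow> 'a c0" where
  "c0_single k a = diag (\<lambda>j. if j = k then a else 0)"

lemma c0_nth_single: "c0_nth (c0_single k a) j = (if j = k then a else 0)"
proof -
  have "(\<lambda>j. if j = k then a else 0) \<longlonglongrightarrow> 0"
    by (rule tendsto_eventually, rule eventually_sequentiallyI[of "Suc k"]) auto
  then show ?thesis by (simp add: c0_single_def diag_inverse)
qed

lemma c0_nth_sum: "c0_nth (\<Sum>i\<in>I. f i) k = (\<Sum>i\<in>I. c0_nth (f i) k)"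
  by (induction I rule: infinite_finite_induct) (simp_all add: c0_rep)

lemma c0_single_simps:
  "c0_single k (a + b) = c0_single k a + c0_single k b"
  "c0_single k (r *\<^sub>R a) = r *\<^sub>R c0_single k a"
  "c0_single k (c *\<^sub>C a) = c *\<^sub>C c0_single k a"
  "c0_single k (a * b) = c0_single k a * c0_single k b"
  "c0_single k (star a) = star (c0_single k a)"
  by (rule c0_eqI; simp add: c0_nth_single c0_rep)+

lemma norm_c0_single_le: "norm (c0_single k a) \<le> norm a"
  by (rule norm_c0_le) (simp add: c0_nth_single)

text \<open>The norm of a remainder is a supremum over tail entries, which tends to 0 for a
  vanishing sequence. Hence the norm convergence required of a decomposition.\<close>

lemma c0_single_sums: "(\<lambda>k. c0_single k (c0_nth c k)) sums c"
  unfolding sums_def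
proof (rule metric_LIMSEQ_I)
  fix e :: real assume e: "0 < e"
  have "c0_nth c \<longlonglongrightarrow> 0" using c0_nth[of c] by simp
  then obtain N where N: "\<And>k. k \<ge> N \<Longrightarrow> norm (c0_nth c k) < e / 2"
    using LIMSEQ_D[of "c0_nth c" 0 "e / 2"] e by auto
  have "dist (\<Sum>k<n. c0_single k (c0_nth c k)) c < e" if n: "n \<ge> N" for n
  proof -
    have "norm ((\<Sum>k<n. c0_single k (c0_nth c k)) - c) \<le> e / 2"
    proof (rule norm_c0_le)
      fix j
      have "c0_nth ((\<Sum>k<n. c0_single k (c0_nth c k)) - c) j = (if j < n then 0 else - c0_nth c j)"
        by (simp add: c0_rep c0_nth_sum c0_nth_single)
      then show "norm (c0_nth ((\<Sum>k<n. c0_single k (c0_nth c k)) - c) j) \<le> e / 2"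
        using N[of j] n e by (auto simp: less_imp_le)
    qed
    then show ?thesis using e by (simp add: dist_norm)
  qed
  then show "\<exists>N. \<forall>n\<ge>N. dist (\<Sum>k<n. c0_single k (c0_nth c k)) c < e" by blast
qed

text \<open>The corner embedding \<open>c0_single k\<close> is a *-homomorphism, so it turns
  \<open>star_mat Y * Y\<close> into a sum of Gram matrices, one for each row of
  \<open>Y\<close>.\<close>

lemma completely_positive_compression:
  fixes \<Phi> :: "'a::cstar_algebra c0 \<Rightarrow> 'h::complex_hilbert_space cbop"
  assumes lin: "bounded_clinear \<Phi>" and star: "star_preserving \<Phi>"
    and pos: "\<And>(I :: nat set) b x. finite I \<Longrightarrow>
      nonneg_complex (\<Sum>i\<in>I. \<Sum>j\<in>I. cinner (x i) (cbop_apply (\<Phi> (star (b i) * b j)) (x j)))"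
  shows "completely_positive (\<lambda>a. \<Phi> (c0_single k a))"
  unfolding completely_positive_def
proof (intro conjI allI ballI)
  have "bounded_linear (c0_single k)"
    by (rule bounded_linear_intro[of _ 1]) (simp_all add: c0_single_simps norm_c0_single_le)
  then show "bounded_clinear (\<lambda>a. \<Phi> (c0_single k a))"
    using lin bounded_linear_compose[of \<Phi> "c0_single k"]
    by (auto simp: bounded_clinear_def c0_single_simps)
  show "star_preserving (\<lambda>a. \<Phi> (c0_single k a))"
    using star by (simp add: star_preserving_def c0_single_simps)
  fix n and A :: "'a mat" assume "A \<in> positive_mats n"
  then obtain Y where Y: "Y \<in> carrier_mat n n" and A: "A = star_mat Y * Y" by (auto simp: positive_mats_def)
  have Ac: "A \<in> carrier_mat n n" using \<open>A \<in> positive_mats n\<close> by (rule positive_mats_carrier)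
  interpret \<Phi>: bounded_linear \<Phi> using lin by (simp add: bounded_clinear_def)
  have c0_sum: "c0_single k (\<Sum>l<n. v l) = (\<Sum>l<n. c0_single k (v l))" for v :: "nat \<Rightarrow> 'a"
    by (rule c0_eqI) (simp add: c0_nth_sum c0_nth_single)
  define b where "b l i = c0_single k (Y $$ (l, i))" for l i
  have entry: "\<Phi> (c0_single k (A $$ (i, j))) = (\<Sum>l<n. \<Phi> (star (b l i) * b l j))" if "i < n" "j < n" for i j
    unfolding A star_mat_mult_entry[OF Y that]
    by (simp add: c0_sum c0_single_simps b_def \<Phi>.sum)
  have "positive_form n (\<lambda>i j. map_mat (\<lambda>a. \<Phi> (c0_single k a)) A $$ (i, j))"
    unfolding positive_form_def
  proof
    fix x
    have "mform n (\<lambda>i j. map_mat (\<lambda>a. \<Phi> (c0_single k a)) A $$ (i, j)) x x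
        = (\<Sum>i<n. \<Sum>j<n. \<Sum>l<n. cinner (x i) (cbop_apply (\<Phi> (star (b l i) * b l j)) (x j)))"
      unfolding mform_def
      by (intro sum.cong refl) (use Ac in \<open>simp add: entry cbop_apply_sum_left cinner_sum_right\<close>)
    also have "\<dots> = (\<Sum>i<n. \<Sum>l<n. \<Sum>j<n. cinner (x i) (cbop_apply (\<Phi> (star (b l i) * b l j)) (x j)))"
      by (intro sum.cong refl sum.swap)
    also have "\<dots> = (\<Sum>l<n. \<Sum>i<n. \<Sum>j<n. cinner (x i) (cbop_apply (\<Phi> (star (b l i) * b l j)) (x j)))"
      by (rule sum.swap)
    also have "nonneg_complex \<dots>" by (intro nonneg_complex_sum pos) simp
    finally show "nonneg_complex (mform n (\<lambda>i j. map_mat (\<lambda>a. \<Phi> (c0_single k a)) A $$ (i, j)) x x)" .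
  qed
  then show "map_mat (\<lambda>a. \<Phi> (c0_single k a)) A \<in> positive_mats n"
    using Ac by (simp add: positive_mats_iff_positive_form)
qed

section \<open>Factorization through the diagonal map\<close>

lemma bounded_linear_diag_map:
  assumes v: "vanishing \<phi>"
  shows "bounded_linear (diag_map \<phi>)"
proof -
  have bl: "bounded_linear (\<phi> k)" for k
    using v by (auto simp: vanishing_def bounded_clinear_def)
  obtain K where K: "\<And>k. onorm (\<phi> k) \<le> K"
  proof -
    have "Bseq (\<lambda>k. onorm (\<phi> k))"
      using v convergent_imp_Bseq convergentI unfolding vanishing_def by blast
    then obtain K where "\<And>k. norm (onorm (\<phi> k)) \<le> K" unfolding Bseq_def by blast
    then show ?thesis using that by (metis abs_le_D1 real_norm_def)
  qed
  show ?thesis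
  proof (rule bounded_linear_intro)
    show "diag_map \<phi> (a + b) = diag_map \<phi> a + diag_map \<phi> b" for a b
      by (rule c0_eqI) (simp add: diag_map_nth[OF v] c0_rep linear_add[OF bounded_linear.linear[OF bl]])
    show "diag_map \<phi> (r *\<^sub>R a) = r *\<^sub>R diag_map \<phi> a" for r a
      by (rule c0_eqI) (simp add: diag_map_nth[OF v] c0_rep linear_scale[OF bounded_linear.linear[OF bl]])
    show "norm (diag_map \<phi> a) \<le> norm a * K" for a
    proof (rule norm_c0_le)
      fix k
      have "norm (\<phi> k a) \<le> onorm (\<phi> k) * norm a" by (rule onorm[OF bl])
      also have "\<dots> \<le> K * norm a" by (intro mult_right_mono K) simp
      finally show "norm (c0_nth (diag_map \<phi> a) k) \<le> norm a * K"
        by (simp add: diag_map_nth[OF v] mult.commute)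
    qed
  qed
qed

lemma diag_map_scaleC:
  assumes v: "vanishing \<phi>"
  shows "diag_map \<phi> (c *\<^sub>C a) = c *\<^sub>C diag_map \<phi> a"
  using v by (intro c0_eqI) (simp add: diag_map_nth[OF v] c0_rep vanishing_def bounded_clinear_def)

text \<open>The one-by-one matrices of \<open>a\<close> and \<open>- a\<close> are both positive
  under every \<open>\<phi> k\<close>, so the quadratic form of \<open>f a\<close> is nonnegative
  and nonpositive. This makes the factor \<open>g\<close> well defined.\<close>

lemma diag_map_zero_imp_zero:
  fixes f :: "'a::cstar_algebra \<Rightarrow> 'h::complex_hilbert_space cbop"
  assumes v: "vanishing \<phi>" and f: "bounded_clinear f"
    and pos: "\<And>n A. A \<in> Gamma_pos n \<phi> \<Longrightarrow> map_mat f A \<in> positive_mats n"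
    and a: "diag_map \<phi> a = 0"
  shows "f a = 0"
proof (rule cbop_eq_zeroI)
  fix x
  have "nonneg_complex (cinner x (cbop_apply (f b) x))" if b: "\<And>k. \<phi> k b = 0" for b
  proof -
    define A where "A = mat 1 1 (\<lambda>_. b)"
    have "map_mat (\<phi> k) A = star_mat (0\<^sub>m 1 1) * 0\<^sub>m 1 1" for k
      by (rule eq_matI) (simp_all add: A_def star_mat_def b)
    then have "A \<in> Gamma_pos 1 \<phi>"
      by (auto simp: Gamma_pos_def positive_mats_def A_def)
    then have "positive_form 1 (\<lambda>i j. map_mat f A $$ (i, j))"
      by (intro positive_form_of_positive_mats pos)
    then have "nonneg_complex (mform 1 (\<lambda>i j. map_mat f A $$ (i, j)) (\<lambda>_. x) (\<lambda>_. x))"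
      by (simp add: positive_form_def)
    then show ?thesis by (simp add: mform_def A_def)
  qed
  moreover have z: "\<phi> k a = 0" for k using diag_map_nth[OF v, of a k] a by (simp add: c0_rep)
  moreover have "\<phi> k (- a) = 0" for k
    using z v linear_neg[of "\<phi> k" a] by (simp add: vanishing_def bounded_clinear_def bounded_linear.linear)
  ultimately have "nonneg_complex (cinner x (cbop_apply (f a) x))" "nonneg_complex (cinner x (cbop_apply (f (- a)) x))"
    by blast+
  moreover have "cinner x (cbop_apply (f (- a)) x) = - cinner x (cbop_apply (f a) x)"
  proof -
    have "f (- a) = 0 - f a"
      using linear_neg[of f a] f by (simp add: bounded_clinear_def bounded_linear.linear)
    then show ?thesis using cbop_apply_simps(6)[of 0 "f a" x] by (simp add: cbop_apply_simps(5))
  qed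
  ultimately show "cinner x (cbop_apply (f a) x) = 0"
    by (simp add: nonneg_complex_def cbop_apply_simps complex_eq_iff)
qed

text \<open>The matrices are padded with zeros because the number of summands may exceed the size of \<open>F\<close>.\<close>

lemma gram_form_nonneg:
  fixes f :: "'a::cstar_algebra \<Rightarrow> 'h::complex_hilbert_space cbop" and m :: nat
  assumes v: "vanishing \<phi>" and f: "bounded_clinear f"
    and pos: "\<And>n A. A \<in> Gamma_pos n \<phi> \<Longrightarrow> map_mat f A \<in> positive_mats n"
    and F: "finite F"
    and a: "\<And>x y. x \<in> F \<Longrightarrow> y \<in> F \<Longrightarrow> diag_map \<phi> (a x y) = (\<Sum>k<m. star (z k x) * z k y)"
  shows "nonneg_complex (\<Sum>x\<in>F. \<Sum>y\<in>F. cinner x (cbop_apply (f (a x y)) y))"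
proof -
  define p where "p = card F"
  obtain h where h: "bij_betw h {..<p} F"
    using ex_bij_betw_nat_finite[OF F] by (auto simp: p_def lessThan_atLeast0)
  have hF: "h i \<in> F" if "i < p" for i using h that by (auto simp: bij_betw_def)
  define N where "N = max p m"
  define A where "A = mat N N (\<lambda>(i, j). if i < p \<and> j < p then a (h i) (h j) else 0)"
  have Ac: "A \<in> carrier_mat N N" by (simp add: A_def)
  have "map_mat (\<phi> l) A \<in> positive_mats N" for l
  proof -
    have \<phi>0: "\<phi> l 0 = 0"
      using v linear_0[of "\<phi> l"] by (simp add: vanishing_def bounded_clinear_def bounded_linear.linear)
    \<comment> \<open>Coordinate \<open>l\<close> of the given Gram relation is a Gram relation for
      the image of \<open>A\<close> under \<open>\<phi> l\<close>.\<close>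
    define Y where "Y = mat N N (\<lambda>(k, j). if k < m \<and> j < p then c0_nth (z k (h j)) l else 0)"
    have Y: "Y \<in> carrier_mat N N" by (simp add: Y_def)
    have "map_mat (\<phi> l) A = star_mat Y * Y"
    proof (rule eq_matI)
      fix i j assume "i < dim_row (star_mat Y * Y)" "j < dim_col (star_mat Y * Y)"
      then have ij: "i < N" "j < N" using Y by (auto simp: star_mat_def)
      have "(star_mat Y * Y) $$ (i, j) = (\<Sum>k<N. star (Y $$ (k, i)) * Y $$ (k, j))"
        by (rule star_mat_mult_entry[OF Y ij])
      also have "\<dots> = (\<Sum>k<N. if k < m then if i < p \<and> j < p then
          star (c0_nth (z k (h i)) l) * c0_nth (z k (h j)) l else 0 else 0)"
        by (intro sum.cong refl) (auto simp: Y_def ij)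
      also have "\<dots> = (\<Sum>k<m. if i < p \<and> j < p then star (c0_nth (z k (h i)) l) * c0_nth (z k (h j)) l else 0)"
        by (rule sum.mono_neutral_cong_right) (auto simp: N_def)
      also have "\<dots> = (if i < p \<and> j < p then c0_nth (\<Sum>k<m. star (z k (h i)) * z k (h j)) l else 0)"
        by (cases "i < p"; cases "j < p") (simp_all add: c0_nth_sum c0_rep)
      also have "\<dots> = map_mat (\<phi> l) A $$ (i, j)"
        using ij by (auto simp: A_def \<phi>0 a[symmetric] hF diag_map_nth[OF v])
      finally show "map_mat (\<phi> l) A $$ (i, j) = (star_mat Y * Y) $$ (i, j)" by simp
    qed (use Ac Y in \<open>auto simp: star_mat_def\<close>)
    then show ?thesis using Y by (auto simp: positive_mats_def)
  qed
  then have "A \<in> Gamma_pos N \<phi>" using Ac by (simp add: Gamma_pos_def)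
  then have "positive_form N (\<lambda>i j. map_mat f A $$ (i, j))"
    by (intro positive_form_of_positive_mats pos)
  \<comment> \<open>Padding the vectors by zero leaves only the entries belonging to
    \<open>F\<close>.\<close>
  then have "nonneg_complex (mform N (\<lambda>i j. map_mat f A $$ (i, j)) (\<lambda>i. if i < p then h i else 0) (\<lambda>i. if i < p then h i else 0))"
    by (simp add: positive_form_def)
  also have "mform N (\<lambda>i j. map_mat f A $$ (i, j)) (\<lambda>i. if i < p then h i else 0) (\<lambda>i. if i < p then h i else 0)
      = (\<Sum>i<N. if i < p then (\<Sum>j<N. if j < p then cinner (h i) (cbop_apply (f (a (h i) (h j))) (h j)) else 0) else 0)"
    unfolding mform_def by (intro sum.cong refl) (auto simp: A_def cbop_apply_simps intro!: sum.cong)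
  also have "\<dots> = (\<Sum>i<p. \<Sum>j<N. if j < p then cinner (h i) (cbop_apply (f (a (h i) (h j))) (h j)) else 0)"
    by (rule sum.mono_neutral_cong_right) (auto simp: N_def)
  also have "\<dots> = (\<Sum>i<p. \<Sum>j<p. cinner (h i) (cbop_apply (f (a (h i) (h j))) (h j)))"
    by (intro sum.cong refl sum.mono_neutral_cong_right) (auto simp: N_def)
  also have "\<dots> = (\<Sum>x\<in>F. \<Sum>y\<in>F. cinner x (cbop_apply (f (a x y)) y))"
    by (simp add: sum.reindex_bij_betw[OF h, symmetric])
  finally show ?thesis .
qed

lemma positive_imp_decomposable:
  fixes f :: "'a::cstar_algebra \<Rightarrow> 'h::complex_hilbert_space cbop"
  assumes v: "vanishing \<phi>" and X: "cstar_subalgebra (range (diag_map \<phi>))" and f: "bounded_clinear f"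
    and pos: "\<And>n A. A \<in> Gamma_pos n \<phi> \<Longrightarrow> map_mat f A \<in> positive_mats n"
  shows "decomposable \<phi> f"
proof -
  interpret f: bounded_linear f using f by (simp add: bounded_clinear_def)
  interpret D: bounded_linear "diag_map \<phi>" by (rule bounded_linear_diag_map[OF v])
  define g where "g x = f (SOME a. diag_map \<phi> a = x)" for x
  have g: "g (diag_map \<phi> a) = f a" for a
  proof -
    define a' where "a' = (SOME a'. diag_map \<phi> a' = diag_map \<phi> a)"
    have "diag_map \<phi> a' = diag_map \<phi> a" unfolding a'_def by (rule someI) (rule refl)
    then have "f (a' - a) = 0"
      by (intro diag_map_zero_imp_zero[OF v f pos]) (simp_all add: D.diff)
    then show ?thesis by (simp add: g_def a'_def f.diff)
  qed
  \<comment> \<open>Completeness of the range enters the bound on \<open>g\<close> through the open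
    mapping theorem.\<close>
  have "closed (range (diag_map \<phi>))"
    using X by (simp add: cstar_subalgebra_def complete_imp_closed)
  then obtain K where K: "0 \<le> K" "\<And>x. x \<in> range (diag_map \<phi>) \<Longrightarrow> \<exists>a. diag_map \<phi> a = x \<and> norm a \<le> K * norm x"
    using open_mapping_bounded_preimages[OF D.bounded_linear_axioms] by blast
  have "cp_on_subalgebra (range (diag_map \<phi>)) g (onorm f * K)"
  proof
    show "cstar_subalgebra (range (diag_map \<phi>))" by (rule X)
    show "0 \<le> onorm f * K" by (simp add: K onorm_pos_le[OF f.bounded_linear_axioms])
    show "g (x + y) = g x + g y" if "x \<in> range (diag_map \<phi>)" "y \<in> range (diag_map \<phi>)" for x y
      using that by (auto simp: g f.add simp flip: D.add)
    show "g (c *\<^sub>C x) = c *\<^sub>C g x" if "x \<in> range (diag_map \<phi>)" for c x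
      using that f by (auto simp: g bounded_clinear_def simp flip: diag_map_scaleC[OF v])
    show "norm (g x) \<le> onorm f * K * norm x" if x: "x \<in> range (diag_map \<phi>)" for x
    proof -
      obtain a where a: "diag_map \<phi> a = x" "norm a \<le> K * norm x" using K(2)[OF x] by blast
      have "norm (g x) \<le> onorm f * norm a" using onorm[OF f.bounded_linear_axioms] g a by metis
      also have "\<dots> \<le> onorm f * (K * norm x)"
        using a(2) by (rule mult_left_mono) (rule onorm_pos_le[OF f.bounded_linear_axioms])
      finally show ?thesis by (simp add: mult.assoc)
    qed
    show "nonneg_complex (\<Sum>x\<in>F. \<Sum>y\<in>F. cinner x (cbop_apply (g (\<Sum>k<m. star (z k x) * z k y)) y))"
      if F: "finite F" and z: "\<And>x y. x \<in> F \<Longrightarrow> y \<in> F \<Longrightarrow> (\<Sum>k<m. star (z k x) * z k y) \<in> range (diag_map \<phi>)"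
      for F :: "'h set" and m :: nat and z
    proof -
      define a where "a x y = (SOME a. diag_map \<phi> a = (\<Sum>k<m. star (z k x) * z k y))" for x y
      have a: "diag_map \<phi> (a x y) = (\<Sum>k<m. star (z k x) * z k y)" if xy: "x \<in> F" "y \<in> F" for x y
      proof -
        obtain b where "diag_map \<phi> b = (\<Sum>k<m. star (z k x) * z k y)" using z[OF xy] by (metis imageE)
        then show ?thesis unfolding a_def by (rule someI)
      qed
      have "nonneg_complex (\<Sum>x\<in>F. \<Sum>y\<in>F. cinner x (cbop_apply (f (a x y)) y))"
        using v f pos F a by (rule gram_form_nonneg)
      then show ?thesis by (simp add: a[symmetric] g)
    qed
  qed
  then obtain \<Phi> where \<Phi>: "bounded_clinear \<Phi>" "star_preserving \<Phi>"
    and ext: "\<forall>x\<in>range (diag_map \<phi>). \<Phi> x = g x"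
    and gram: "\<forall>(I :: nat set) b x. finite I \<longrightarrow>
      nonneg_complex (\<Sum>i\<in>I. \<Sum>j\<in>I. cinner (x i) (cbop_apply (\<Phi> (star (b i) * b j)) (x j)))"
    using cp_on_subalgebra.completely_positive_extension by blast
  interpret \<Phi>: bounded_linear \<Phi> using \<Phi>(1) by (simp add: bounded_clinear_def)
  show ?thesis
    unfolding decomposable_def
  proof (intro exI[of _ "\<lambda>k a. \<Phi> (c0_single k a)"] conjI allI)
    show "completely_positive (\<lambda>a. \<Phi> (c0_single k a))" for k
      using \<Phi> gram by (intro completely_positive_compression) blast+
    \<comment> \<open>\<open>\<Phi>\<close> is continuous, so it applies term by term to the corner
      expansion of \<open>diag_map \<phi> a\<close>, at which it agrees with
      \<open>g\<close>.\<close>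
    show "(\<lambda>k. \<Phi> (c0_single k (\<phi> k a))) sums f a" for a
      using \<Phi>.sums[OF c0_single_sums[of "diag_map \<phi> a"]] ext by (simp add: diag_map_nth[OF v] g)
  qed
qed

theorem theorem3p8:
  fixes \<phi> :: "nat \<Rightarrow> 'a::cstar_algebra \<Rightarrow> 'a"
    and f :: "'a \<Rightarrow> 'h::complex_hilbert_space cbop"
  assumes nonunital: "\<nexists>e::'a. \<forall>x. e * x = x \<and> x * e = x"
    and vanishing: "vanishing \<phi>"
    and star_maps: "\<And>k. star_preserving (\<phi> k)"
    and cstar: "cstar_subalgebra (range (diag_map \<phi>))"
    and f: "bounded_clinear f"
  shows "decomposable \<phi> f \<longleftrightarrow>
    (\<forall>n. \<forall>A\<in>carrier_mat n n. A \<in> Gamma_pos n \<phi> \<longrightarrow> map_mat f A \<in> positive_mats n)"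
proof
  assume "decomposable \<phi> f"
  then show "\<forall>n. \<forall>A\<in>carrier_mat n n. A \<in> Gamma_pos n \<phi> \<longrightarrow> map_mat f A \<in> positive_mats n"
    using decomposable_imp_positive by blast
next
  assume pos: "\<forall>n. \<forall>A\<in>carrier_mat n n. A \<in> Gamma_pos n \<phi> \<longrightarrow> map_mat f A \<in> positive_mats n"
  have "map_mat f A \<in> positive_mats n" if "A \<in> Gamma_pos n \<phi>" for n A
    using pos that by (auto simp: Gamma_pos_def)
  then show "decomposable \<phi> f" by (rule positive_imp_decomposable[OF vanishing cstar f])
qed

end
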